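(* Let $d\in\{1,2,\ldots\}$, $0<\alpha<2\wedge d$, $\delta\in[0,\frac{d-\alpha}{2}]$, $\kappa=\kappa_\delta$, and let $\tilde p$ be the Schrödinger perturbation of the heat kernel of $\Delta^{\alpha/2}$ by $q(x)=\kappa|x|^{-\alpha}$. There is a constant $M\ge1$ such that for all $t\in(0,\infty)$ and $x\in\mathbb{R}^d\setminus\{0\}$, $$\int_{\mathbb{R}^d}\tilde p(t,x,y)\,dy\le M\left(1+t^{\delta/\alpha}|x|^{-\delta}\right).$$
   Context: For $\beta\in(0,d-\alpha)$ let $\kappa_\beta=\frac{2^\alpha\Gamma(\frac{\beta+\alpha}{2})\Gamma(\frac{d-\beta}{2})}{\Gamma(\frac{\beta}{2})\Gamma(\frac{d-\beta-\alpha}{2})}$, and let $\kappa_0=0$. The heat kernel of $\Delta^{\alpha/2}$ is $p(t,x,y)=p_t(y-x)$, where $p_t(x)=(2\pi)^{-d}\int_{\mathbb{R}^d}e^{-t|\xi|^\alpha}e^{-ix\cdot\xi}\,d\xi$. The Schrödinger perturbation of $p$ by $q(x)=\kappa|x|^{-\alpha}$ is $\tilde p=\sum_{n=0}^\infty p_n$ with $p_0=p$ and $p_n(t,x,y)=\int_0^t\int_{\mathbb{R}^d}p(s,x,z)q(z)p_{n-1}(t-s,z,y)\,dz\,ds$ for $n\ge1$ (values in $[0,\infty]$; $\tilde p=p$ if $\delta=0$). *)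

theory Defs
  imports "HOL-Analysis.Analysis"
begin

text \<open>The coupling constant \<open>\<kappa>\<^sub>\<beta>\<close>; it is meant for \<open>0 \<le> \<beta> < d - \<alpha>\<close>, and at \<open>\<beta> = 0\<close> the value is
  prescribed, since the formula would involve the pole of \<open>\<Gamma>\<close> at \<open>0\<close>.\<close>

definition kappa :: "nat \<Rightarrow> real \<Rightarrow> real \<Rightarrow> real" where
  "kappa d \<alpha> \<beta> =
     (if \<beta> = 0 then 0
      else 2 powr \<alpha> * Gamma ((\<beta> + \<alpha>) / 2) * Gamma ((real d - \<beta>) / 2)
           / (Gamma (\<beta> / 2) * Gamma ((real d - \<beta> - \<alpha>) / 2)))"

text \<open>The Fourier integral \<open>p\<^sub>t(x)\<close> for \<open>t > 0\<close>. Its value is real, because the integrand at \<open>-\<xi>\<close> is the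
  complex conjugate of the integrand at \<open>\<xi>\<close>, so \<^const>\<open>Re\<close> only changes the type.\<close>

definition stable_density :: "real \<Rightarrow> real \<Rightarrow> real ^ 'n \<Rightarrow> real" where
  "stable_density \<alpha> t x =
     Re (complex_of_real ((2 * pi) powr (- real CARD('n))) *
         (LINT \<xi>|lborel. complex_of_real (exp (- t * norm \<xi> powr \<alpha>)) *
                         exp (- \<i> * complex_of_real (x \<bullet> \<xi>))))"

text \<open>The heat kernel of \<open>\<Delta>\<^bsup>\<alpha>/2\<^esup>\<close>. The density is nonnegative for \<open>0 < \<alpha> \<le> 2\<close>, so \<^const>\<open>ennreal\<close> does
  not truncate anything.\<close>

definition heat_kernel :: "real \<Rightarrow> real \<Rightarrow> real ^ 'n \<Rightarrow> real ^ 'n \<Rightarrow> ennreal" where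
  "heat_kernel \<alpha> t x y = ennreal (stable_density \<alpha> t (y - x))"

primrec perturbation_term ::
  "(real \<Rightarrow> 'a \<Rightarrow> 'a \<Rightarrow> ennreal) \<Rightarrow> ('a \<Rightarrow> ennreal) \<Rightarrow> nat \<Rightarrow> real \<Rightarrow> 'a \<Rightarrow> 'a::euclidean_space \<Rightarrow> ennreal"
where
  "perturbation_term p q 0 = p"
| "perturbation_term p q (Suc n) =
     (\<lambda>t x y. \<integral>\<^sup>+s\<in>{0<..<t}.
        (\<integral>\<^sup>+z. p s x z * q z * perturbation_term p q n (t - s) z y \<partial>lborel) \<partial>lborel)"

definition schroedinger_perturbation ::
  "(real \<Rightarrow> 'a \<Rightarrow> 'a \<Rightarrow> ennreal) \<Rightarrow> ('a \<Rightarrow> ennreal) \<Rightarrow> real \<Rightarrow> 'a \<Rightarrow> 'a::euclidean_space \<Rightarrow> ennreal" where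
  "schroedinger_perturbation p q t x y = (\<Sum>n. perturbation_term p q n t x y)"

text \<open>The potential \<open>q(x) = \<kappa>|x|\<^bsup>-\<alpha>\<^esup>\<close>. Here \<open>q(0) = 0\<close> because \<open>0 powr (-\<alpha>) = 0\<close>; the value at this
  single point does not affect the integrals above.\<close>

definition hardy_potential :: "real \<Rightarrow> real \<Rightarrow> real ^ 'n \<Rightarrow> ennreal" where
  "hardy_potential \<kappa> \<alpha> x = ennreal (\<kappa> * norm x powr (- \<alpha>))"

end

theory Submission
  imports Defs "HOL-Probability.Probability"
begin

text \<open>
  The function \<open>|x|\<^sup>-\<^sup>\<gamma>\<close> is, up to a constant, \<open>\<integral>\<^sub>0\<^sup>\<infinity> t\<^sup>a p\<^sub>t(x) dt\<close> with \<open>a = (d - \<gamma> - \<alpha>) / \<alpha>\<close>. By the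
  semigroup property it is therefore stationary for the heat flow with source \<open>\<kappa>\<^sub>\<gamma>|x|\<^sup>-\<^sup>\<alpha>|x|\<^sup>-\<^sup>\<gamma>\<close>, and the
  constant \<open>\<kappa>\<^sub>\<gamma>\<close> is found by integrating against a Gaussian. With \<open>\<beta> = \<delta> / 2\<close>, so that \<open>\<kappa>\<^sub>\<beta> < \<kappa>\<^sub>\<delta>\<close>, put
  \<open>\<Phi>(x) = 2 + |x/R|\<^sup>-\<^sup>\<delta> - |x/R|\<^sup>-\<^sup>\<beta> \<ge> 1\<close>. Close to the origin the subtracted term produces the source
  \<open>(\<kappa>\<^sub>\<delta> - \<kappa>\<^sub>\<beta>)|x|\<^sup>-\<^sup>\<alpha>|x/R|\<^sup>-\<^sup>\<beta>\<close>, which absorbs \<open>2\<kappa>\<^sub>\<delta>|x|\<^sup>-\<^sup>\<alpha>\<close>; away from the origin the potential is bounded.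
  Hence \<open>(1 + l t)\<Phi>(x)\<close> is a supersolution for \<open>l t \<le> 1\<close> if \<open>l\<close> is a suitable multiple of \<open>R\<^sup>-\<^sup>\<alpha>\<close>, and it
  dominates all partial sums of the perturbation series. Choosing \<open>R\<close> with \<open>l t = 1\<close> gives the bound.
\<close>

section \<open>Gamma and Gaussian integrals\<close>

text \<open>The power |x|^-\<delta> alone is stationary for the perturbed equation, but it has no
  positive lower bound and cannot dominate the mass of the heat kernel. Adding a constant creates
  the demand \<kappa>|x|^-\<alpha>; if \<delta> < \<alpha>, growth in time cannot meet it, because
  |x|^-\<alpha> is not bounded by a multiple of 1 + |x|^-\<delta>. Subtracting |x|^-\<beta> helps
  only if its coupling constant is strictly smaller. Here \<delta> \<le> (d - \<alpha>) / 2 enters: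
  the constants are symmetric under \<beta> -> d - \<alpha> - \<beta> and increase only up to the
  midpoint. The kernel is defined by an oscillating integral, so its sign, its dependence on |x|
  alone and its total mass have to be derived first. After that all identities live in
  [0, infinity]; a difference such as \<Phi> is treated by adding the subtracted part on both sides
  and cancelling it, which needs its finiteness. The length R is tied to the time by R^\<alpha> ~ t,
  so a linear factor in time suffices.\<close>

lemma gamma_nn_integral:
  fixes a c :: real
  assumes "a > 0" "c > 0"
  shows "(\<integral>\<^sup>+u\<in>{0<..}. ennreal (u powr (a - 1) * exp (- c * u)) \<partial>lborel) = ennreal (Gamma a * c powr (- a))"
proof -
  have "(\<integral>\<^sup>+u\<in>{0<..}. ennreal (u powr (a - 1) * exp (- c * u)) \<partial>lborel)
     = ennreal \<bar>1/c\<bar> * (\<integral>\<^sup>+u. ennreal ((0 + (1/c) * u) powr (a - 1) * exp (- c * (0 + (1/c) * u))) * indicator {0<..} (0 + (1/c) * u) \<partial>lborel)"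
    using assms by (subst nn_integral_real_affine[where c = "1/c" and t = 0]) auto
  also have "\<dots> = ennreal (1/c) * (\<integral>\<^sup>+u. ennreal (c powr (1 - a)) * ennreal (indicator {0..} u * u powr (a - 1) / exp u) \<partial>lborel)"
  proof -
    have "ennreal ((0 + (1/c) * u) powr (a - 1) * exp (- c * (0 + (1/c) * u))) * indicator {0<..} (0 + (1/c) * u)
        = ennreal (c powr (1 - a)) * ennreal (indicator {0..} u * u powr (a - 1) / exp u)" for u
    proof (cases "u > 0")
      case True
      have "(1/c * u) powr (a - 1) = c powr (1 - a) * u powr (a - 1)"
        using True assms powr_minus[of c "a - 1"] by (simp add: powr_divide field_simps)
      thus ?thesis using True assms by (simp add: exp_minus ennreal_mult[symmetric] divide_inverse)
    next
      case False
      hence "\<not> 1/c * u > 0" using assms by (simp add: zero_less_divide_iff)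
      thus ?thesis using False by (cases "u = 0") auto
    qed
    thus ?thesis using assms by simp
  qed
  also have "\<dots> = ennreal (1/c) * (ennreal (c powr (1 - a)) * ennreal (Gamma a))"
    by (subst nn_integral_cmult) (auto simp: Gamma_conv_nn_integral_real[OF assms(1)])
  also have "\<dots> = ennreal (Gamma a * c powr (- a))"
    using assms by (simp add: ennreal_mult[symmetric] Gamma_real_nonneg powr_diff powr_minus field_simps)
  finally show ?thesis .
qed

lemma nn_integral_affine_euclidean:
  fixes f :: "'a::euclidean_space \<Rightarrow> ennreal"
  assumes [measurable]: "f \<in> borel_measurable borel" and "c \<noteq> 0"
  shows "(\<integral>\<^sup>+x. f x \<partial>lborel) = ennreal (\<bar>c\<bar> ^ DIM('a)) * (\<integral>\<^sup>+x. f (t + c *\<^sub>R x) \<partial>lborel)"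
  by (subst lborel_affine[OF \<open>c \<noteq> 0\<close>, of t])
     (simp add: nn_integral_density nn_integral_distr nn_integral_cmult)

lemma integral_affine_euclidean:
  fixes f :: "'a::euclidean_space \<Rightarrow> 'b::{banach, second_countable_topology}"
  assumes [measurable]: "f \<in> borel_measurable borel" and "c \<noteq> 0"
  shows "(LINT x|lborel. f x) = \<bar>c\<bar> ^ DIM('a) *\<^sub>R (LINT x|lborel. f (t + c *\<^sub>R x))"
  by (subst lborel_affine[OF \<open>c \<noteq> 0\<close>, of t])
     (simp add: integral_density integral_distr)

text \<open>The substitution by \<open>c = sqrt (2 * s)\<close> reduces both claims to the
  characteristic function of the standard normal law.\<close>

lemma gaussian_fourier_real:
  fixes s x :: real
  assumes "s > 0"
  shows "integrable lborel (\<lambda>u. exp (\<i> * complex_of_real (x * u)) * complex_of_real (exp (- s * u\<^sup>2)))" (is ?I)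
    and "(LINT u|lborel. exp (\<i> * complex_of_real (x * u)) * complex_of_real (exp (- s * u\<^sup>2)))
       = complex_of_real (sqrt (pi / s) * exp (- x\<^sup>2 / (4 * s)))" (is ?E)
proof -
  define c where "c = sqrt (2 * s)"
  have c: "c > 0" "c\<^sup>2 = 2 * s" using assms by (auto simp: c_def)
  define f :: "real \<Rightarrow> complex" where
    "f u = complex_of_real (std_normal_density u) * iexp ((x / c) * u)" for u
  have int: "integrable lborel f"
    unfolding f_def
    by (rule Bochner_Integration.integrable_bound[OF integrable_normal_density[of 1 0]])
       (auto simp: norm_mult)
  have fE: "(LINT u|lborel. f u) = complex_of_real (exp (- (x / c)\<^sup>2 / 2))"
    unfolding f_def
    using fun_cong[OF char_std_normal_distribution, of "x / c"]
    unfolding char_def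
    by (subst (asm) integral_density) (auto simp: scaleR_conv_of_real)
  have conv: "exp (\<i> * complex_of_real (x * u)) * complex_of_real (exp (- s * u\<^sup>2))
      = sqrt (2 * pi) *\<^sub>R f (0 + c * u)" for u
    using c by (simp add: f_def normal_density_def power_mult_distrib scaleR_conv_of_real mult_ac
                  field_simps del: of_real_mult)
  show ?I
    unfolding conv using lborel_integrable_real_affine[OF int, of c 0] c by auto
  have "(LINT u|lborel. f u) = c *\<^sub>R (LINT u|lborel. f (0 + c * u))"
    using lborel_integral_real_affine[of c f 0] c by simp
  hence "(LINT u|lborel. f (0 + c * u)) = complex_of_real (exp (- (x / c)\<^sup>2 / 2)) /\<^sub>R c"
    using fE c by simp
  moreover have "- (x / c)\<^sup>2 / 2 = - x\<^sup>2 / (4 * s)" using c by (simp add: power_divide)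
  moreover have "complex_of_real e /\<^sub>R c = complex_of_real (e / c)" for e
    using c by (simp add: scaleR_conv_of_real field_simps)
  ultimately have *: "(LINT u|lborel. f (0 + c * u)) = complex_of_real (exp (- x\<^sup>2 / (4 * s)) / c)"
    by (simp only:)
  have "sqrt (2 * pi) / c = sqrt (pi / s)"
    unfolding c_def real_sqrt_divide[symmetric] by simp
  hence q: "sqrt (2 * pi) = sqrt (pi / s) * c" using c by (simp add: field_simps)
  have "(LINT u|lborel. exp (\<i> * complex_of_real (x * u)) * complex_of_real (exp (- s * u\<^sup>2)))
      = sqrt (2 * pi) *\<^sub>R (LINT u|lborel. f (0 + c * u))"
    unfolding conv by (rule integral_scaleR_right)
  thus ?E unfolding * q using c by (simp add: scaleR_conv_of_real)
qed

lemma norm_power2_eq_sum_Basis: "(norm (x::'a::euclidean_space))\<^sup>2 = (\<Sum>b\<in>Basis. (x \<bullet> b)\<^sup>2)"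
  unfolding power2_norm_eq_inner by (subst euclidean_inner) (simp only: power2_eq_square)

text \<open>The complex exponential is kept because, unlike the cosine, it factors over the
  coordinates, so that the integral is a product of one-dimensional ones.\<close>

lemma gaussian_fourier_complex:
  fixes x :: "'a::euclidean_space" and s :: real
  assumes "s > 0"
  shows "integrable lborel (\<lambda>\<xi>. exp (\<i> * complex_of_real (x \<bullet> \<xi>)) * complex_of_real (exp (- s * (norm \<xi>)\<^sup>2)))" (is "integrable _ ?g")
    and "(LINT \<xi>|lborel. exp (\<i> * complex_of_real (x \<bullet> \<xi>)) * complex_of_real (exp (- s * (norm \<xi>)\<^sup>2)))
       = complex_of_real ((pi / s) powr (real DIM('a) / 2) * exp (- (norm x)\<^sup>2 / (4 * s)))"
proof -
  interpret product_sigma_finite "\<lambda>_::'a. lborel :: real measure" ..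
  let ?T = "\<lambda>f. \<Sum>b\<in>Basis. f b *\<^sub>R b :: 'a"
  define h where "h b u = exp (\<i> * complex_of_real ((x \<bullet> b) * u)) * complex_of_real (exp (- s * u\<^sup>2))" for b u
  have hi: "integrable lborel (h b)" for b
    unfolding h_def[abs_def] by (rule gaussian_fourier_real(1)[OF assms])
  have T: "?T \<in> measurable (\<Pi>\<^sub>M b\<in>Basis. lborel) borel" by measurable
  have g[measurable]: "?g \<in> borel_measurable borel" by measurable
  have gT: "?g (?T f) = (\<Prod>b\<in>Basis. h b (f b))" for f
  proof -
    have "x \<bullet> ?T f = (\<Sum>b\<in>Basis. (x \<bullet> b) * f b)" by (simp add: inner_sum_right mult.commute)
    moreover have "(norm (?T f))\<^sup>2 = (\<Sum>b\<in>Basis. (f b)\<^sup>2)"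
      unfolding norm_power2_eq_sum_Basis by (intro sum.cong refl) (simp add: inner_sum_left_Basis)
    ultimately show ?thesis
      by (simp add: h_def prod.distrib exp_sum[symmetric] sum_distrib_left sum_negf flip: of_real_prod)
  qed
  show "integrable lborel ?g"
    unfolding lborel_eq[where 'a='a] integrable_distr_eq[OF T g] gT
    by (intro product_integrable_prod hi) auto
  have "(LINT \<xi>|lborel. ?g \<xi>) = integral\<^sup>L (\<Pi>\<^sub>M b\<in>Basis. lborel) (\<lambda>f. \<Prod>b\<in>Basis. h b (f b))"
    unfolding lborel_eq[where 'a='a] integral_distr[OF T g] gT ..
  also have "\<dots> = (\<Prod>b\<in>Basis. LINT u|lborel. h b u)"
    by (intro product_integral_prod hi) auto
  also have "\<dots> = (\<Prod>b\<in>(Basis::'a set). complex_of_real (sqrt (pi / s) * exp (- (x \<bullet> b)\<^sup>2 / (4 * s))))"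
    unfolding h_def[abs_def] by (intro prod.cong refl gaussian_fourier_real(2)[OF assms])
  also have "\<dots> = complex_of_real (sqrt (pi / s) ^ DIM('a) * exp (\<Sum>b\<in>Basis. - (x \<bullet> b)\<^sup>2 / (4 * s)))"
    by (simp add: prod.distrib exp_sum)
  also have "(\<Sum>b\<in>Basis. - (x \<bullet> b)\<^sup>2 / (4 * s)) = - (norm x)\<^sup>2 / (4 * s)"
    by (simp add: norm_power2_eq_sum_Basis sum_divide_distrib sum_negf)
  also have "sqrt (pi / s) ^ DIM('a) = (pi / s) powr (real DIM('a) / 2)"
  proof -
    have "pi / s > 0" using assms by simp
    hence "sqrt (pi / s) ^ DIM('a) = ((pi / s) powr (1 / 2)) powr real DIM('a)"
      by (simp only: powr_half_sqrt[OF less_imp_le] powr_realpow real_sqrt_gt_zero)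
    thus ?thesis by (simp only: powr_powr) simp
  qed
  finally show "(LINT \<xi>|lborel. ?g \<xi>) = complex_of_real ((pi / s) powr (real DIM('a) / 2) * exp (- (norm x)\<^sup>2 / (4 * s)))" .
qed

lemma gaussian_fourier:
  fixes x :: "'a::euclidean_space" and s :: real
  assumes "s > 0"
  shows "(LINT \<xi>|lborel. exp (- s * (norm \<xi>)\<^sup>2) * cos (x \<bullet> \<xi>))
       = (pi / s) powr (real DIM('a) / 2) * exp (- (norm x)\<^sup>2 / (4 * s))"
proof -
  have "(LINT \<xi>|lborel. exp (- s * (norm \<xi>)\<^sup>2) * cos (x \<bullet> \<xi>))
      = (LINT \<xi>|lborel. Re (exp (\<i> * complex_of_real (x \<bullet> \<xi>)) * complex_of_real (exp (- s * (norm \<xi>)\<^sup>2))))"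
    by (intro Bochner_Integration.integral_cong) (auto simp: Re_exp)
  also have "\<dots> = Re (LINT \<xi>|lborel. exp (\<i> * complex_of_real (x \<bullet> \<xi>)) * complex_of_real (exp (- s * (norm \<xi>)\<^sup>2)))"
    by (rule integral_Re[OF gaussian_fourier_complex(1)[OF assms]])
  finally show ?thesis unfolding gaussian_fourier_complex(2)[OF assms] by simp
qed

lemma gaussian_integrable:
  fixes s :: real
  assumes "s > 0"
  shows "integrable lborel (\<lambda>\<xi>::'a::euclidean_space. exp (- s * (norm \<xi>)\<^sup>2))"
  using integrable_norm[OF gaussian_fourier_complex(1)[OF assms, of 0]] by simp

lemma gaussian_nn_integral:
  fixes s :: real
  assumes "s > 0"
  shows "(\<integral>\<^sup>+\<xi>. ennreal (exp (- s * (norm \<xi>)\<^sup>2)) \<partial>(lborel :: 'a::euclidean_space measure))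
    = ennreal ((pi / s) powr (real DIM('a) / 2))"
  using gaussian_fourier[OF assms, of "0::'a"]
  by (subst nn_integral_eq_integral[OF gaussian_integrable[OF assms]]) auto

text \<open>Domination by a product of two integrable functions is how the hypothesis of Fubini's
  theorem is checked for every oscillating double integral below.\<close>

lemma integrable_pair_bound:
  fixes h :: "'a::euclidean_space \<Rightarrow> 'b::euclidean_space \<Rightarrow> real"
  assumes [measurable]: "case_prod h \<in> borel_measurable (borel \<Otimes>\<^sub>M borel)"
    and F: "integrable lborel F" and K: "integrable lborel K"
    and le: "\<And>x y. \<bar>h x y\<bar> \<le> F x * K y"
  shows "integrable (lborel \<Otimes>\<^sub>M lborel) (case_prod h)"
proof (rule lborel_pair.Fubini_integrable)
  show "case_prod h \<in> borel_measurable (lborel \<Otimes>\<^sub>M lborel)" by simp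
  have hx: "integrable lborel (h x)" for x
    by (rule Bochner_Integration.integrable_bound[OF integrable_mult_right[OF K, of "F x"]])
       (use le in \<open>auto intro: order_trans[OF _ abs_ge_self]\<close>)
  thus "AE x in lborel. integrable lborel (\<lambda>y. case_prod h (x, y))" by simp
  have "integrable lborel (\<lambda>x. LINT y|lborel. \<bar>h x y\<bar>)"
  proof (rule Bochner_Integration.integrable_bound)
    show "integrable lborel (\<lambda>x. F x * (LINT y|lborel. K y))" using F by simp
    show "AE x in lborel. norm (LINT y|lborel. \<bar>h x y\<bar>) \<le> norm (F x * (LINT y|lborel. K y))"
    proof (rule AE_I2)
      fix x
      have "0 \<le> (LINT y|lborel. \<bar>h x y\<bar>)" by simp
      moreover have "(LINT y|lborel. \<bar>h x y\<bar>) \<le> (LINT y|lborel. F x * K y)"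
        using hx K le by (intro integral_mono) auto
      ultimately show "norm (LINT y|lborel. \<bar>h x y\<bar>) \<le> norm (F x * (LINT y|lborel. K y))" by simp
    qed
  qed measurable
  thus "integrable lborel (\<lambda>x. LINT y|lborel. norm (case_prod h (x, y)))" by simp
qed

lemma powr_nn_integral:
  fixes b t :: real
  assumes "b > 0" "t \<ge> 0"
  shows "(\<integral>\<^sup>+u\<in>{0<..<t}. ennreal (b * u powr (b - 1)) \<partial>lborel) = ennreal (t powr b)"
proof -
  have "((\<lambda>u. b * u powr (b - 1)) has_integral (b * (t powr (b - 1 + 1) / (b - 1 + 1)))) {0..t}"
    using assms by (intro has_integral_mult_right has_integral_powr_from_0) auto
  hence "((\<lambda>u. b * u powr (b - 1)) has_integral t powr b) {0..t}" using assms by simp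
  hence "((\<lambda>u. b * u powr (b - 1)) has_integral t powr b) {0<..<t}"
    by (simp add: has_integral_Icc_iff_Ioo)
  thus ?thesis using assms by (intro nn_integral_has_integral_lebesgue') auto
qed

text \<open>\<open>u powr (- 1 - a) * (1 - exp (- u * r))\<close> is the integral of
  \<open>u powr (- a) * exp (- s * u)\<close> over 0 < s < r. After the interchange the
  \<open>u\<close>-integral is \<open>Gamma (1 - a) * s powr (a - 1)\<close>, and the
  \<open>s\<close>-integral yields the power of \<open>r\<close>. This is the Bernstein
  representation of \<open>r powr a\<close>.\<close>

lemma one_minus_exp_nn_integral:
  fixes a r :: real
  assumes a: "0 < a" "a < 1" and r: "0 \<le> r"
  shows "(\<integral>\<^sup>+u\<in>{0<..}. ennreal (u powr (- 1 - a) * (1 - exp (- u * r))) \<partial>lborel)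
    = ennreal (Gamma (1 - a) / a * r powr a)"
proof -
  have inner: "ennreal (u powr (- 1 - a) * (1 - exp (- u * r)))
     = (\<integral>\<^sup>+s. ennreal (u powr (- a) * exp (- s * u)) * indicator {0<..<r} s \<partial>lborel)" if "u > 0" for u
  proof -
    have "((\<lambda>s. u powr (- a) * exp (- s * u)) has_integral
        (- (u powr (- 1 - a) * exp (- r * u)) - - (u powr (- 1 - a) * exp (- 0 * u)))) {0..r}"
    proof (rule fundamental_theorem_of_calculus[OF r])
      fix s assume "s \<in> {0..r}"
      have *: "u powr (- 1 - a) * u = u powr (- a)"
        using powr_add[of u "- 1 - a" 1] that by simp
      show "((\<lambda>s. - (u powr (- 1 - a) * exp (- s * u))) has_vector_derivative
              u powr (- a) * exp (- s * u)) (at s within {0..r})"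
        unfolding has_real_derivative_iff_has_vector_derivative[symmetric]
        by (rule derivative_eq_intros refl)+ (simp add: *[symmetric])
    qed
    hence "((\<lambda>s. u powr (- a) * exp (- s * u)) has_integral
        (u powr (- 1 - a) * (1 - exp (- u * r)))) {0<..<r}"
      by (simp add: has_integral_Icc_iff_Ioo algebra_simps)
    thus ?thesis
      by (intro nn_integral_has_integral_lebesgue'[symmetric]) auto
  qed
  have "(\<integral>\<^sup>+u\<in>{0<..}. ennreal (u powr (- 1 - a) * (1 - exp (- u * r))) \<partial>lborel)
    = (\<integral>\<^sup>+u. \<integral>\<^sup>+s. ennreal (u powr (- a) * exp (- s * u)) * indicator {0<..<r} s * indicator {0<..} u \<partial>lborel \<partial>lborel)"
  proof (intro nn_integral_cong)
    fix u :: real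
    show "ennreal (u powr (- 1 - a) * (1 - exp (- u * r))) * indicator {0<..} u
        = (\<integral>\<^sup>+s. ennreal (u powr (- a) * exp (- s * u)) * indicator {0<..<r} s * indicator {0<..} u \<partial>lborel)"
      by (cases "u > 0") (simp_all only: inner, simp_all)
  qed
  also have "\<dots> = (\<integral>\<^sup>+s. \<integral>\<^sup>+u. ennreal (u powr (- a) * exp (- s * u)) * indicator {0<..<r} s * indicator {0<..} u \<partial>lborel \<partial>lborel)"
    by (rule lborel_pair.Fubini') simp
  also have "\<dots> = (\<integral>\<^sup>+s. (\<integral>\<^sup>+u\<in>{0<..}. ennreal (u powr ((1 - a) - 1) * exp (- s * u)) \<partial>lborel) * indicator {0<..<r} s \<partial>lborel)"
    by (intro nn_integral_cong, subst nn_integral_multc[symmetric]) (auto simp: mult_ac)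
  also have "\<dots> = (\<integral>\<^sup>+s. ennreal (Gamma (1 - a) / a) * (ennreal (a * s powr (a - 1)) * indicator {0<..<r} s) \<partial>lborel)"
  proof (intro nn_integral_cong)
    fix s :: real
    show "(\<integral>\<^sup>+u\<in>{0<..}. ennreal (u powr ((1 - a) - 1) * exp (- s * u)) \<partial>lborel) * indicator {0<..<r} s
        = ennreal (Gamma (1 - a) / a) * (ennreal (a * s powr (a - 1)) * indicator {0<..<r} s)"
    proof (cases "0 < s \<and> s < r")
      case True
      thus ?thesis using a by (subst gamma_nn_integral) (auto simp: ennreal_mult[symmetric] Gamma_real_nonneg)
    qed (auto split: split_indicator)
  qed
  also have "\<dots> = ennreal (Gamma (1 - a) / a) * (\<integral>\<^sup>+s\<in>{0<..<r}. ennreal (a * s powr (a - 1)) \<partial>lborel)"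
    by (subst nn_integral_cmult) auto
  also have "\<dots> = ennreal (Gamma (1 - a) / a * r powr a)"
    unfolding powr_nn_integral[OF a(1) r] using a by (simp add: ennreal_mult[symmetric] Gamma_real_nonneg)
  finally show ?thesis .
qed

section \<open>Gaussian mixtures\<close>

text \<open>The Gaussian factor makes the integral converge for every bounded measurable
  \<open>\<phi>\<close>; the normalising constant of Fourier inversion is left out. It is applied to
  the symbol exp (-t|\<xi>|^\<alpha>) and, when the transform is inverted, to the density
  itself.\<close>

definition gauss_cos :: "real \<Rightarrow> ('a::euclidean_space \<Rightarrow> real) \<Rightarrow> 'a \<Rightarrow> real" where
  "gauss_cos s \<phi> x = (LINT \<xi>|lborel. exp (- s * (norm \<xi>)\<^sup>2) * \<phi> \<xi> * cos (x \<bullet> \<xi>))"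

text \<open>
  For \<open>\<phi>(\<xi>) = exp (-t|\<xi>|\<^sup>\<alpha>)\<close> the inverse Fourier transform is a limit of \<^const>\<open>gauss_cos\<close> as \<open>s\<close> tends to
  \<open>0\<close>. Unlike positivity of the transform itself, the property below makes sense for all bounded
  \<open>\<phi>\<close> and passes to pointwise limits, so it can be derived from approximations of \<open>|\<xi>|\<^sup>\<alpha>\<close>.
\<close>

definition pos_radial :: "('a::euclidean_space \<Rightarrow> real) \<Rightarrow> bool" where
  "pos_radial \<phi> \<longleftrightarrow> \<phi> \<in> borel_measurable borel \<and> (\<exists>B. \<forall>\<xi>. \<bar>\<phi> \<xi>\<bar> \<le> B) \<and>
     (\<forall>s>0. \<forall>x y. norm x \<le> norm y \<longrightarrow> 0 \<le> gauss_cos s \<phi> y \<and> gauss_cos s \<phi> y \<le> gauss_cos s \<phi> x)"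

lemma gauss_cos_integrable:
  fixes \<phi> :: "'a::euclidean_space \<Rightarrow> real"
  assumes [measurable]: "\<phi> \<in> borel_measurable borel" and B: "\<And>\<xi>. \<bar>\<phi> \<xi>\<bar> \<le> B" and "s > 0"
  shows "integrable lborel (\<lambda>\<xi>. exp (- s * (norm \<xi>)\<^sup>2) * \<phi> \<xi> * cos (x \<bullet> \<xi>))"
proof (rule Bochner_Integration.integrable_bound[OF integrable_mult_right[OF gaussian_integrable[OF \<open>s > 0\<close>], of B]])
  show "AE \<xi> in lborel. norm (exp (- s * (norm \<xi>)\<^sup>2) * \<phi> \<xi> * cos (x \<bullet> \<xi>)) \<le> norm (B * exp (- s * (norm \<xi>)\<^sup>2))"
  proof (rule AE_I2)
    fix \<xi>
    have "\<bar>\<phi> \<xi>\<bar> * \<bar>cos (x \<bullet> \<xi>)\<bar> \<le> \<bar>B\<bar> * 1"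
      using B[of \<xi>] by (intro mult_mono) auto
    thus "norm (exp (- s * (norm \<xi>)\<^sup>2) * \<phi> \<xi> * cos (x \<bullet> \<xi>)) \<le> norm (B * exp (- s * (norm \<xi>)\<^sup>2))"
      by (simp add: abs_mult mult.assoc mult.commute[of "\<bar>B\<bar>"])
  qed
qed simp

lemma pos_radialD:
  assumes "pos_radial \<phi>"
  shows "\<phi> \<in> borel_measurable borel" "\<exists>B. \<forall>\<xi>. \<bar>\<phi> \<xi>\<bar> \<le> B"
    "s > 0 \<Longrightarrow> norm x \<le> norm y \<Longrightarrow> 0 \<le> gauss_cos s \<phi> y"
    "s > 0 \<Longrightarrow> norm x \<le> norm y \<Longrightarrow> gauss_cos s \<phi> y \<le> gauss_cos s \<phi> x"
  using assms unfolding pos_radial_def by blast+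

lemma pos_radial_one: "pos_radial (\<lambda>_::'a::euclidean_space. 1)"
proof -
  have "exp (- (norm y)\<^sup>2 / (4 * s)) \<le> exp (- (norm x)\<^sup>2 / (4 * s))"
    if "s > 0" "norm x \<le> norm y" for s and x y :: 'a
    using that by (auto intro!: divide_right_mono power_mono)
  thus ?thesis unfolding pos_radial_def gauss_cos_def
    by (auto simp: gaussian_fourier[simplified] intro!: mult_left_mono)
qed

lemma pos_radial_cmult:
  assumes "pos_radial \<phi>" "c \<ge> 0"
  shows "pos_radial (\<lambda>\<xi>. c * \<phi> \<xi>)"
proof -
  obtain B where B: "\<bar>\<phi> \<xi>\<bar> \<le> B" for \<xi> using pos_radialD(2)[OF assms(1)] by auto
  have "\<bar>c * \<phi> \<xi>\<bar> \<le> c * B" for \<xi> using B[of \<xi>] assms(2) by (simp add: abs_mult mult_left_mono)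
  moreover have "gauss_cos s (\<lambda>\<xi>. c * \<phi> \<xi>) x = c * gauss_cos s \<phi> x" for s x
    unfolding gauss_cos_def by (simp add: mult.left_commute mult.assoc flip: integral_mult_right_zero)
  ultimately show ?thesis
    using assms pos_radialD[OF assms(1)] unfolding pos_radial_def
    by (auto intro: mult_left_mono)
qed

lemma pos_radial_add:
  assumes "pos_radial \<phi>" "pos_radial \<psi>"
  shows "pos_radial (\<lambda>\<xi>. \<phi> \<xi> + \<psi> \<xi>)"
proof -
  note [measurable] = pos_radialD(1)[OF assms(1)] pos_radialD(1)[OF assms(2)]
  obtain B where B: "\<bar>\<phi> \<xi>\<bar> \<le> B" for \<xi> using pos_radialD(2)[OF assms(1)] by auto
  obtain C where C: "\<bar>\<psi> \<xi>\<bar> \<le> C" for \<xi> using pos_radialD(2)[OF assms(2)] by auto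
  have "\<bar>\<phi> \<xi> + \<psi> \<xi>\<bar> \<le> B + C" for \<xi> using B[of \<xi>] C[of \<xi>] by linarith
  moreover have "gauss_cos s (\<lambda>\<xi>. \<phi> \<xi> + \<psi> \<xi>) x = gauss_cos s \<phi> x + gauss_cos s \<psi> x" if "s > 0" for s x
    unfolding gauss_cos_def using gauss_cos_integrable[OF pos_radialD(1)[OF assms(1)] B that] gauss_cos_integrable[OF pos_radialD(1)[OF assms(2)] C that]
    by (simp add: ring_distribs)
  ultimately show ?thesis
    using pos_radialD[OF assms(1)] pos_radialD[OF assms(2)] unfolding pos_radial_def
    by (auto intro!: add_mono add_nonneg_nonneg)
qed

text \<open>A bound \<open>B\<close> uniform in \<open>n\<close> lets \<open>B\<close> times the
  Gaussian factor dominate all integrands, so \<open>gauss_cos\<close> passes to the limit and the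
  inequalities with it.\<close>

lemma pos_radial_lim:
  assumes "\<And>n. pos_radial (\<Phi> n)" and B: "\<And>n \<xi>. \<bar>\<Phi> n \<xi>\<bar> \<le> B"
    and lim: "\<And>\<xi>. (\<lambda>n. \<Phi> n \<xi>) \<longlonglongrightarrow> \<phi> \<xi>"
  shows "pos_radial \<phi>"
proof -
  have meas: "\<phi> \<in> borel_measurable borel" "\<Phi> n \<in> borel_measurable borel" for n
    using borel_measurable_LIMSEQ_metric[OF pos_radialD(1)[OF assms(1)]] lim pos_radialD(1)[OF assms(1)] by auto
  note [measurable] = meas
  have "\<bar>\<phi> \<xi>\<bar> \<le> B" for \<xi>
    by (rule LIMSEQ_le_const2[OF tendsto_rabs[OF lim]]) (use B in auto)
  have G: "(\<lambda>n. gauss_cos s (\<Phi> n) x) \<longlonglongrightarrow> gauss_cos s \<phi> x" if "s > 0" for s x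
    unfolding gauss_cos_def
  proof (rule integral_dominated_convergence)
    show "integrable lborel (\<lambda>\<xi>::'a. B * exp (- s * (norm \<xi>)\<^sup>2))"
      by (rule integrable_mult_right[OF gaussian_integrable[OF that]])
    show "AE \<xi> in lborel. norm (exp (- s * (norm \<xi>)\<^sup>2) * \<Phi> n \<xi> * cos (x \<bullet> \<xi>)) \<le> B * exp (- s * (norm \<xi>)\<^sup>2)" for n
    proof (rule AE_I2)
      fix \<xi>
      have "\<bar>\<Phi> n \<xi>\<bar> * \<bar>cos (x \<bullet> \<xi>)\<bar> \<le> B * 1"
        using B[of n \<xi>] by (intro mult_mono) auto
      thus "norm (exp (- s * (norm \<xi>)\<^sup>2) * \<Phi> n \<xi> * cos (x \<bullet> \<xi>)) \<le> B * exp (- s * (norm \<xi>)\<^sup>2)"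
        by (simp add: abs_mult mult.assoc mult.commute[of B])
    qed
    show "AE \<xi> in lborel. (\<lambda>n. exp (- s * (norm \<xi>)\<^sup>2) * \<Phi> n \<xi> * cos (x \<bullet> \<xi>)) \<longlonglongrightarrow> exp (- s * (norm \<xi>)\<^sup>2) * \<phi> \<xi> * cos (x \<bullet> \<xi>)"
      by (intro AE_I2 tendsto_intros lim)
  qed simp_all
  have "0 \<le> gauss_cos s \<phi> y" "gauss_cos s \<phi> y \<le> gauss_cos s \<phi> x" if "s > 0" "norm x \<le> norm y" for s x y
    using LIMSEQ_le_const[OF G[OF that(1)]] LIMSEQ_le[OF G[OF that(1)] G[OF that(1)]]
      pos_radialD(3,4)[OF assms(1) that] by auto
  thus ?thesis using meas(1) \<open>\<And>\<xi>. \<bar>\<phi> \<xi>\<bar> \<le> B\<close> unfolding pos_radial_def by blast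
qed

text \<open>The Laplace transform of the weight \<open>w\<close> at |\<xi>|^2. For a nonnegative
  \<open>w\<close> that vanishes on \<open>u \<le> 0\<close> it is a positive mixture of Gaussians
  in \<open>\<xi>\<close>.\<close>

definition laplace :: "(real \<Rightarrow> real) \<Rightarrow> 'a::euclidean_space \<Rightarrow> real" where
  "laplace w \<xi> = (LINT u|lborel. w u * exp (- u * (norm \<xi>)\<^sup>2))"

lemma laplace_measurable[measurable]:
  assumes [measurable]: "w \<in> borel_measurable borel"
  shows "laplace w \<in> borel_measurable borel"
  unfolding laplace_def[abs_def] by measurable

lemma laplace_bounds:
  assumes w: "integrable lborel w" "\<And>u. w u \<ge> 0" "\<And>u. u \<le> 0 \<Longrightarrow> w u = 0"
  shows "integrable lborel (\<lambda>u. w u * exp (- u * (norm \<xi>)\<^sup>2))"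
    and "0 \<le> laplace w \<xi>" "laplace w \<xi> \<le> (LINT u|lborel. w u)"
proof -
  have le: "w u * exp (- u * (norm \<xi>)\<^sup>2) \<le> w u" for u
  proof (cases "u \<le> 0")
    case False
    thus ?thesis using w(2)[of u] by (simp add: mult_left_le)
  qed (simp add: w)
  show I: "integrable lborel (\<lambda>u. w u * exp (- u * (norm \<xi>)\<^sup>2))"
    using w le by (intro Bochner_Integration.integrable_bound[OF w(1)]) auto
  show "0 \<le> laplace w \<xi>" unfolding laplace_def using w(2) by simp
  show "laplace w \<xi> \<le> (LINT u|lborel. w u)"
    unfolding laplace_def using le I w(1) by (intro integral_mono) auto
qed

text \<open>Multiplying \<open>\<phi>\<close> by exp (-u|\<xi>|^2) merely replaces \<open>s\<close>
  by \<open>s + u\<close> in \<open>gauss_cos\<close>. The product therefore yields the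
  \<open>w\<close>-weighted integral of \<open>gauss_cos (s + u) \<phi> x\<close> over
  \<open>u\<close>, and the inequalities are inherited.\<close>

lemma pos_radial_laplace_mult:
  fixes \<phi> :: "'a::euclidean_space \<Rightarrow> real"
  assumes w: "integrable lborel w" "\<And>u. w u \<ge> 0" "\<And>u. u \<le> 0 \<Longrightarrow> w u = 0"
    and \<phi>: "pos_radial \<phi>"
  shows "pos_radial (\<lambda>\<xi>. laplace w \<xi> * \<phi> \<xi>)"
proof -
  note [measurable] = pos_radialD(1)[OF \<phi>] borel_measurable_integrable[OF w(1), simplified]
  obtain B where B: "\<bar>\<phi> \<xi>\<bar> \<le> B" for \<xi> using pos_radialD(2)[OF \<phi>] by auto
  have bd: "\<bar>laplace w \<xi> * \<phi> \<xi>\<bar> \<le> (LINT u|lborel. w u) * B" for \<xi>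
    unfolding abs_mult using laplace_bounds[OF w, of \<xi>] B[of \<xi>] by (intro mult_mono) auto
  define h where "h s x u \<xi> = w u * (exp (- (s + u) * (norm \<xi>)\<^sup>2) * \<phi> \<xi> * cos (x \<bullet> \<xi>))" for s x u \<xi>
  have hint: "integrable (lborel \<Otimes>\<^sub>M lborel) (case_prod (h s x))" if "s > 0" for s x
  proof (rule integrable_pair_bound[OF _ w(1)])
    show "integrable lborel (\<lambda>\<xi>::'a. B * exp (- s * (norm \<xi>)\<^sup>2))"
      by (rule integrable_mult_right[OF gaussian_integrable[OF that]])
    show "\<bar>h s x u \<xi>\<bar> \<le> w u * (B * exp (- s * (norm \<xi>)\<^sup>2))" for u \<xi>
    proof (cases "u \<le> 0")
      case False
      have "\<bar>\<phi> \<xi>\<bar> * \<bar>cos (x \<bullet> \<xi>)\<bar> \<le> B * 1" using B[of \<xi>] by (intro mult_mono) auto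
      moreover have "exp (- (s + u) * (norm \<xi>)\<^sup>2) \<le> exp (- s * (norm \<xi>)\<^sup>2)" using False
        by (simp add: algebra_simps)
      ultimately have "exp (- (s + u) * (norm \<xi>)\<^sup>2) * (\<bar>\<phi> \<xi>\<bar> * \<bar>cos (x \<bullet> \<xi>)\<bar>) \<le> exp (- s * (norm \<xi>)\<^sup>2) * (B * 1)"
        by - (rule mult_mono, auto)
      thus ?thesis unfolding h_def using w(2)[of u]
        by (simp add: abs_mult mult_left_mono mult.assoc mult.commute[of B] del: minus_add_distrib)
    qed (simp add: h_def w)
    show "case_prod (h s x) \<in> borel_measurable (borel \<Otimes>\<^sub>M borel)"
      unfolding h_def by measurable
  qed
  have hL: "(LINT \<xi>|lborel. h s x u \<xi>) = w u * gauss_cos (s + u) \<phi> x" for s x u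
    unfolding h_def gauss_cos_def by simp
  have hI: "integrable lborel (\<lambda>u. w u * gauss_cos (s + u) \<phi> x)" if "s > 0" for s x
    using lborel_pair.integrable_fst[OF hint[OF that]] unfolding hL .
  have eq: "gauss_cos s (\<lambda>\<xi>. laplace w \<xi> * \<phi> \<xi>) x = (LINT u|lborel. w u * gauss_cos (s + u) \<phi> x)" if "s > 0" for s x
  proof -
    have "gauss_cos s (\<lambda>\<xi>. laplace w \<xi> * \<phi> \<xi>) x = (LINT \<xi>|lborel. LINT u|lborel. h s x u \<xi>)"
      unfolding gauss_cos_def laplace_def h_def
      by (intro Bochner_Integration.integral_cong refl)
         (simp add: ring_distribs exp_add mult_ac exp_diff exp_minus divide_inverse flip: integral_mult_left_zero integral_mult_right_zero)
    also have "\<dots> = (LINT u|lborel. LINT \<xi>|lborel. h s x u \<xi>)"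
      by (rule lborel_pair.Fubini_integral[OF hint[OF that]])
    finally show ?thesis unfolding hL .
  qed
  have le: "w u * gauss_cos (s + u) \<phi> y \<le> w u * gauss_cos (s + u) \<phi> x \<and> 0 \<le> w u * gauss_cos (s + u) \<phi> y"
    if "s > 0" "norm x \<le> norm y" for s x y u
  proof (cases "u \<le> 0")
    case False
    hence "s + u > 0" using that by simp
    thus ?thesis
      using pos_radialD(3,4)[OF \<phi> _ that(2)] w(2)[of u] by (auto intro!: mult_left_mono)
  qed (simp_all add: w)
  have "0 \<le> gauss_cos s (\<lambda>\<xi>. laplace w \<xi> * \<phi> \<xi>) y \<and>
      gauss_cos s (\<lambda>\<xi>. laplace w \<xi> * \<phi> \<xi>) y \<le> gauss_cos s (\<lambda>\<xi>. laplace w \<xi> * \<phi> \<xi>) x"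
    if "s > 0" "norm x \<le> norm y" for s x y
    unfolding eq[OF that(1)] using le[OF that] hI[OF that(1)]
    by (auto intro!: integral_mono integral_nonneg_AE)
  thus ?thesis unfolding pos_radial_def using bd by (auto intro!: exI[of _ "(LINT u|lborel. w u) * B"])
qed

text \<open>The exponential series has nonnegative coefficients, and the powers in it arise by
  repeated use of \<open>pos_radial_laplace_mult\<close>.\<close>

lemma pos_radial_exp_laplace:
  fixes w :: "real \<Rightarrow> real"
  assumes w: "integrable lborel w" "\<And>u. w u \<ge> 0" "\<And>u. u \<le> 0 \<Longrightarrow> w u = 0"
  shows "pos_radial (\<lambda>\<xi>::'a::euclidean_space. exp (laplace w \<xi>))"
proof (rule pos_radial_lim)
  let ?T = "\<lambda>k (\<xi>::'a). inverse (fact k) * laplace w \<xi> ^ k"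
  have pow: "pos_radial (\<lambda>\<xi>::'a. laplace w \<xi> ^ n)" for n
    by (induction n) (auto intro: pos_radial_one pos_radial_laplace_mult[OF w])
  show "pos_radial (\<lambda>\<xi>. \<Sum>k<n. ?T k \<xi>)" for n
  proof (induction n)
    case 0
    show ?case using pos_radial_cmult[OF pos_radial_one, of 0] by simp
  next
    case (Suc n)
    thus ?case by (auto intro!: pos_radial_add pos_radial_cmult pow)
  qed
  have sums: "(\<lambda>k. ?T k \<xi>) sums exp (laplace w \<xi>)" for \<xi>
    using exp_converges[of "laplace w \<xi>"] by simp
  thus "(\<lambda>n. \<Sum>k<n. ?T k \<xi>) \<longlonglongrightarrow> exp (laplace w \<xi>)" for \<xi> by (simp add: sums_def)
  have nn: "0 \<le> ?T k \<xi>" for k \<xi> using laplace_bounds(2)[OF w, of \<xi>] by simp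
  have "(\<Sum>k<n. ?T k \<xi>) \<le> exp (laplace w \<xi>)" for n \<xi>
    using sum_le_suminf[OF sums_summable[OF sums], of "{..<n}"] nn sums_unique[OF sums] by simp
  hence "\<bar>\<Sum>k<n. ?T k \<xi>\<bar> \<le> exp (laplace w \<xi>)" for n \<xi>
    unfolding abs_of_nonneg[OF sum_nonneg[OF nn]] .
  thus "\<bar>\<Sum>k<n. ?T k \<xi>\<bar> \<le> exp (LINT u|lborel. w u)" for n \<xi>
    by (rule order_trans) (simp add: laplace_bounds(3)[OF w])
qed

text \<open>
  The approximations truncate the integral \<open>c|\<xi>|\<^sup>\<alpha> = \<integral>\<^sub>0\<^sup>\<infinity> (1 - exp (-u|\<xi>|\<^sup>2)) u\<^sup>-\<^sup>1\<^sup>-\<^sup>\<alpha>\<^sup>/\<^sup>2 du\<close> to a compact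
  interval, where both parts of the integrand are integrable.
\<close>

lemma pos_radial_stable:
  fixes \<alpha> t :: real
  assumes \<alpha>: "0 < \<alpha>" "\<alpha> < 2" and t: "t \<ge> 0"
  shows "pos_radial (\<lambda>\<xi>::'a::euclidean_space. exp (- t * norm \<xi> powr \<alpha>))"
proof (rule pos_radial_lim)
  define a where "a = \<alpha> / 2"
  have a: "0 < a" "a < 1" using \<alpha> by (auto simp: a_def)
  \<comment> \<open>\<open>c\<close> is the constant produced by
    \<open>one_minus_exp_nn_integral\<close>; dividing the weight by it makes the limit exactly
    t|\<xi>|^\<alpha>.\<close>
  define c where "c = Gamma (1 - a) / a"
  have c: "c > 0" using a by (simp add: c_def Gamma_real_pos)
  define I where "I n = {1 / (real n + 1)..real n + 1}" for n
  define w where "w n u = (t / c) * (indicator (I n) u * u powr (- 1 - a))" for n u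
  have wi: "integrable lborel (w n)" for n
  proof -
    have "set_integrable lborel (I n) (\<lambda>u. u powr (- 1 - a))"
      unfolding I_def
    proof (rule borel_integrable_atLeastAtMost')
      have "u > 0" if "u \<ge> 1 / (real n + 1)" for u :: real
        using that by (smt (verit) divide_pos_pos of_nat_0_le_iff)
      thus "continuous_on {1 / (real n + 1)..real n + 1} (\<lambda>u. u powr (- 1 - a))"
        by (intro continuous_intros) force
    qed
    thus ?thesis unfolding w_def set_integrable_def by (intro integrable_mult_right) simp
  qed
  have I0: "u > 0" if "u \<in> I n" for u n
    using that unfolding I_def by (smt (verit) atLeastAtMost_iff divide_pos_pos of_nat_0_le_iff)
  have w0: "w n u \<ge> 0" "u \<le> 0 \<Longrightarrow> w n u = 0" for n u
    using t c I0[of u n] by (auto simp: w_def indicator_def)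
  note w = wi w0
  let ?M = "\<lambda>n. LINT u|lborel. w n u"
  \<comment> \<open>The two factors combine to the exponential of minus the truncated integral, the
    characteristic function of a compound Poisson law. \<open>?M n\<close> does not depend on
    \<open>\<xi>\<close>, so the first factor is just a nonnegative constant.\<close>
  show "pos_radial (\<lambda>\<xi>::'a. exp (- ?M n) * exp (laplace (w n) \<xi>))" for n
    by (intro pos_radial_cmult pos_radial_exp_laplace w) auto
  show "\<bar>exp (- ?M n) * exp (laplace (w n) \<xi>)\<bar> \<le> 1" for n and \<xi> :: 'a
    using laplace_bounds(3)[OF w, of n \<xi>] by (simp flip: exp_add)
  fix \<xi> :: 'a
  define r where "r = (norm \<xi>)\<^sup>2"
  define f where "f u = (t / c) * (indicator {0<..} u * (u powr (- 1 - a) * (1 - exp (- u * r))))" for u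
  have f0: "indicator {0<..} u * (u powr (- 1 - a) * (1 - exp (- u * r))) \<ge> 0" for u :: real
    by (auto simp: r_def split: split_indicator)
  have ra: "r powr a = norm \<xi> powr \<alpha>"
    by (cases "\<xi> = 0") (auto simp: r_def a_def powr_powr simp flip: powr_numeral)
  have "has_bochner_integral lborel (\<lambda>u. indicator {0<..} u * (u powr (- 1 - a) * (1 - exp (- u * r)))) (c * r powr a)"
  proof (rule has_bochner_integral_nn_integral)
    have "(\<integral>\<^sup>+u. ennreal (indicator {0<..} u * (u powr (- 1 - a) * (1 - exp (- u * r)))) \<partial>lborel)
      = (\<integral>\<^sup>+u\<in>{0<..}. ennreal (u powr (- 1 - a) * (1 - exp (- u * r))) \<partial>lborel)"
      by (intro nn_integral_cong) (auto split: split_indicator)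
    thus "(\<integral>\<^sup>+u. ennreal (indicator {0<..} u * (u powr (- 1 - a) * (1 - exp (- u * r)))) \<partial>lborel) = ennreal (c * r powr a)"
      unfolding c_def by (subst (asm) one_minus_exp_nn_integral[OF a]) (auto simp: r_def)
  qed (use f0 c in auto)
  hence "has_bochner_integral lborel f (t / c * (c * r powr a))"
    unfolding f_def by (rule has_bochner_integral_mult_right)
  hence f: "integrable lborel f" "(LINT u|lborel. f u) = t * norm \<xi> powr \<alpha>"
    using c ra by (auto simp: has_bochner_integral_iff)
  have "?M n - laplace (w n) \<xi> = (LINT u|lborel. w n u * (1 - exp (- u * r)))" for n
    unfolding laplace_def r_def[symmetric] using laplace_bounds(1)[OF w, of n \<xi>] wi[of n]
    by (simp add: right_diff_distrib r_def flip: Bochner_Integration.integral_diff)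
  moreover have "(\<lambda>n. LINT u|lborel. w n u * (1 - exp (- u * r))) \<longlonglongrightarrow> (LINT u|lborel. f u)"
  proof (rule integral_dominated_convergence[OF _ _ f(1)])
    show "AE u in lborel. norm (w n u * (1 - exp (- u * r))) \<le> f u" for n
    proof (rule AE_I2)
      fix u
      show "norm (w n u * (1 - exp (- u * r))) \<le> f u"
      proof (cases "u \<in> I n")
        case True
        hence "u > 0" by (rule I0)
        thus ?thesis using True t c by (simp add: w_def f_def abs_mult r_def)
      qed (use f0[of u] t c in \<open>simp add: w_def f_def\<close>)
    qed
    show "AE u in lborel. (\<lambda>n. w n u * (1 - exp (- u * r))) \<longlonglongrightarrow> f u"
    proof (rule AE_I2)
      fix u :: real
      show "(\<lambda>n. w n u * (1 - exp (- u * r))) \<longlonglongrightarrow> f u"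
      proof (cases "u > 0")
        case True
        obtain N where N: "real N > max u (1 / u)" using reals_Archimedean2 by blast
        have "u \<in> I n" if "n \<ge> N" for n
        proof -
          have "real n \<ge> real N" using that by simp
          hence "real n + 1 \<ge> 1 / u" "real n + 1 \<ge> u" using N by linarith+
          thus ?thesis unfolding I_def using True by (simp add: field_simps)
        qed
        hence "\<forall>\<^sub>F n in sequentially. w n u * (1 - exp (- u * r)) = f u"
          unfolding eventually_sequentially using True by (intro exI[of _ N]) (simp add: w_def f_def)
        thus ?thesis by (rule tendsto_eventually)
      qed (use w0(2)[of u] in \<open>simp add: f_def\<close>)
    qed
  qed (use f wi in auto)
  ultimately have "(\<lambda>n. ?M n - laplace (w n) \<xi>) \<longlonglongrightarrow> t * norm \<xi> powr \<alpha>"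
    using f(2) by simp
  hence "(\<lambda>n. exp (- (?M n - laplace (w n) \<xi>))) \<longlonglongrightarrow> exp (- (t * norm \<xi> powr \<alpha>))"
    by (intro tendsto_intros)
  thus "(\<lambda>n. exp (- ?M n) * exp (laplace (w n) \<xi>)) \<longlonglongrightarrow> exp (- t * norm \<xi> powr \<alpha>)"
    by (simp add: exp_diff exp_minus field_simps)
qed

section \<open>Stable densities\<close>

lemma power_exp_bound:
  fixes y t :: real
  assumes "t > 0" "y \<ge> 0"
  shows "y ^ k * exp (- t * y) \<le> fact k / t ^ k"
proof -
  have "(\<lambda>n. (t * y) ^ n /\<^sub>R fact n) sums exp (t * y)" by (rule exp_converges)
  moreover have "0 \<le> (t * y) ^ n /\<^sub>R fact n" for n using assms by simp
  ultimately have "(\<Sum>n\<in>{k}. (t * y) ^ n /\<^sub>R fact n) \<le> exp (t * y)"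
    using sum_le_suminf[of "\<lambda>n. (t * y) ^ n /\<^sub>R fact n" "{k}"] by (auto simp: sums_iff)
  thus ?thesis using assms
    by (simp add: power_mult_distrib exp_minus field_simps)
qed

text \<open>Polar coordinates are avoided: a Gamma integral writes the function as a superposition
  of Gaussians, whose space integrals contribute \<open>u powr (- D / 2)\<close>, where
  \<open>D\<close> is the dimension. The exponent \<open>D\<close> then leaves the weight
  \<open>u powr (D / 2 - 1)\<close>, which is integrable near 0.\<close>

lemma integrable_inverse_power:
  "integrable lborel (\<lambda>\<xi>::'a::euclidean_space. (1 + (norm \<xi>)\<^sup>2) powr (- real DIM('a)))"
proof (rule integrableI_bounded)
  let ?D = "real DIM('a)"
  have D: "?D > 0" by simp
  have eq: "ennreal ((1 + (norm \<xi>)\<^sup>2) powr (- ?D))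
     = ennreal (1 / Gamma ?D) * (\<integral>\<^sup>+u\<in>{0<..}. ennreal (u powr (?D - 1) * exp (- (1 + (norm \<xi>)\<^sup>2) * u)) \<partial>lborel)" for \<xi> :: 'a
    using D by (subst gamma_nn_integral) (auto simp: ennreal_mult[symmetric] Gamma_real_pos add_pos_nonneg less_imp_neq[OF Gamma_real_pos, symmetric])
  have "(\<integral>\<^sup>+\<xi>. ennreal (norm ((1 + (norm \<xi>)\<^sup>2) powr (- ?D))) \<partial>(lborel :: 'a measure))
    = ennreal (1 / Gamma ?D) * (\<integral>\<^sup>+\<xi>. (\<integral>\<^sup>+u\<in>{0<..}. ennreal (u powr (?D - 1) * exp (- (1 + (norm (\<xi>::'a))\<^sup>2) * u)) \<partial>lborel) \<partial>lborel)"
    by (simp add: eq nn_integral_cmult del: ennreal_1)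
  also have "(\<integral>\<^sup>+\<xi>. (\<integral>\<^sup>+u\<in>{0<..}. ennreal (u powr (?D - 1) * exp (- (1 + (norm (\<xi>::'a))\<^sup>2) * u)) \<partial>lborel) \<partial>lborel)
     = (\<integral>\<^sup>+u. \<integral>\<^sup>+\<xi>. ennreal (u powr (?D - 1) * exp (- (1 + (norm (\<xi>::'a))\<^sup>2) * u)) * indicator {0<..} u \<partial>lborel \<partial>lborel)"
    by (rule lborel_pair.Fubini') simp
  also have "\<dots> = (\<integral>\<^sup>+u. ennreal (pi powr (?D / 2)) * (ennreal (u powr (?D / 2 - 1) * exp (- 1 * u)) * indicator {0<..} u) \<partial>lborel)"
  proof (rule nn_integral_cong)
    fix u :: real
    show "(\<integral>\<^sup>+\<xi>. ennreal (u powr (?D - 1) * exp (- (1 + (norm (\<xi>::'a))\<^sup>2) * u)) * indicator {0<..} u \<partial>lborel)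
       = ennreal (pi powr (?D / 2)) * (ennreal (u powr (?D / 2 - 1) * exp (- 1 * u)) * indicator {0<..} u)"
    proof (cases "u > 0")
      case True
      have "(\<integral>\<^sup>+\<xi>. ennreal (u powr (?D - 1) * exp (- (1 + (norm (\<xi>::'a))\<^sup>2) * u)) * indicator {0<..} u \<partial>lborel)
          = ennreal (u powr (?D - 1) * exp (- u)) * (\<integral>\<^sup>+\<xi>. ennreal (exp (- u * (norm (\<xi>::'a))\<^sup>2)) \<partial>lborel)"
        using True by (subst nn_integral_cmult[symmetric]) (auto simp: ennreal_mult[symmetric] ring_distribs exp_diff exp_minus field_simps)
      also have "\<dots> = ennreal (pi powr (?D / 2) * ((u powr (?D - 1) / u powr (?D / 2)) * exp (- u)))"
        using True by (subst gaussian_nn_integral) (auto simp: ennreal_mult[symmetric] powr_divide mult_ac)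
      also have "u powr (?D - 1) / u powr (?D / 2) = u powr (?D / 2 - 1)"
        by (simp add: field_simps flip: powr_diff)
      finally show ?thesis using True by (simp add: ennreal_mult)
    qed simp
  qed
  also have "\<dots> = ennreal (pi powr (?D / 2)) * ennreal (Gamma (?D / 2) * 1 powr (- (?D / 2)))"
    by (subst nn_integral_cmult, simp, subst gamma_nn_integral) auto
  finally show "(\<integral>\<^sup>+\<xi>. ennreal (norm ((1 + (norm \<xi>)\<^sup>2) powr (- ?D))) \<partial>(lborel :: 'a measure)) < \<infinity>"
    by (simp add: ennreal_mult_less_top)
qed simp

lemma stable_symbol_integrable:
  fixes \<alpha> t :: real
  assumes "0 < \<alpha>" "t > 0"
  shows "integrable lborel (\<lambda>\<xi>::'a::euclidean_space. exp (- t * norm \<xi> powr \<alpha>))"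
proof -
  let ?D = "real DIM('a)"
  \<comment> \<open>One term of the exponential series with exponent \<open>k * \<alpha>\<close> at
    least \<open>2 * D\<close> beats the growth of (1 + r^2)^D for r > 1.\<close>
  obtain k :: nat where k: "real k * \<alpha> \<ge> 2 * ?D"
    using reals_Archimedean3[OF assms(1)] less_imp_le by blast
  define C where "C = 2 powr ?D * (1 + fact k / t ^ k)"
  have "exp (- t * r powr \<alpha>) * (1 + r\<^sup>2) powr ?D \<le> C" if "r \<ge> 0" for r
  proof (cases "r \<le> 1")
    case True
    hence "r\<^sup>2 \<le> 1" using that by (simp add: power_le_one)
    hence "(1 + r\<^sup>2) powr ?D \<le> 2 powr ?D" by (intro powr_mono2) auto
    moreover have "exp (- t * r powr \<alpha>) \<le> 1" using assms by simp
    ultimately have "exp (- t * r powr \<alpha>) * (1 + r\<^sup>2) powr ?D \<le> 1 * 2 powr ?D" by (intro mult_mono) auto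
    also have "\<dots> \<le> C" unfolding C_def using assms by (simp add: field_simps)
    finally show ?thesis .
  next
    case False
    hence r: "r > 1" by simp
    have "1 \<le> r\<^sup>2" using r by (simp add: one_le_power)
    hence "(1 + r\<^sup>2) powr ?D \<le> (2 * r\<^sup>2) powr ?D" by (intro powr_mono2) auto
    also have "\<dots> = 2 powr ?D * r powr (2 * ?D)"
      using r by (simp add: powr_mult powr_powr flip: powr_numeral)
    also have "\<dots> \<le> 2 powr ?D * r powr (real k * \<alpha>)"
      using r k by (intro mult_left_mono powr_mono) auto
    also have "r powr (real k * \<alpha>) = (r powr \<alpha>) ^ k"
      using r by (simp add: powr_powr mult.commute flip: powr_realpow)
    finally have "exp (- t * r powr \<alpha>) * (1 + r\<^sup>2) powr ?D \<le> exp (- t * r powr \<alpha>) * (2 powr ?D * (r powr \<alpha>) ^ k)"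
      by (intro mult_left_mono) auto
    also have "\<dots> = 2 powr ?D * ((r powr \<alpha>) ^ k * exp (- t * r powr \<alpha>))" by simp
    also have "\<dots> \<le> 2 powr ?D * (fact k / t ^ k)"
      using power_exp_bound[OF assms(2), of "r powr \<alpha>" k] by (intro mult_left_mono) auto
    also have "\<dots> \<le> C" unfolding C_def by (simp add: field_simps)
    finally show ?thesis .
  qed
  from this[OF norm_ge_zero] have bd: "exp (- t * norm \<xi> powr \<alpha>) \<le> C * (1 + (norm \<xi>)\<^sup>2) powr (- ?D)" for \<xi> :: 'a
    using add_pos_nonneg[OF zero_less_one, of "(norm \<xi>)\<^sup>2"] by (simp add: powr_minus field_simps)
  show ?thesis
  proof (rule Bochner_Integration.integrable_bound)
    show "integrable lborel (\<lambda>\<xi>::'a. C * (1 + (norm \<xi>)\<^sup>2) powr (- ?D))"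
      by (rule integrable_mult_right[OF integrable_inverse_power])
    show "AE \<xi>::'a in lborel. norm (exp (- t * norm \<xi> powr \<alpha>)) \<le> norm (C * (1 + (norm \<xi>)\<^sup>2) powr (- ?D))"
      using bd by (auto intro: order_trans[OF _ abs_ge_self])
  qed simp
qed

lemma stable_density_eq:
  fixes x :: "real ^ 'n"
  assumes "0 < \<alpha>" "t > 0"
  shows "stable_density \<alpha> t x
     = (2 * pi) powr (- real CARD('n)) * (LINT \<xi>|lborel. exp (- t * norm \<xi> powr \<alpha>) * cos (x \<bullet> \<xi>))"
proof -
  let ?f = "\<lambda>\<xi>. complex_of_real (exp (- t * norm \<xi> powr \<alpha>)) * exp (- \<i> * complex_of_real (x \<bullet> \<xi>))"
  have "integrable lborel ?f"
    by (rule Bochner_Integration.integrable_bound[OF stable_symbol_integrable[OF assms]]) (auto simp: norm_mult)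
  hence "Re (LINT \<xi>|lborel. ?f \<xi>) = (LINT \<xi>|lborel. Re (?f \<xi>))" by (rule integral_Re[symmetric])
  also have "\<dots> = (LINT \<xi>|lborel. exp (- t * norm \<xi> powr \<alpha>) * cos (x \<bullet> \<xi>))"
    by (intro Bochner_Integration.integral_cong) (auto simp: Re_exp)
  finally show ?thesis unfolding stable_density_def by simp
qed

lemma stable_density_measurable[measurable (raw)]:
  assumes [measurable]: "f \<in> borel_measurable M" "g \<in> borel_measurable M"
  shows "(\<lambda>w. stable_density \<alpha> (f w) (g w :: real ^ 'n)) \<in> borel_measurable M"
  unfolding stable_density_def by measurable

lemma stable_density_scaling:
  fixes x :: "real ^ 'n"
  assumes "0 < \<alpha>" "t > 0" "c > 0"
  shows "stable_density \<alpha> (c powr \<alpha> * t) (c *\<^sub>R x) = c powr (- real CARD('n)) * stable_density \<alpha> t x"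
proof -
  have "(LINT \<xi>|lborel. exp (- t * norm (\<xi> :: real ^ 'n) powr \<alpha>) * cos (x \<bullet> \<xi>))
     = c ^ CARD('n) * (LINT \<xi>|lborel. exp (- t * norm (0 + c *\<^sub>R \<xi> :: real ^ 'n) powr \<alpha>) * cos (x \<bullet> (0 + c *\<^sub>R \<xi>)))"
    using assms by (subst integral_affine_euclidean[where c = c and t = 0]) auto
  also have "(LINT \<xi>|lborel. exp (- t * norm (0 + c *\<^sub>R \<xi> :: real ^ 'n) powr \<alpha>) * cos (x \<bullet> (0 + c *\<^sub>R \<xi>)))
     = (LINT \<xi>|lborel. exp (- (c powr \<alpha> * t) * norm (\<xi> :: real ^ 'n) powr \<alpha>) * cos ((c *\<^sub>R x) \<bullet> \<xi>))"
    using assms by (simp add: powr_mult mult_ac)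
  finally show ?thesis
    using assms by (simp add: stable_density_eq powr_minus powr_realpow field_simps)
qed

lemma inverse_Suc_tendsto: "(\<lambda>n. 1 / (real n + 1)) \<longlonglongrightarrow> 0"
  using LIMSEQ_inverse_real_of_nat by (simp add: inverse_eq_divide add.commute)

section \<open>Positivity, Fourier inversion and the semigroup property of the stable
  densities\<close>

context
  fixes \<alpha> :: real
  assumes \<alpha>: "0 < \<alpha>" "\<alpha> < 2"
begin

text \<open>Both inequalities hold for the Gaussian-regularised integrals by
  \<open>pos_radial_stable\<close> and survive s -> 0, where the integrable symbol dominates. In
  particular the density depends on |x| alone and is largest at the origin.\<close>

lemma stable_density_radial:
  fixes x y :: "real ^ 'n"
  assumes "t > 0" "norm x \<le> norm y"
  shows "0 \<le> stable_density \<alpha> t y" "stable_density \<alpha> t y \<le> stable_density \<alpha> t x"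
proof -
  let ?\<phi> = "\<lambda>\<xi>::real ^ 'n. exp (- t * norm \<xi> powr \<alpha>)"
  let ?s = "\<lambda>n. 1 / (real n + 1)"
  have s: "?s n > 0" for n by simp
  have lim: "(\<lambda>n. (2 * pi) powr (- real CARD('n)) * gauss_cos (?s n) ?\<phi> z) \<longlonglongrightarrow> stable_density \<alpha> t z" for z
    unfolding stable_density_eq[OF \<alpha>(1) assms(1)] gauss_cos_def
  proof (intro tendsto_mult_left integral_dominated_convergence)
    show "integrable lborel ?\<phi>" by (rule stable_symbol_integrable[OF \<alpha>(1) assms(1)])
    show "AE \<xi> in lborel. norm (exp (- ?s n * (norm \<xi>)\<^sup>2) * ?\<phi> \<xi> * cos (z \<bullet> \<xi>)) \<le> ?\<phi> \<xi>" for n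
    proof (rule AE_I2)
      fix \<xi> :: "real ^ 'n"
      have "exp (- ?s n * (norm \<xi>)\<^sup>2) * ?\<phi> \<xi> * \<bar>cos (z \<bullet> \<xi>)\<bar> \<le> 1 * ?\<phi> \<xi> * 1"
        by (intro mult_mono) auto
      thus "norm (exp (- ?s n * (norm \<xi>)\<^sup>2) * ?\<phi> \<xi> * cos (z \<bullet> \<xi>)) \<le> ?\<phi> \<xi>"
        by (simp add: abs_mult)
    qed
    show "AE \<xi> in lborel. (\<lambda>n. exp (- ?s n * (norm \<xi>)\<^sup>2) * ?\<phi> \<xi> * cos (z \<bullet> \<xi>)) \<longlonglongrightarrow> ?\<phi> \<xi> * cos (z \<bullet> \<xi>)"
    proof (rule AE_I2)
      fix \<xi> :: "real ^ 'n"
      from inverse_Suc_tendsto have "(\<lambda>n. exp (- ?s n * (norm \<xi>)\<^sup>2) * ?\<phi> \<xi> * cos (z \<bullet> \<xi>)) \<longlonglongrightarrow> exp (- 0 * (norm \<xi>)\<^sup>2) * ?\<phi> \<xi> * cos (z \<bullet> \<xi>)"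
        by (intro tendsto_intros)
      thus "(\<lambda>n. exp (- ?s n * (norm \<xi>)\<^sup>2) * ?\<phi> \<xi> * cos (z \<bullet> \<xi>)) \<longlonglongrightarrow> ?\<phi> \<xi> * cos (z \<bullet> \<xi>)" by simp
    qed
  qed simp_all
  note P = pos_radialD(3,4)[OF pos_radial_stable[OF \<alpha> less_imp_le[OF assms(1)]] s assms(2)]
  show "0 \<le> stable_density \<alpha> t y"
    by (rule LIMSEQ_le_const[OF lim]) (intro exI allI impI mult_nonneg_nonneg P(1) powr_ge_zero)
  show "stable_density \<alpha> t y \<le> stable_density \<alpha> t x"
    by (rule LIMSEQ_le[OF lim lim]) (intro exI allI impI mult_left_mono P(2) powr_ge_zero)
qed

lemma stable_density_bound:
  fixes x :: "real ^ 'n"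
  shows "t > 0 \<Longrightarrow> \<bar>stable_density \<alpha> t x\<bar> \<le> stable_density \<alpha> t (0 :: real ^ 'n)"
  using stable_density_radial[of t 0 x] by simp

lemma stable_density_norm_cong:
  fixes x y :: "real ^ 'n"
  assumes "t > 0" "norm x = norm y"
  shows "stable_density \<alpha> t x = stable_density \<alpha> t y"
  using stable_density_radial[of t x y] stable_density_radial[of t y x] assms by simp

text \<open>After interchanging the integrals, the \<open>x\<close>-integral is a Gaussian
  transform. The product of two cosines splits into terms centred at \<open>\<eta>\<close> and
  \<open>- \<eta>\<close>, which contribute equally because the symbol is even.\<close>

lemma gauss_cos_stable_density:
  fixes \<eta> :: "real ^ 'n"
  assumes t: "t > 0" and e: "e > 0"
  shows "gauss_cos e (stable_density \<alpha> t) \<eta>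
     = (2 * pi) powr (- real CARD('n)) * (pi / e) powr (real CARD('n) / 2) *
       (LINT \<xi>|lborel. exp (- t * norm \<xi> powr \<alpha>) * exp (- (norm (\<xi> - \<eta>))\<^sup>2 / (4 * e)))"
proof -
  let ?K = "(2 * pi) powr (- real CARD('n))" and ?G = "(pi / e) powr (real CARD('n) / 2)"
  let ?\<phi> = "\<lambda>\<xi>::real ^ 'n. exp (- t * norm \<xi> powr \<alpha>)"
  let ?g = "\<lambda>z::real ^ 'n. exp (- (norm z)\<^sup>2 / (4 * e))"
  note I\<phi> = stable_symbol_integrable[OF \<alpha>(1) t, where 'a = "real ^ 'n"]
  define h where "h x \<xi> = exp (- e * (norm x)\<^sup>2) * cos (\<eta> \<bullet> x) * (?\<phi> \<xi> * cos (x \<bullet> \<xi>))" for x \<xi>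
  have hint: "integrable (lborel \<Otimes>\<^sub>M lborel) (case_prod h)"
  proof (rule integrable_pair_bound[OF _ gaussian_integrable[OF e] I\<phi>])
    show "case_prod h \<in> borel_measurable (borel \<Otimes>\<^sub>M borel)" unfolding h_def by measurable
    show "\<bar>h x \<xi>\<bar> \<le> exp (- e * (norm x)\<^sup>2) * ?\<phi> \<xi>" for x \<xi>
    proof -
      have "exp (- e * (norm x)\<^sup>2) * \<bar>cos (\<eta> \<bullet> x)\<bar> * (?\<phi> \<xi> * \<bar>cos (x \<bullet> \<xi>)\<bar>) \<le> exp (- e * (norm x)\<^sup>2) * 1 * (?\<phi> \<xi> * 1)"
        by (intro mult_mono mult_nonneg_nonneg) auto
      thus ?thesis by (simp add: h_def abs_mult)
    qed
  qed
  have inner: "(LINT x|lborel. h x \<xi>) = ?\<phi> \<xi> * (?G * ((?g (\<xi> - \<eta>) + ?g (\<xi> + \<eta>)) / 2))" for \<xi>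
  proof -
    have i: "integrable lborel (\<lambda>x. exp (- e * (norm x)\<^sup>2) * cos (v \<bullet> x))" for v :: "real ^ 'n"
      using gauss_cos_integrable[of "\<lambda>_. 1" 1 e v] e by simp
    have "(LINT x|lborel. h x \<xi>) = (LINT x|lborel. ?\<phi> \<xi> / 2 * (exp (- e * (norm x)\<^sup>2) * cos ((\<xi> - \<eta>) \<bullet> x)
        + exp (- e * (norm x)\<^sup>2) * cos ((\<xi> + \<eta>) \<bullet> x)))"
      unfolding h_def by (intro Bochner_Integration.integral_cong refl)
        (simp add: inner_diff_left inner_add_left cos_diff cos_add inner_commute algebra_simps)
    also have "\<dots> = ?\<phi> \<xi> / 2 * (?G * ?g (\<xi> - \<eta>) + ?G * ?g (\<xi> + \<eta>))"
      using i[of "\<xi> - \<eta>"] i[of "\<xi> + \<eta>"] gaussian_fourier[OF e, of "\<xi> - \<eta>"] gaussian_fourier[OF e, of "\<xi> + \<eta>"]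
      by simp
    finally show ?thesis by (simp add: field_simps)
  qed
  have J: "integrable lborel (\<lambda>\<xi>. ?\<phi> \<xi> * ?g (\<xi> + v))" for v
    by (rule Bochner_Integration.integrable_bound[OF I\<phi>]) (use e in auto)
  have flip_sign: "(LINT \<xi>|lborel. ?\<phi> \<xi> * ?g (\<xi> + \<eta>)) = (LINT \<xi>|lborel. ?\<phi> \<xi> * ?g (\<xi> - \<eta>))"
    by (subst integral_affine_euclidean[where c = "-1" and t = 0])
       (auto simp: norm_minus_commute)
  have "gauss_cos e (stable_density \<alpha> t) \<eta> = ?K * (LINT x|lborel. LINT \<xi>|lborel. h x \<xi>)"
    unfolding gauss_cos_def stable_density_eq[OF \<alpha>(1) t] h_def
    by (simp add: mult_ac flip: integral_mult_right_zero)
  also have "(LINT x|lborel. LINT \<xi>|lborel. h x \<xi>) = (LINT \<xi>|lborel. LINT x|lborel. h x \<xi>)"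
    by (rule lborel_pair.Fubini_integral[OF hint, symmetric])
  also have "\<dots> = (LINT \<xi>|lborel. ?G / 2 * (?\<phi> \<xi> * ?g (\<xi> - \<eta>) + ?\<phi> \<xi> * ?g (\<xi> + \<eta>)))"
  proof -
    have alg: "p * (g * ((a + b) / 2)) = g / 2 * (p * a + p * b)" for p g a b :: real by (simp add: field_simps)
    show ?thesis unfolding inner alg ..
  qed
  also have "\<dots> = ?G * (LINT \<xi>|lborel. ?\<phi> \<xi> * ?g (\<xi> - \<eta>))"
    using J[of \<eta>] J[of "-\<eta>"] flip_sign by simp
  finally show ?thesis by simp
qed

lemma gauss_cos_stable_density_tendsto:
  fixes \<eta> :: "real ^ 'n"
  assumes t: "t > 0"
  shows "(\<lambda>n. gauss_cos (1 / (real n + 1)) (stable_density \<alpha> t) \<eta>) \<longlonglongrightarrow> exp (- t * norm \<eta> powr \<alpha>)"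
proof -
  let ?d = "real CARD('n)"
  let ?\<phi> = "\<lambda>\<xi>::real ^ 'n. exp (- t * norm \<xi> powr \<alpha>)"
  let ?s = "\<lambda>n. 1 / (real n + 1)"
  let ?F = "\<lambda>n. LINT \<zeta>|lborel. ?\<phi> (\<eta> + (2 * sqrt (?s n)) *\<^sub>R \<zeta>) * exp (- 1 * (norm \<zeta>)\<^sup>2)"
  have eq: "gauss_cos (?s n) (stable_density \<alpha> t) \<eta> = pi powr (- ?d / 2) * ?F n" for n
  proof -
    define e where "e = ?s n"
    have e: "e > 0" by (simp add: e_def)
    define c where "c = 2 * sqrt e"
    have c: "c > 0" "c\<^sup>2 = 4 * e" using e by (auto simp: c_def power_mult_distrib)
    have "(LINT \<xi>|lborel. ?\<phi> \<xi> * exp (- (norm (\<xi> - \<eta>))\<^sup>2 / (4 * e)))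
       = c ^ CARD('n) * (LINT \<zeta>|lborel. ?\<phi> (\<eta> + c *\<^sub>R \<zeta>) * exp (- (norm (\<eta> + c *\<^sub>R \<zeta> - \<eta>))\<^sup>2 / (4 * e)))"
      using c by (subst integral_affine_euclidean[where c = c and t = \<eta>]) auto
    also have "\<dots> = c ^ CARD('n) * (LINT \<zeta>|lborel. ?\<phi> (\<eta> + c *\<^sub>R \<zeta>) * exp (- 1 * (norm \<zeta>)\<^sup>2))"
      using c e by (simp add: power_mult_distrib)
    finally have "gauss_cos e (stable_density \<alpha> t) \<eta>
      = ((2 * pi) powr (- ?d) * (pi / e) powr (?d / 2) * c ^ CARD('n)) *
        (LINT \<zeta>|lborel. ?\<phi> (\<eta> + c *\<^sub>R \<zeta>) * exp (- 1 * (norm \<zeta>)\<^sup>2))"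
      unfolding gauss_cos_stable_density[OF t e] by (simp add: mult.assoc)
    also have "(2 * pi) powr (- ?d) * (pi / e) powr (?d / 2) * c ^ CARD('n) = pi powr (- ?d / 2)"
    proof -
      have "c ^ CARD('n) = 2 powr ?d * e powr (?d / 2)"
        using c e by (simp add: c_def powr_mult powr_half_sqrt[symmetric] powr_powr flip: powr_realpow)
      moreover have "pi powr ?d = pi powr (?d / 2) * pi powr (?d / 2)" by (simp flip: powr_add)
      ultimately show ?thesis
        using e by (simp add: powr_mult powr_divide powr_minus field_simps)
    qed
    finally show ?thesis unfolding c_def e_def .
  qed
  have "?F \<longlonglongrightarrow> (LINT \<zeta>|lborel. ?\<phi> \<eta> * exp (- 1 * (norm (\<zeta> :: real ^ 'n))\<^sup>2))"
  proof (rule integral_dominated_convergence)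
    show "integrable lborel (\<lambda>\<zeta>::real ^ 'n. exp (- 1 * (norm \<zeta>)\<^sup>2))" by (rule gaussian_integrable) simp
    show "AE \<zeta> in lborel. norm (?\<phi> (\<eta> + (2 * sqrt (?s n)) *\<^sub>R \<zeta>) * exp (- 1 * (norm \<zeta>)\<^sup>2)) \<le> exp (- 1 * (norm \<zeta>)\<^sup>2)" for n
      using t by (intro AE_I2) (auto simp: abs_mult intro!: mult_left_le_one_le)
    show "AE \<zeta> in lborel. (\<lambda>n. ?\<phi> (\<eta> + (2 * sqrt (?s n)) *\<^sub>R \<zeta>) * exp (- 1 * (norm \<zeta>)\<^sup>2)) \<longlonglongrightarrow> ?\<phi> \<eta> * exp (- 1 * (norm \<zeta>)\<^sup>2)"
    proof (rule AE_I2)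
      fix \<zeta> :: "real ^ 'n"
      from inverse_Suc_tendsto have "(\<lambda>n. \<eta> + (2 * sqrt (?s n)) *\<^sub>R \<zeta>) \<longlonglongrightarrow> \<eta> + (2 * sqrt 0) *\<^sub>R \<zeta>"
        by (intro tendsto_intros)
      hence "(\<lambda>n. norm (\<eta> + (2 * sqrt (?s n)) *\<^sub>R \<zeta>) powr \<alpha>) \<longlonglongrightarrow> norm \<eta> powr \<alpha>"
        using \<alpha> by (intro tendsto_powr' tendsto_norm tendsto_const) (auto intro!: always_eventually)
      thus "(\<lambda>n. ?\<phi> (\<eta> + (2 * sqrt (?s n)) *\<^sub>R \<zeta>) * exp (- 1 * (norm \<zeta>)\<^sup>2)) \<longlonglongrightarrow> ?\<phi> \<eta> * exp (- 1 * (norm \<zeta>)\<^sup>2)"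
        by (intro tendsto_mult tendsto_exp tendsto_const)
    qed
  qed simp_all
  hence "(\<lambda>n. pi powr (- ?d / 2) * ?F n) \<longlonglongrightarrow> pi powr (- ?d / 2) * (LINT \<zeta>|lborel. ?\<phi> \<eta> * exp (- 1 * (norm (\<zeta> :: real ^ 'n))\<^sup>2))"
    by (rule tendsto_mult_left)
  also have "pi powr (- ?d / 2) * (LINT \<zeta>|lborel. ?\<phi> \<eta> * exp (- 1 * (norm (\<zeta> :: real ^ 'n))\<^sup>2)) = ?\<phi> \<eta>"
    using gaussian_fourier[of 1 "0 :: real ^ 'n"] by (simp add: powr_minus)
  finally show ?thesis unfolding eq .
qed

text \<open>The density is nonnegative, so at frequency 0 the damped integrals increase in
  \<open>n\<close>. Their limit 1 gives integrability and total mass together, by monotone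
  convergence.\<close>

lemma
  assumes t: "t > 0"
  shows stable_density_integrable: "integrable lborel (stable_density \<alpha> t :: real ^ 'n \<Rightarrow> real)" (is ?I)
    and stable_density_integral: "(LINT x|lborel. stable_density \<alpha> t (x :: real ^ 'n)) = 1" (is ?E)
proof -
  let ?p = "stable_density \<alpha> t :: real ^ 'n \<Rightarrow> real"
  let ?s = "\<lambda>n. 1 / (real n + 1)"
  let ?f = "\<lambda>n x. exp (- ?s n * (norm x)\<^sup>2) * ?p x * cos (0 \<bullet> x)"
  have p0: "?p x \<ge> 0" for x using stable_density_radial(1)[OF t order_refl] .
  have 1: "integrable lborel (?f n)" for n
    by (rule gauss_cos_integrable[OF _ stable_density_bound[OF t]]) simp_all
  have 2: "AE x in lborel. mono (\<lambda>n. ?f n x)"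
  proof (intro AE_I2 monoI)
    fix x :: "real ^ 'n" and m n :: nat assume "m \<le> n"
    hence "?s n \<le> ?s m" by (simp add: field_simps)
    hence "?s n * (norm x)\<^sup>2 \<le> ?s m * (norm x)\<^sup>2" by (intro mult_right_mono) auto
    thus "?f m x \<le> ?f n x" using p0 by (auto intro!: mult_right_mono)
  qed
  have 3: "AE x in lborel. (\<lambda>n. ?f n x) \<longlonglongrightarrow> ?p x"
  proof (intro AE_I2)
    fix x :: "real ^ 'n"
    have "(\<lambda>n. ?f n x) \<longlonglongrightarrow> exp (- 0 * (norm x)\<^sup>2) * ?p x * cos (0 \<bullet> x)"
      by (intro tendsto_intros inverse_Suc_tendsto)
    thus "(\<lambda>n. ?f n x) \<longlonglongrightarrow> ?p x" by simp
  qed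
  have 4: "(\<lambda>n. integral\<^sup>L lborel (?f n)) \<longlonglongrightarrow> 1"
    using gauss_cos_stable_density_tendsto[OF t, of "0 :: real ^ 'n"] \<alpha> unfolding gauss_cos_def by simp
  show ?I by (rule integrable_monotone_convergence[OF 1 2 3 4]) simp
  show ?E by (rule integral_monotone_convergence[OF 1 2 3 4]) simp
qed

text \<open>Integrability of the density now allows the Gaussian damping to be removed.\<close>

lemma stable_density_fourier:
  fixes \<eta> :: "real ^ 'n"
  assumes t: "t > 0"
  shows "(LINT x|lborel. stable_density \<alpha> t x * cos (\<eta> \<bullet> x)) = exp (- t * norm \<eta> powr \<alpha>)"
proof (rule LIMSEQ_unique[OF _ gauss_cos_stable_density_tendsto[OF t]])
  let ?p = "stable_density \<alpha> t :: real ^ 'n \<Rightarrow> real"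
  let ?s = "\<lambda>n. 1 / (real n + 1)"
  show "(\<lambda>n. gauss_cos (?s n) ?p \<eta>) \<longlonglongrightarrow> (LINT x|lborel. ?p x * cos (\<eta> \<bullet> x))"
    unfolding gauss_cos_def
  proof (rule integral_dominated_convergence[OF _ _ stable_density_integrable[OF t]])
    show "AE x in lborel. norm (exp (- ?s n * (norm x)\<^sup>2) * ?p x * cos (\<eta> \<bullet> x)) \<le> ?p x" for n
    proof (rule AE_I2)
      fix x :: "real ^ 'n"
      have p0: "?p x \<ge> 0" using stable_density_radial(1)[OF t order_refl] .
      hence "exp (- ?s n * (norm x)\<^sup>2) * ?p x * \<bar>cos (\<eta> \<bullet> x)\<bar> \<le> 1 * ?p x * 1"
        by (intro mult_mono) auto
      thus "norm (exp (- ?s n * (norm x)\<^sup>2) * ?p x * cos (\<eta> \<bullet> x)) \<le> ?p x"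
        using p0 by (simp add: abs_mult)
    qed
    show "AE x in lborel. (\<lambda>n. exp (- ?s n * (norm x)\<^sup>2) * ?p x * cos (\<eta> \<bullet> x)) \<longlonglongrightarrow> ?p x * cos (\<eta> \<bullet> x)"
    proof (intro AE_I2)
      fix x :: "real ^ 'n"
      have "(\<lambda>n. exp (- ?s n * (norm x)\<^sup>2) * ?p x * cos (\<eta> \<bullet> x)) \<longlonglongrightarrow> exp (- 0 * (norm x)\<^sup>2) * ?p x * cos (\<eta> \<bullet> x)"
        by (intro tendsto_intros inverse_Suc_tendsto)
      thus "(\<lambda>n. exp (- ?s n * (norm x)\<^sup>2) * ?p x * cos (\<eta> \<bullet> x)) \<longlonglongrightarrow> ?p x * cos (\<eta> \<bullet> x)" by simp
    qed
  qed simp_all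
qed

lemma stable_density_uminus: "t > 0 \<Longrightarrow> stable_density \<alpha> t (- x :: real ^ 'n) = stable_density \<alpha> t x"
  by (rule stable_density_norm_cong) simp_all

text \<open>Only the factor of time \<open>s\<close> is replaced by its Fourier integral; the
  \<open>z\<close>-integral is then the Fourier transform of the density of time \<open>t\<close>.
  The sine part vanishes by symmetry, and the two symbols multiply.\<close>

lemma stable_density_semigroup:
  fixes x :: "real ^ 'n"
  assumes s: "s > 0" and t: "t > 0"
  shows "(LINT z|lborel. stable_density \<alpha> s (z - x) * stable_density \<alpha> t z) = stable_density \<alpha> (s + t) x"
proof -
  let ?K = "(2 * pi) powr (- real CARD('n))"
  let ?p = "stable_density \<alpha> t :: real ^ 'n \<Rightarrow> real"
  let ?\<phi> = "\<lambda>\<xi>::real ^ 'n. exp (- s * norm \<xi> powr \<alpha>)"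
  have p0: "?p z \<ge> 0" for z using stable_density_radial(1)[OF t order_refl] .
  define h where "h z \<xi> = ?p z * (?\<phi> \<xi> * cos ((z - x) \<bullet> \<xi>))" for z \<xi>
  have hint: "integrable (lborel \<Otimes>\<^sub>M lborel) (case_prod h)"
  proof (rule integrable_pair_bound[OF _ stable_density_integrable[OF t] stable_symbol_integrable[OF \<alpha>(1) s]])
    show "case_prod h \<in> borel_measurable (borel \<Otimes>\<^sub>M borel)" unfolding h_def by measurable
    show "\<bar>h z \<xi>\<bar> \<le> ?p z * ?\<phi> \<xi>" for z \<xi>
    proof -
      have "?p z * (?\<phi> \<xi> * \<bar>cos ((z - x) \<bullet> \<xi>)\<bar>) \<le> ?p z * (?\<phi> \<xi> * 1)"
        using p0 by (intro mult_left_mono) auto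
      thus ?thesis using p0 by (simp add: h_def abs_mult)
    qed
  qed
  have inner: "(LINT z|lborel. h z \<xi>) = ?\<phi> \<xi> * (cos (x \<bullet> \<xi>) * exp (- t * norm \<xi> powr \<alpha>))" for \<xi>
  proof -
    have i_cos: "integrable lborel (\<lambda>z. ?p z * cos (\<xi> \<bullet> z))" and i_sin: "integrable lborel (\<lambda>z. ?p z * sin (\<xi> \<bullet> z))"
      using p0 by (auto intro!: Bochner_Integration.integrable_bound[OF stable_density_integrable[OF t]]
          AE_I2 mult_left_le simp: abs_mult)
    have "(LINT z|lborel. ?p z * sin (\<xi> \<bullet> z)) = (LINT z|lborel. ?p (- z) * sin (\<xi> \<bullet> (- z)))"
      by (subst integral_affine_euclidean[where c = "-1" and t = 0]) auto
    hence odd: "(LINT z|lborel. ?p z * sin (\<xi> \<bullet> z)) = 0"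
      using t by (simp add: stable_density_uminus)
    have "(LINT z|lborel. h z \<xi>)
       = (LINT z|lborel. ?\<phi> \<xi> * (cos (x \<bullet> \<xi>) * (?p z * cos (\<xi> \<bullet> z)) + sin (x \<bullet> \<xi>) * (?p z * sin (\<xi> \<bullet> z))))"
      unfolding h_def by (intro Bochner_Integration.integral_cong refl)
        (simp add: inner_diff_left cos_diff inner_commute algebra_simps)
    also have "\<dots> = ?\<phi> \<xi> * (cos (x \<bullet> \<xi>) * (LINT z|lborel. ?p z * cos (\<xi> \<bullet> z)))"
      using i_cos i_sin odd by simp
    finally show ?thesis unfolding stable_density_fourier[OF t] .
  qed
  have "(LINT z|lborel. stable_density \<alpha> s (z - x) * ?p z) = ?K * (LINT z|lborel. LINT \<xi>|lborel. h z \<xi>)"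
  proof -
    have "stable_density \<alpha> s (z - x) * ?p z = ?K * (LINT \<xi>|lborel. h z \<xi>)" for z
      unfolding h_def stable_density_eq[OF \<alpha>(1) s] by simp
    thus ?thesis by simp
  qed
  also have "(LINT z|lborel. LINT \<xi>|lborel. h z \<xi>) = (LINT \<xi>|lborel. LINT z|lborel. h z \<xi>)"
    by (rule lborel_pair.Fubini_integral[OF hint, symmetric])
  also have "\<dots> = (LINT \<xi>|lborel. exp (- (s + t) * norm \<xi> powr \<alpha>) * cos (x \<bullet> \<xi>))"
    unfolding inner by (intro Bochner_Integration.integral_cong refl) (simp add: algebra_simps exp_add[symmetric] exp_diff)
  finally show ?thesis
    using stable_density_eq[OF \<alpha>(1), of "s + t" x] s t by simp
qed

lemma stable_density_nn_semigroup:
  fixes x :: "real ^ 'n"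
  assumes s: "s > 0" and t: "t > 0"
  shows "(\<integral>\<^sup>+z. ennreal (stable_density \<alpha> s (z - x)) * ennreal (stable_density \<alpha> t z) \<partial>lborel)
     = ennreal (stable_density \<alpha> (s + t) x)"
proof -
  have nn: "stable_density \<alpha> s z \<ge> 0" "stable_density \<alpha> t z \<ge> 0" for z :: "real ^ 'n"
    using stable_density_radial(1) s t by auto
  have "integrable lborel (\<lambda>z. stable_density \<alpha> s (z - x) * stable_density \<alpha> t z)"
  proof (rule Bochner_Integration.integrable_bound)
    show "integrable lborel (\<lambda>z. stable_density \<alpha> s (0 :: real ^ 'n) * stable_density \<alpha> t (z :: real ^ 'n))"
      by (rule integrable_mult_right[OF stable_density_integrable[OF t]])
    show "AE z in lborel. norm (stable_density \<alpha> s (z - x) * stable_density \<alpha> t z)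
        \<le> norm (stable_density \<alpha> s (0 :: real ^ 'n) * stable_density \<alpha> t z)"
      using stable_density_radial(2)[OF s, of 0] nn by (intro AE_I2) (auto simp: abs_mult intro!: mult_right_mono)
  qed simp
  hence "(\<integral>\<^sup>+z. ennreal (stable_density \<alpha> s (z - x) * stable_density \<alpha> t z) \<partial>lborel)
     = ennreal (LINT z|lborel. stable_density \<alpha> s (z - x) * stable_density \<alpha> t z)"
    using nn by (intro nn_integral_eq_integral) auto
  thus ?thesis unfolding stable_density_semigroup[OF s t] using nn by (simp add: ennreal_mult)
qed

end

section \<open>Time integrals of stable densities\<close>

text \<open>With |x|^-s written as a Gamma integral in \<open>u\<close>, the space integral is
  Gaussian and leaves the power -D / 2 of u + 1 / 2. A second Gamma integral, in \<open>v\<close>,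
  expresses this power; after the interchange the \<open>u\<close>-integral is again of Gamma type,
  so neither polar coordinates nor a Beta integral is required.\<close>

lemma gaussian_moment_nn_integral:
  fixes s :: real
  defines "D \<equiv> real DIM('a::euclidean_space)"
  assumes s: "0 < s" "s < D"
  shows "(\<integral>\<^sup>+x. ennreal (norm (x::'a) powr (- s) * exp (- (norm x)\<^sup>2 / 2)) \<partial>lborel)
    = ennreal (pi powr (D / 2) / Gamma (D / 2) * (Gamma ((D - s) / 2) * 2 powr ((D - s) / 2)))"
proof -
  have D: "D > 0" using s by simp
  note G = Gamma_real_pos less_imp_neq[OF Gamma_real_pos, symmetric]
  have e: "exp (- (u + 1 / 2) * N) = exp (- N / 2) * exp (- N * u)" for u N :: real
    unfolding exp_add[symmetric] by (rule arg_cong[where f = exp]) (simp add: algebra_simps)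
  have "(\<integral>\<^sup>+x. ennreal (norm (x::'a) powr (- s) * exp (- (norm x)\<^sup>2 / 2)) \<partial>lborel)
     = (\<integral>\<^sup>+x. \<integral>\<^sup>+u. ennreal (1 / Gamma (s / 2)) * (ennreal (u powr (s / 2 - 1)) * ennreal (exp (- (u + 1 / 2) * (norm (x::'a))\<^sup>2)) * indicator {0<..} u) \<partial>lborel \<partial>lborel)"
  proof (rule nn_integral_cong_AE)
    show "AE x::'a in lborel. ennreal (norm x powr (- s) * exp (- (norm x)\<^sup>2 / 2))
      = (\<integral>\<^sup>+u. ennreal (1 / Gamma (s / 2)) * (ennreal (u powr (s / 2 - 1)) * ennreal (exp (- (u + 1 / 2) * (norm x)\<^sup>2)) * indicator {0<..} u) \<partial>lborel)"
      using AE_lborel_singleton[of "0::'a"]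
    proof eventually_elim
      case (elim x)
      have r: "(norm x)\<^sup>2 > 0" using elim by simp
      have "(\<integral>\<^sup>+u. ennreal (1 / Gamma (s / 2)) * (ennreal (u powr (s / 2 - 1)) * ennreal (exp (- (u + 1 / 2) * (norm x)\<^sup>2)) * indicator {0<..} u) \<partial>lborel)
         = (\<integral>\<^sup>+u. ennreal (exp (- (norm x)\<^sup>2 / 2) / Gamma (s / 2)) * (ennreal (u powr (s / 2 - 1) * exp (- (norm x)\<^sup>2 * u)) * indicator {0<..} u) \<partial>lborel)"
        unfolding e using s by (intro nn_integral_cong) (auto simp: ennreal_mult[symmetric] G mult_ac split: split_indicator)
      also have "\<dots> = ennreal (exp (- (norm x)\<^sup>2 / 2) / Gamma (s / 2)) * ennreal (Gamma (s / 2) * (norm x)\<^sup>2 powr (- (s / 2)))"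
        using s r by (subst nn_integral_cmult, simp, subst gamma_nn_integral) auto
      also have "(norm x)\<^sup>2 powr (- (s / 2)) = norm x powr (- s)"
        using elim by (simp add: powr_powr flip: powr_numeral)
      also have "ennreal (exp (- (norm x)\<^sup>2 / 2) / Gamma (s / 2)) * ennreal (Gamma (s / 2) * norm x powr (- s))
          = ennreal (norm x powr (- s) * exp (- (norm x)\<^sup>2 / 2))"
        using s by (simp add: ennreal_mult[symmetric] G)
      finally show ?case by simp
    qed
  qed
  also have "\<dots> = (\<integral>\<^sup>+u. \<integral>\<^sup>+x. ennreal (1 / Gamma (s / 2)) * (ennreal (u powr (s / 2 - 1)) * ennreal (exp (- (u + 1 / 2) * (norm (x::'a))\<^sup>2)) * indicator {0<..} u) \<partial>lborel \<partial>lborel)"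
    by (rule lborel_pair.Fubini') simp
  also have "\<dots> = (\<integral>\<^sup>+u. \<integral>\<^sup>+v. ennreal (pi powr (D / 2) / (Gamma (s / 2) * Gamma (D / 2))) *
      (ennreal (u powr (s / 2 - 1)) * ennreal (v powr (D / 2 - 1)) * ennreal (exp (- (u + 1 / 2) * v)) * indicator {0<..} u * indicator {0<..} v) \<partial>lborel \<partial>lborel)"
  proof (rule nn_integral_cong)
    fix u :: real
    show "(\<integral>\<^sup>+x. ennreal (1 / Gamma (s / 2)) * (ennreal (u powr (s / 2 - 1)) * ennreal (exp (- (u + 1 / 2) * (norm (x::'a))\<^sup>2)) * indicator {0<..} u) \<partial>lborel)
      = (\<integral>\<^sup>+v. ennreal (pi powr (D / 2) / (Gamma (s / 2) * Gamma (D / 2))) *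
      (ennreal (u powr (s / 2 - 1)) * ennreal (v powr (D / 2 - 1)) * ennreal (exp (- (u + 1 / 2) * v)) * indicator {0<..} u * indicator {0<..} v) \<partial>lborel)"
    proof (cases "u > 0")
      case True
      hence u: "u + 1 / 2 > 0" by simp
      have "(\<integral>\<^sup>+x. ennreal (1 / Gamma (s / 2)) * (ennreal (u powr (s / 2 - 1)) * ennreal (exp (- (u + 1 / 2) * (norm (x::'a))\<^sup>2)) * indicator {0<..} u) \<partial>lborel)
         = ennreal (1 / Gamma (s / 2)) * (ennreal (u powr (s / 2 - 1)) * (\<integral>\<^sup>+x. ennreal (exp (- (u + 1 / 2) * (norm (x::'a))\<^sup>2)) \<partial>lborel))"
        using True by (simp add: nn_integral_cmult)
      also have "(\<integral>\<^sup>+x. ennreal (exp (- (u + 1 / 2) * (norm (x::'a))\<^sup>2)) \<partial>lborel) = ennreal ((pi / (u + 1 / 2)) powr (D / 2))"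
        unfolding D_def by (rule gaussian_nn_integral[OF u])
      also have "\<dots> = ennreal (pi powr (D / 2) / Gamma (D / 2)) * ennreal (Gamma (D / 2) * (u + 1 / 2) powr (- (D / 2)))"
      proof -
        have "(pi / (u + 1 / 2)) powr (D / 2) = pi powr (D / 2) * (u + 1 / 2) powr (- (D / 2))"
          using u by (simp only: powr_divide pi_ge_zero less_imp_le powr_minus_divide) simp
        thus ?thesis using u D by (simp add: ennreal_mult[symmetric] G)
      qed
      also have "ennreal (Gamma (D / 2) * (u + 1 / 2) powr (- (D / 2))) = (\<integral>\<^sup>+v\<in>{0<..}. ennreal (v powr (D / 2 - 1) * exp (- (u + 1 / 2) * v)) \<partial>lborel)"
        using u D by (subst gamma_nn_integral) auto
      also have "ennreal (1 / Gamma (s / 2)) * (ennreal (u powr (s / 2 - 1)) * (ennreal (pi powr (D / 2) / Gamma (D / 2)) * (\<integral>\<^sup>+v\<in>{0<..}. ennreal (v powr (D / 2 - 1) * exp (- (u + 1 / 2) * v)) \<partial>lborel)))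
         = (ennreal (1 / Gamma (s / 2)) * ennreal (u powr (s / 2 - 1)) * ennreal (pi powr (D / 2) / Gamma (D / 2))) * (\<integral>\<^sup>+v\<in>{0<..}. ennreal (v powr (D / 2 - 1) * exp (- (u + 1 / 2) * v)) \<partial>lborel)"
        by (simp only: mult.assoc)
      also have "\<dots> = (\<integral>\<^sup>+v. (ennreal (1 / Gamma (s / 2)) * ennreal (u powr (s / 2 - 1)) * ennreal (pi powr (D / 2) / Gamma (D / 2))) * (ennreal (v powr (D / 2 - 1) * exp (- (u + 1 / 2) * v)) * indicator {0<..} v) \<partial>lborel)"
        by (rule nn_integral_cmult[symmetric]) simp
      also have "\<dots> = (\<integral>\<^sup>+v. ennreal (pi powr (D / 2) / (Gamma (s / 2) * Gamma (D / 2))) *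
      (ennreal (u powr (s / 2 - 1)) * ennreal (v powr (D / 2 - 1)) * ennreal (exp (- (u + 1 / 2) * v)) * indicator {0<..} u * indicator {0<..} v) \<partial>lborel)"
        using True s D by (intro nn_integral_cong) (auto simp: ennreal_mult[symmetric] G split: split_indicator)
      finally show ?thesis .
    qed simp
  qed
  also have "\<dots> = (\<integral>\<^sup>+v. \<integral>\<^sup>+u. ennreal (pi powr (D / 2) / (Gamma (s / 2) * Gamma (D / 2))) *
      (ennreal (u powr (s / 2 - 1)) * ennreal (v powr (D / 2 - 1)) * ennreal (exp (- (u + 1 / 2) * v)) * indicator {0<..} u * indicator {0<..} v) \<partial>lborel \<partial>lborel)"
    by (rule lborel_pair.Fubini') simp
  also have "\<dots> = (\<integral>\<^sup>+v. ennreal (pi powr (D / 2) / Gamma (D / 2)) * (ennreal (v powr ((D - s) / 2 - 1) * exp (- (1 / 2) * v)) * indicator {0<..} v) \<partial>lborel)"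
  proof (rule nn_integral_cong)
    fix v :: real
    show "(\<integral>\<^sup>+u. ennreal (pi powr (D / 2) / (Gamma (s / 2) * Gamma (D / 2))) *
      (ennreal (u powr (s / 2 - 1)) * ennreal (v powr (D / 2 - 1)) * ennreal (exp (- (u + 1 / 2) * v)) * indicator {0<..} u * indicator {0<..} v) \<partial>lborel)
      = ennreal (pi powr (D / 2) / Gamma (D / 2)) * (ennreal (v powr ((D - s) / 2 - 1) * exp (- (1 / 2) * v)) * indicator {0<..} v)"
    proof (cases "v > 0")
      case True
      have "(\<integral>\<^sup>+u. ennreal (pi powr (D / 2) / (Gamma (s / 2) * Gamma (D / 2))) *
      (ennreal (u powr (s / 2 - 1)) * ennreal (v powr (D / 2 - 1)) * ennreal (exp (- (u + 1 / 2) * v)) * indicator {0<..} u * indicator {0<..} v) \<partial>lborel)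
        = (\<integral>\<^sup>+u. ennreal (pi powr (D / 2) / (Gamma (s / 2) * Gamma (D / 2)) * (v powr (D / 2 - 1) * exp (- (1 / 2) * v))) *
            (ennreal (u powr (s / 2 - 1) * exp (- v * u)) * indicator {0<..} u) \<partial>lborel)"
        unfolding e using True s D by (intro nn_integral_cong) (auto simp: ennreal_mult[symmetric] G mult_ac split: split_indicator)
      also have "\<dots> = ennreal (pi powr (D / 2) / (Gamma (s / 2) * Gamma (D / 2)) * (v powr (D / 2 - 1) * exp (- (1 / 2) * v))) * ennreal (Gamma (s / 2) * v powr (- (s / 2)))"
        using True s by (subst nn_integral_cmult, simp, subst gamma_nn_integral) auto
      also have "\<dots> = ennreal (pi powr (D / 2) / Gamma (D / 2) * ((v powr (D / 2 - 1) * v powr (- (s / 2))) * exp (- (1 / 2) * v)))"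
        using s D by (simp add: ennreal_mult[symmetric] G mult_ac)
      also have "v powr (D / 2 - 1) * v powr (- (s / 2)) = v powr ((D - s) / 2 - 1)"
        unfolding powr_add[symmetric] by (rule arg_cong[where f = "(powr) v"]) (simp add: field_simps)
      finally show ?thesis using True D by (simp add: ennreal_mult[symmetric] G)
    qed simp
  qed
  also have "\<dots> = ennreal (pi powr (D / 2) / Gamma (D / 2)) * ennreal (Gamma ((D - s) / 2) * (1 / 2) powr (- ((D - s) / 2)))"
    using s by (subst nn_integral_cmult, simp, subst gamma_nn_integral) auto
  also have "(1 / 2 :: real) powr (- ((D - s) / 2)) = 2 powr ((D - s) / 2)"
    by (simp add: powr_divide powr_minus)
  finally show ?thesis using s D by (simp add: ennreal_mult[symmetric] G)
qed

text \<open>The Mellin transform of the density in time. For b > 0 and \<alpha> b < d it is a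
  multiple of the Riesz kernel |x|^(\<alpha> b - d), see \<open>stable_potential_eq\<close>. Below,
  \<open>b = a + 1\<close> represents the power |x|^-\<gamma> and \<open>b = a\<close> its
  source.\<close>

definition stable_potential :: "real \<Rightarrow> real \<Rightarrow> real ^ 'n \<Rightarrow> ennreal" where
  "stable_potential \<alpha> b x = (\<integral>\<^sup>+t\<in>{0<..}. ennreal (t powr (b - 1) * stable_density \<alpha> t x) \<partial>lborel)"

lemma stable_potential_measurable[measurable]: "stable_potential \<alpha> b \<in> borel_measurable borel"
  unfolding stable_potential_def[abs_def] by measurable

lemma stable_potential_scaling:
  fixes x :: "real ^ 'n"
  assumes \<alpha>: "0 < \<alpha>" and c: "c > 0"
  shows "stable_potential \<alpha> b (c *\<^sub>R x) = ennreal (c powr (\<alpha> * b - real CARD('n))) * stable_potential \<alpha> b x"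
proof -
  let ?C = "c powr \<alpha>"
  have C: "?C > 0" using c by simp
  have "stable_potential \<alpha> b (c *\<^sub>R x)
    = ennreal ?C * (\<integral>\<^sup>+t. ennreal ((0 + ?C * t) powr (b - 1) * stable_density \<alpha> (0 + ?C * t) (c *\<^sub>R x)) * indicator {0<..} (0 + ?C * t) \<partial>lborel)"
    unfolding stable_potential_def using C by (subst nn_integral_real_affine[where c = ?C and t = 0]) auto
  also have "\<dots> = ennreal ?C * (\<integral>\<^sup>+t. ennreal (?C powr (b - 1) * c powr (- real CARD('n))) * (ennreal (t powr (b - 1) * stable_density \<alpha> t x) * indicator {0<..} t) \<partial>lborel)"
  proof (intro arg_cong[where f = "(*) (ennreal ?C)"] nn_integral_cong)
    fix t :: real
    show "ennreal ((0 + ?C * t) powr (b - 1) * stable_density \<alpha> (0 + ?C * t) (c *\<^sub>R x)) * indicator {0<..} (0 + ?C * t)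
      = ennreal (?C powr (b - 1) * c powr (- real CARD('n))) * (ennreal (t powr (b - 1) * stable_density \<alpha> t x) * indicator {0<..} t)"
    proof (cases "t > 0")
      case True
      have "(?C * t) powr (b - 1) * stable_density \<alpha> (?C * t) (c *\<^sub>R x)
        = (?C powr (b - 1) * c powr (- real CARD('n))) * (t powr (b - 1) * stable_density \<alpha> t x)"
        using True C by (simp only: stable_density_scaling[OF \<alpha> True c] powr_mult) simp
      thus ?thesis using True C by (simp add: ennreal_mult'[symmetric])
    next
      case False
      thus ?thesis using c by (auto simp: indicator_def zero_less_mult_iff)
    qed
  qed
  also have "\<dots> = ennreal ?C * (ennreal (?C powr (b - 1) * c powr (- real CARD('n))) * stable_potential \<alpha> b x)"
    unfolding stable_potential_def by (subst nn_integral_cmult) auto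
  also have "\<dots> = ennreal (?C * (?C powr (b - 1) * c powr (- real CARD('n)))) * stable_potential \<alpha> b x"
    by (simp add: ennreal_mult mult_ac)
  also have "?C * (?C powr (b - 1) * c powr (- real CARD('n))) = c powr (\<alpha> * b - real CARD('n))"
    by (simp add: powr_powr powr_add[symmetric] algebra_simps)
  finally show ?thesis .
qed

section \<open>Identification of the time integrals with Riesz kernels\<close>

context
  fixes \<alpha> :: real
  assumes \<alpha>: "0 < \<alpha>" "\<alpha> < 2"
begin

lemma stable_density_nonneg: "t > 0 \<Longrightarrow> 0 \<le> stable_density \<alpha> t (x :: real ^ 'n)"
  using stable_density_radial(1)[OF \<alpha> _ order_refl] .

lemma stable_potential_norm_cong:
  fixes x y :: "real ^ 'n"
  assumes "norm x = norm y"
  shows "stable_potential \<alpha> b x = stable_potential \<alpha> b y"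
  unfolding stable_potential_def using stable_density_norm_cong[OF \<alpha> _ assms]
  by (intro nn_integral_cong) (auto split: split_indicator)

text \<open>The case \<open>e = 1 / 2\<close>, \<open>\<eta> = 0\<close> of
  \<open>gauss_cos_stable_density\<close>, in which the Gaussians on the two sides coincide.\<close>

lemma stable_density_gauss_nn_integral:
  assumes t: "t > 0"
  shows "(\<integral>\<^sup>+x. ennreal (stable_density \<alpha> t (x::real ^ 'n) * exp (- (norm x)\<^sup>2 / 2)) \<partial>lborel)
     = ennreal ((2 * pi) powr (- real CARD('n) / 2)) *
       (\<integral>\<^sup>+\<xi>. ennreal (exp (- t * norm (\<xi>::real ^ 'n) powr \<alpha>) * exp (- (norm \<xi>)\<^sup>2 / 2)) \<partial>lborel)"
proof -
  let ?\<phi> = "\<lambda>\<xi>::real ^ 'n. exp (- t * norm \<xi> powr \<alpha>) * exp (- (norm \<xi>)\<^sup>2 / 2)"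
  have I\<phi>: "integrable lborel ?\<phi>"
    by (rule Bochner_Integration.integrable_bound[OF stable_symbol_integrable[OF \<alpha>(1) t]]) auto
  have Ip: "integrable lborel (\<lambda>x::real ^ 'n. stable_density \<alpha> t x * exp (- (norm x)\<^sup>2 / 2))"
    using stable_density_nonneg[OF t]
    by (intro Bochner_Integration.integrable_bound[OF stable_density_integrable[OF \<alpha> t]])
       (auto intro!: AE_I2 mult_left_le simp: abs_mult)
  have "(LINT x|lborel. stable_density \<alpha> t (x :: real ^ 'n) * exp (- (norm x)\<^sup>2 / 2)) = gauss_cos (1 / 2) (stable_density \<alpha> t) (0 :: real ^ 'n)"
    unfolding gauss_cos_def by (simp add: mult.commute)
  also have "\<dots> = (2 * pi) powr (- real CARD('n)) * (2 * pi) powr (real CARD('n) / 2) * (LINT \<xi>|lborel. ?\<phi> \<xi>)"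
    by (subst gauss_cos_stable_density[OF \<alpha> t]) (simp_all add: mult.commute)
  also have "(2 * pi) powr (- real CARD('n)) * (2 * pi) powr (real CARD('n) / 2) = (2 * pi) powr (- real CARD('n) / 2)"
    by (simp flip: powr_add)
  finally have "ennreal (LINT x|lborel. stable_density \<alpha> t (x :: real ^ 'n) * exp (- (norm x)\<^sup>2 / 2)) = ennreal ((2 * pi) powr (- real CARD('n) / 2)) * ennreal (LINT \<xi>|lborel. ?\<phi> \<xi>)"
    by (simp add: ennreal_mult)
  moreover have "(\<integral>\<^sup>+x. ennreal (stable_density \<alpha> t (x::real ^ 'n) * exp (- (norm x)\<^sup>2 / 2)) \<partial>lborel)
      = ennreal (LINT x|lborel. stable_density \<alpha> t (x :: real ^ 'n) * exp (- (norm x)\<^sup>2 / 2))"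
    by (intro nn_integral_eq_integral Ip AE_I2 mult_nonneg_nonneg stable_density_nonneg[OF t]) simp
  moreover have "(\<integral>\<^sup>+\<xi>. ennreal (?\<phi> \<xi>) \<partial>lborel) = ennreal (LINT \<xi>|lborel. ?\<phi> \<xi>)"
    by (intro nn_integral_eq_integral I\<phi> AE_I2) simp
  ultimately show ?thesis by simp
qed

text \<open>On the Fourier side the time integral is a Gamma integral with value
  \<open>Gamma b\<close> times |\<xi>|^(-\<alpha> b), so an explicit Gaussian moment replaces the
  unknown potential.\<close>

lemma stable_potential_gauss_nn_integral:
  assumes b: "b > 0"
  shows "(\<integral>\<^sup>+x. stable_potential \<alpha> b (x::real ^ 'n) * ennreal (exp (- (norm x)\<^sup>2 / 2)) \<partial>lborel)
     = ennreal ((2 * pi) powr (- real CARD('n) / 2) * Gamma b) *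
       (\<integral>\<^sup>+\<xi>. ennreal (norm (\<xi>::real ^ 'n) powr (- (\<alpha> * b)) * exp (- (norm \<xi>)\<^sup>2 / 2)) \<partial>lborel)"
proof -
  let ?K = "(2 * pi) powr (- real CARD('n) / 2)"
  have "(\<integral>\<^sup>+x. stable_potential \<alpha> b (x::real ^ 'n) * ennreal (exp (- (norm x)\<^sup>2 / 2)) \<partial>lborel)
    = (\<integral>\<^sup>+x. \<integral>\<^sup>+t. ennreal (t powr (b - 1)) * ennreal (stable_density \<alpha> t (x::real ^ 'n) * exp (- (norm x)\<^sup>2 / 2)) * indicator {0<..} t \<partial>lborel \<partial>lborel)"
    unfolding stable_potential_def using stable_density_nonneg
    by (intro nn_integral_cong, subst nn_integral_multc[symmetric])
       (auto simp: ennreal_mult''[symmetric] ennreal_mult'[symmetric] mult_ac intro!: nn_integral_cong split: split_indicator)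
  also have "\<dots> = (\<integral>\<^sup>+t. \<integral>\<^sup>+x. ennreal (t powr (b - 1)) * ennreal (stable_density \<alpha> t (x::real ^ 'n) * exp (- (norm x)\<^sup>2 / 2)) * indicator {0<..} t \<partial>lborel \<partial>lborel)"
    by (rule lborel_pair.Fubini') simp
  also have "\<dots> = (\<integral>\<^sup>+t. \<integral>\<^sup>+\<xi>. ennreal ?K * (ennreal (t powr (b - 1)) * ennreal (exp (- t * norm (\<xi>::real ^ 'n) powr \<alpha>) * exp (- (norm \<xi>)\<^sup>2 / 2)) * indicator {0<..} t) \<partial>lborel \<partial>lborel)"
  proof (rule nn_integral_cong)
    fix t :: real
    show "(\<integral>\<^sup>+x. ennreal (t powr (b - 1)) * ennreal (stable_density \<alpha> t (x::real ^ 'n) * exp (- (norm x)\<^sup>2 / 2)) * indicator {0<..} t \<partial>lborel)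
      = (\<integral>\<^sup>+\<xi>. ennreal ?K * (ennreal (t powr (b - 1)) * ennreal (exp (- t * norm (\<xi>::real ^ 'n) powr \<alpha>) * exp (- (norm \<xi>)\<^sup>2 / 2)) * indicator {0<..} t) \<partial>lborel)"
    proof (cases "t > 0")
      case True
      thus ?thesis using stable_density_gauss_nn_integral[OF True, where 'n = 'n]
        by (simp add: nn_integral_cmult mult_ac)
    qed simp
  qed
  also have "\<dots> = (\<integral>\<^sup>+\<xi>. \<integral>\<^sup>+t. ennreal ?K * (ennreal (t powr (b - 1)) * ennreal (exp (- t * norm (\<xi>::real ^ 'n) powr \<alpha>) * exp (- (norm \<xi>)\<^sup>2 / 2)) * indicator {0<..} t) \<partial>lborel \<partial>lborel)"
    by (rule lborel_pair.Fubini') simp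
  also have "\<dots> = (\<integral>\<^sup>+\<xi>. ennreal (?K * Gamma b) * ennreal (norm (\<xi>::real ^ 'n) powr (- (\<alpha> * b)) * exp (- (norm \<xi>)\<^sup>2 / 2)) \<partial>lborel)"
  proof (rule nn_integral_cong_AE)
    show "AE \<xi>::real ^ 'n in lborel. (\<integral>\<^sup>+t. ennreal ?K * (ennreal (t powr (b - 1)) * ennreal (exp (- t * norm \<xi> powr \<alpha>) * exp (- (norm \<xi>)\<^sup>2 / 2)) * indicator {0<..} t) \<partial>lborel)
      = ennreal (?K * Gamma b) * ennreal (norm \<xi> powr (- (\<alpha> * b)) * exp (- (norm \<xi>)\<^sup>2 / 2))"
      using AE_lborel_singleton[of "0 :: real ^ 'n"]
    proof eventually_elim
      case (elim \<xi>)
      hence r: "norm \<xi> powr \<alpha> > 0" by simp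
      have "(\<integral>\<^sup>+t. ennreal ?K * (ennreal (t powr (b - 1)) * ennreal (exp (- t * norm \<xi> powr \<alpha>) * exp (- (norm \<xi>)\<^sup>2 / 2)) * indicator {0<..} t) \<partial>lborel)
        = (\<integral>\<^sup>+t. ennreal (?K * exp (- (norm \<xi>)\<^sup>2 / 2)) * (ennreal (t powr (b - 1) * exp (- (norm \<xi> powr \<alpha>) * t)) * indicator {0<..} t) \<partial>lborel)"
        by (intro nn_integral_cong) (auto simp: ennreal_mult mult_ac)
      also have "\<dots> = ennreal (?K * exp (- (norm \<xi>)\<^sup>2 / 2)) * ennreal (Gamma b * (norm \<xi> powr \<alpha>) powr (- b))"
        using r b by (subst nn_integral_cmult, simp, subst gamma_nn_integral) auto
      finally show ?case using b by (simp add: powr_powr ennreal_mult[symmetric] Gamma_real_nonneg mult_ac)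
    qed
  qed
  finally show ?thesis by (simp add: nn_integral_cmult)
qed

text \<open>The factor \<open>Gamma b\<close> and the Fourier normalisation, times the quotient of
  the Gaussian moments of |\<xi>|^(-\<alpha> b) and of |x|^(\<alpha> b - d).\<close>

definition riesz_const :: "nat \<Rightarrow> real \<Rightarrow> real" where
  "riesz_const d b = (2 * pi) powr (- real d / 2) * Gamma b *
     (Gamma ((real d - \<alpha> * b) / 2) * 2 powr ((real d - \<alpha> * b) / 2)) / (Gamma (\<alpha> * b / 2) * 2 powr (\<alpha> * b / 2))"

text \<open>
  Scaling and rotational symmetry determine the potential up to a constant, which is read off by
  integrating against \<open>exp (-|x|\<^sup>2 / 2)\<close>, a fixed point of the normalised Fourier transform.
\<close>

lemma stable_potential_eq:
  fixes x :: "real ^ 'n"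
  assumes b: "0 < b" "\<alpha> * b < real CARD('n)" and x: "x \<noteq> 0"
  shows "stable_potential \<alpha> b x = ennreal (riesz_const CARD('n) b * norm x powr (\<alpha> * b - real CARD('n)))"
proof -
  let ?d = "real CARD('n)"
  note G = Gamma_real_pos less_imp_neq[OF Gamma_real_pos, symmetric]
  have ab: "0 < \<alpha> * b" using b \<alpha> by simp
  obtain e :: "real ^ 'n" where e: "norm e = 1" using vector_choose_size[of 1] by auto
  define C where "C = stable_potential \<alpha> b e"
  have V: "stable_potential \<alpha> b z = ennreal (norm z powr (\<alpha> * b - ?d)) * C" if "z \<noteq> 0" for z :: "real ^ 'n"
  proof -
    have "stable_potential \<alpha> b z = stable_potential \<alpha> b (norm z *\<^sub>R e)"
      by (rule stable_potential_norm_cong) (simp add: e)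
    thus ?thesis using that \<alpha> unfolding C_def by (simp add: stable_potential_scaling)
  qed
  define K where "K = pi powr (?d / 2) / Gamma (?d / 2)"
  define A where "A = K * (Gamma (\<alpha> * b / 2) * 2 powr (\<alpha> * b / 2))"
  define B where "B = (2 * pi) powr (- ?d / 2) * Gamma b * (K * (Gamma ((?d - \<alpha> * b) / 2) * 2 powr ((?d - \<alpha> * b) / 2)))"
  have K: "K > 0" by (simp add: K_def G)
  have A: "A > 0" using ab K by (simp add: A_def G)
  \<comment> \<open>A priori \<open>C\<close> may be infinite. The equation
    \<open>C * ennreal A = ennreal B\<close> with \<open>A > 0\<close> rules this out, so the
    division is carried out as a multiplication by \<open>1 / A\<close>.\<close>
  have "C * ennreal A = (\<integral>\<^sup>+z. C * ennreal (norm (z::real ^ 'n) powr (- (?d - \<alpha> * b)) * exp (- (norm z)\<^sup>2 / 2)) \<partial>lborel)"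
    using ab b gaussian_moment_nn_integral[of "?d - \<alpha> * b", where 'a = "real ^ 'n"]
    by (subst nn_integral_cmult) (auto simp: A_def K_def)
  also have "\<dots> = (\<integral>\<^sup>+z. stable_potential \<alpha> b (z::real ^ 'n) * ennreal (exp (- (norm z)\<^sup>2 / 2)) \<partial>lborel)"
  proof (rule nn_integral_cong_AE)
    show "AE z::real ^ 'n in lborel. C * ennreal (norm z powr (- (?d - \<alpha> * b)) * exp (- (norm z)\<^sup>2 / 2))
        = stable_potential \<alpha> b z * ennreal (exp (- (norm z)\<^sup>2 / 2))"
      using AE_lborel_singleton[of "0 :: real ^ 'n"]
      by eventually_elim (simp add: V ennreal_mult mult_ac)
  qed
  also have "\<dots> = ennreal B"
    unfolding stable_potential_gauss_nn_integral[OF b(1)] B_def K_def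
    using gaussian_moment_nn_integral[of "\<alpha> * b", where 'a = "real ^ 'n"] ab b
    by (simp add: ennreal_mult[symmetric] G)
  finally have CA: "C * ennreal A = ennreal B" .
  have "ennreal A * ennreal (1 / A) = 1" using A by (simp add: ennreal_mult[symmetric])
  hence "C = (C * ennreal A) * ennreal (1 / A)" by (simp only: mult.assoc mult_1_right)
  also have "\<dots> = ennreal (B / A)" unfolding CA using A by (simp add: ennreal_mult''[symmetric])
  also have "B / A = riesz_const CARD('n) b" using K by (simp add: A_def B_def riesz_const_def)
  finally have "C = ennreal (riesz_const CARD('n) b)" .
  thus ?thesis using V[OF x] by (simp add: ennreal_mult''[symmetric] mult.commute)
qed

lemma riesz_const_pos:
  "0 < b \<Longrightarrow> \<alpha> * b < real d \<Longrightarrow> riesz_const d b > 0"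
  unfolding riesz_const_def using \<alpha> by (auto intro!: divide_pos_pos mult_pos_pos Gamma_real_pos)

end

text \<open>
  Writing \<open>t\<^sup>a = \<integral>\<^sub>0\<^sup>t a u\<^sup>a\<^sup>-\<^sup>1 du\<close> in the potential of order \<open>a + 1\<close> and substituting \<open>t = u + s\<close> exhibits it as
  the integral over all \<open>s > 0\<close> of the heat flow, at time \<open>s\<close>, of \<open>a\<close> times the potential of order
  \<open>a\<close>; this flow is \<open>stable_mixture \<alpha> a s\<close>.
\<close>

definition stable_mixture :: "real \<Rightarrow> real \<Rightarrow> real \<Rightarrow> real ^ 'n \<Rightarrow> ennreal" where
  "stable_mixture \<alpha> a s x = (\<integral>\<^sup>+u\<in>{0<..}. ennreal (a * u powr (a - 1)) * ennreal (stable_density \<alpha> (u + s) x) \<partial>lborel)"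

lemma stable_mixture_measurable[measurable (raw)]:
  assumes [measurable]: "f \<in> borel_measurable M" "g \<in> borel_measurable M"
  shows "(\<lambda>w. stable_mixture \<alpha> a (f w) (g w :: real ^ 'n)) \<in> borel_measurable M"
  unfolding stable_mixture_def by measurable

lemma heat_kernel_measurable[measurable (raw)]:
  assumes [measurable]: "f \<in> borel_measurable M" "g \<in> borel_measurable M" "h \<in> borel_measurable M"
  shows "(\<lambda>w. heat_kernel \<alpha> (f w) (g w) (h w :: real ^ 'n)) \<in> borel_measurable M"
  unfolding heat_kernel_def by measurable

section \<open>Heat flow of the time integrals\<close>

context
  fixes \<alpha> :: real
  assumes \<alpha>: "0 < \<alpha>" "\<alpha> < 2"
begin

lemma heat_kernel_total_mass:
  fixes x :: "real ^ 'n"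
  assumes "t > 0"
  shows "(\<integral>\<^sup>+y. heat_kernel \<alpha> t x y \<partial>lborel) = 1"
proof -
  have "(\<integral>\<^sup>+y. heat_kernel \<alpha> t x y \<partial>lborel) = (\<integral>\<^sup>+y. ennreal (stable_density \<alpha> t (y :: real ^ 'n)) \<partial>lborel)"
    unfolding heat_kernel_def by (subst nn_integral_affine_euclidean[where c = 1 and t = x]) auto
  also have "\<dots> = 1"
    using stable_density_nonneg[OF \<alpha> assms] stable_density_integrable[OF \<alpha> assms, where 'n = 'n]
      stable_density_integral[OF \<alpha> assms, where 'n = 'n]
    by (subst nn_integral_eq_integral) auto
  finally show ?thesis .
qed

lemma stable_potential_eq_mixture:
  fixes x :: "real ^ 'n"
  assumes a: "a > 0"
  shows "stable_potential \<alpha> (a + 1) x = (\<integral>\<^sup>+s\<in>{0<..}. stable_mixture \<alpha> a s x \<partial>lborel)"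
proof -
  let ?w = "\<lambda>u. ennreal (a * u powr (a - 1))"
  let ?p = "\<lambda>t. ennreal (stable_density \<alpha> t x)"
  have "stable_potential \<alpha> (a + 1) x = (\<integral>\<^sup>+t. \<integral>\<^sup>+u. ?w u * (indicator {0<..} u * indicator {0<..} (t - u)) * (?p t * indicator {0<..} t) \<partial>lborel \<partial>lborel)"
    unfolding stable_potential_def
  proof (rule nn_integral_cong)
    fix t :: real
    show "ennreal (t powr (a + 1 - 1) * stable_density \<alpha> t x) * indicator {0<..} t
        = (\<integral>\<^sup>+u. ?w u * (indicator {0<..} u * indicator {0<..} (t - u)) * (?p t * indicator {0<..} t) \<partial>lborel)"
    proof (cases "t > 0")
      case True
      \<comment> \<open>Indicators of fixed sets make joint measurability in \<open>t\<close> and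
        \<open>u\<close> automatic.\<close>
      have "indicator {0<..<t} u = (indicator {0<..} u * indicator {0<..} (t - u) :: ennreal)" for u
        by (auto split: split_indicator)
      thus ?thesis using True powr_nn_integral[OF a, of t] by (simp add: nn_integral_multc ennreal_mult')
    qed simp
  qed
  also have "\<dots> = (\<integral>\<^sup>+u. \<integral>\<^sup>+t. ?w u * (indicator {0<..} u * indicator {0<..} (t - u)) * (?p t * indicator {0<..} t) \<partial>lborel \<partial>lborel)"
    by (rule lborel_pair.Fubini') simp
  also have "\<dots> = (\<integral>\<^sup>+u. \<integral>\<^sup>+s. ?w u * ?p (u + s) * indicator {0<..} u * indicator {0<..} s \<partial>lborel \<partial>lborel)"
  proof (rule nn_integral_cong)
    fix u :: real
    have "(\<integral>\<^sup>+t. ?w u * (indicator {0<..} u * indicator {0<..} (t - u)) * (?p t * indicator {0<..} t) \<partial>lborel)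
      = (\<integral>\<^sup>+s. ?w u * (indicator {0<..} u * indicator {0<..} (u + 1 * s - u)) * (?p (u + 1 * s) * indicator {0<..} (u + 1 * s)) \<partial>lborel)"
      by (subst nn_integral_real_affine[where c = 1 and t = u]) auto
    also have "\<dots> = (\<integral>\<^sup>+s. ?w u * ?p (u + s) * indicator {0<..} u * indicator {0<..} s \<partial>lborel)"
      by (intro nn_integral_cong) (auto split: split_indicator)
    finally show "(\<integral>\<^sup>+t. ?w u * (indicator {0<..} u * indicator {0<..} (t - u)) * (?p t * indicator {0<..} t) \<partial>lborel)
      = (\<integral>\<^sup>+s. ?w u * ?p (u + s) * indicator {0<..} u * indicator {0<..} s \<partial>lborel)" .
  qed
  also have "\<dots> = (\<integral>\<^sup>+s. \<integral>\<^sup>+u. ?w u * ?p (u + s) * indicator {0<..} u * indicator {0<..} s \<partial>lborel \<partial>lborel)"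
    by (rule lborel_pair.Fubini') simp
  also have "\<dots> = (\<integral>\<^sup>+s\<in>{0<..}. stable_mixture \<alpha> a s x \<partial>lborel)"
    unfolding stable_mixture_def by (simp add: nn_integral_multc)
  finally show ?thesis .
qed

lemma stable_mixture_0:
  fixes x :: "real ^ 'n"
  assumes "a > 0"
  shows "stable_mixture \<alpha> a 0 x = ennreal a * stable_potential \<alpha> a x"
  unfolding stable_mixture_def stable_potential_def using assms
  by (subst nn_integral_cmult[symmetric])
     (auto intro!: nn_integral_cong simp: ennreal_mult'[symmetric] ennreal_mult''[symmetric] mult_ac split: split_indicator)

lemma heat_kernel_stable_mixture:
  fixes x :: "real ^ 'n"
  assumes T: "T > 0" and s: "s \<ge> 0"
  shows "(\<integral>\<^sup>+z. heat_kernel \<alpha> T x z * stable_mixture \<alpha> a s z \<partial>lborel) = stable_mixture \<alpha> a (T + s) x"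
proof -
  let ?w = "\<lambda>u. ennreal (a * u powr (a - 1))"
  have "(\<integral>\<^sup>+z. heat_kernel \<alpha> T x z * stable_mixture \<alpha> a s z \<partial>lborel)
    = (\<integral>\<^sup>+z. \<integral>\<^sup>+u. ?w u * indicator {0<..} u * (ennreal (stable_density \<alpha> T (z - x)) * ennreal (stable_density \<alpha> (u + s) z)) \<partial>lborel \<partial>lborel)"
    unfolding stable_mixture_def heat_kernel_def
    by (intro nn_integral_cong, subst nn_integral_cmult[symmetric]) (auto simp: mult_ac)
  also have "\<dots> = (\<integral>\<^sup>+u. \<integral>\<^sup>+z. ?w u * indicator {0<..} u * (ennreal (stable_density \<alpha> T (z - x)) * ennreal (stable_density \<alpha> (u + s) z)) \<partial>lborel \<partial>lborel)"
    by (rule lborel_pair.Fubini') simp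
  also have "\<dots> = (\<integral>\<^sup>+u. ?w u * indicator {0<..} u * (\<integral>\<^sup>+z. ennreal (stable_density \<alpha> T (z - x)) * ennreal (stable_density \<alpha> (u + s) z) \<partial>lborel) \<partial>lborel)"
    by (simp add: nn_integral_cmult)
  also have "\<dots> = stable_mixture \<alpha> a (T + s) x"
    unfolding stable_mixture_def
  proof (rule nn_integral_cong)
    fix u :: real
    show "?w u * indicator {0<..} u * (\<integral>\<^sup>+z. ennreal (stable_density \<alpha> T (z - x)) * ennreal (stable_density \<alpha> (u + s) z) \<partial>lborel)
      = ?w u * ennreal (stable_density \<alpha> (u + (T + s)) x) * indicator {0<..} u"
    proof (cases "u > 0")
      case True
      thus ?thesis using stable_density_nn_semigroup[OF \<alpha> T, of "u + s" x] s by (simp add: add_ac)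
    qed simp
  qed
  finally show ?thesis .
qed

text \<open>The integral of the mixtures over all s > 0 is split at \<open>T\<close>: by the
  semigroup property the heat flow over time \<open>T\<close> shifts the range to s > T, and the
  source accounts for 0 < s < T.\<close>

lemma stable_potential_stationary:
  fixes x :: "real ^ 'n"
  assumes a: "a > 0" and T: "T > 0"
  shows "stable_potential \<alpha> (a + 1) x = (\<integral>\<^sup>+z. heat_kernel \<alpha> T x z * stable_potential \<alpha> (a + 1) z \<partial>lborel)
    + (\<integral>\<^sup>+s\<in>{0<..<T}. (\<integral>\<^sup>+z. heat_kernel \<alpha> s x z * (ennreal a * stable_potential \<alpha> a z) \<partial>lborel) \<partial>lborel)"
proof -
  let ?W = "\<lambda>s. stable_mixture \<alpha> a s x"
  have 1: "(\<integral>\<^sup>+s\<in>{0<..<T}. (\<integral>\<^sup>+z. heat_kernel \<alpha> s x z * (ennreal a * stable_potential \<alpha> a z) \<partial>lborel) \<partial>lborel)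
      = (\<integral>\<^sup>+s\<in>{0<..<T}. ?W s \<partial>lborel)"
    using heat_kernel_stable_mixture[of _ 0 x a] by (intro nn_integral_cong) (auto simp: stable_mixture_0[OF a] split: split_indicator)
  have "(\<integral>\<^sup>+z. heat_kernel \<alpha> T x z * stable_potential \<alpha> (a + 1) z \<partial>lborel)
      = (\<integral>\<^sup>+z. \<integral>\<^sup>+s. heat_kernel \<alpha> T x z * stable_mixture \<alpha> a s z * indicator {0<..} s \<partial>lborel \<partial>lborel)"
    unfolding stable_potential_eq_mixture[OF a] by (simp add: nn_integral_cmult mult.assoc)
  also have "\<dots> = (\<integral>\<^sup>+s. \<integral>\<^sup>+z. heat_kernel \<alpha> T x z * stable_mixture \<alpha> a s z * indicator {0<..} s \<partial>lborel \<partial>lborel)"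
    by (rule lborel_pair.Fubini') simp
  also have "\<dots> = (\<integral>\<^sup>+s. ?W (T + 1 * s) * indicator {T<..} (T + 1 * s) \<partial>lborel)"
    by (intro nn_integral_cong) (auto simp: nn_integral_multc heat_kernel_stable_mixture[OF T] split: split_indicator)
  also have "\<dots> = (\<integral>\<^sup>+s\<in>{T<..}. ?W s \<partial>lborel)"
    by (subst (2) nn_integral_real_affine[where c = 1 and t = T]) auto
  finally have 2: "(\<integral>\<^sup>+z. heat_kernel \<alpha> T x z * stable_potential \<alpha> (a + 1) z \<partial>lborel) = (\<integral>\<^sup>+s\<in>{T<..}. ?W s \<partial>lborel)" .
  have "(\<integral>\<^sup>+s\<in>{0<..}. ?W s \<partial>lborel) = (\<integral>\<^sup>+s. ?W s * indicator {T<..} s + ?W s * indicator {0<..<T} s \<partial>lborel)"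
  proof (rule nn_integral_cong_AE)
    show "AE s in lborel. ?W s * indicator {0<..} s = ?W s * indicator {T<..} s + ?W s * indicator {0<..<T} s"
      using AE_lborel_singleton[of T] by eventually_elim (use T in \<open>auto split: split_indicator\<close>)
  qed
  also have "\<dots> = (\<integral>\<^sup>+s\<in>{T<..}. ?W s \<partial>lborel) + (\<integral>\<^sup>+s\<in>{0<..<T}. ?W s \<partial>lborel)"
    by (rule nn_integral_add) auto
  finally show ?thesis unfolding 1 2 stable_potential_eq_mixture[OF a, of x] .
qed

text \<open>\<open>a\<close> is determined by \<alpha> (a + 1) = d - \<gamma>. The rule
  \<open>Gamma (a + 1) = a * Gamma a\<close> absorbs the factor \<open>a\<close>, and the remaining
  Gamma values and powers of 2 assemble to the formula for \<open>kappa\<close>.\<close>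

lemma riesz_const_ratio:
  fixes d :: nat
  assumes g: "0 < \<gamma>" "\<gamma> < real d - \<alpha>"
  defines "a \<equiv> (real d - \<gamma> - \<alpha>) / \<alpha>"
  shows "a * riesz_const \<alpha> d a = riesz_const \<alpha> d (a + 1) * kappa d \<alpha> \<gamma>"
proof -
  have a: "a > 0" using g \<alpha> by (simp add: a_def)
  have e: "\<alpha> * a = real d - \<gamma> - \<alpha>" "\<alpha> * (a + 1) = real d - \<gamma>"
    using \<alpha> by (simp_all add: a_def field_simps)
  note G = less_imp_neq[OF Gamma_real_pos, symmetric]
  have "Gamma (a + 1) = a * Gamma a" using a by (intro Gamma_plus1) (auto elim!: nonpos_Ints_cases)
  moreover have "2 powr ((\<gamma> + \<alpha>) / 2) / 2 powr ((real d - \<gamma> - \<alpha>) / 2)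
      = 2 powr \<alpha> * (2 powr (\<gamma> / 2) / 2 powr ((real d - \<gamma>) / 2))"
    unfolding powr_add[symmetric] powr_diff[symmetric] by (rule arg_cong[where f = "(powr) 2"]) (simp add: field_simps)
  ultimately show ?thesis using g \<alpha> a
    unfolding riesz_const_def[OF \<alpha>] kappa_def e by (simp add: G divide_simps)
qed

end

section \<open>Monotonicity of the coupling constant\<close>

lemma kappa_pos: "0 < \<alpha> \<Longrightarrow> 0 < \<gamma> \<Longrightarrow> \<gamma> < real d - \<alpha> \<Longrightarrow> 0 < kappa d \<alpha> \<gamma>"
  unfolding kappa_def by (auto intro!: divide_pos_pos mult_pos_pos Gamma_real_pos)

text \<open>The trigamma function is strictly decreasing, so the increment has a negative
  derivative. Equivalently, \<open>ln_Gamma (x + h) - ln_Gamma x\<close> is strictly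
  concave.\<close>

lemma Digamma_increment_antimono:
  fixes x y h :: real
  assumes "0 < x" "x < y" "0 < h"
  shows "Digamma (y + h) - Digamma y < Digamma (x + h) - Digamma x"
proof (rule DERIV_neg_imp_decreasing[OF assms(2)])
  fix u assume u: "x \<le> u" "u \<le> y"
  hence "((\<lambda>u. Digamma (u + h) - Digamma u) has_real_derivative (Polygamma 1 (u + h) - Polygamma 1 u)) (at u)"
    using assms by (auto intro!: derivative_eq_intros elim!: nonpos_Ints_cases)
  moreover have "Polygamma 1 (u + h) < Polygamma 1 u"
    using assms u by (intro Polygamma_real_strict_antimono) auto
  ultimately show "\<exists>y. ((\<lambda>u. Digamma (u + h) - Digamma u) has_real_derivative y) (at u) \<and> y < 0"
    by force
qed

text \<open>
  With \<open>g(x) = ln \<Gamma>(x + \<alpha>/2) - ln \<Gamma>(x)\<close> and \<open>m = (d - \<alpha>)/2\<close> one has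
  \<open>ln \<kappa>\<^sub>\<beta> = \<alpha> ln 2 + g(\<beta>/2) + g(m - \<beta>/2)\<close>, and \<open>g\<close> is strictly concave.
\<close>

lemma kappa_strict_mono:
  fixes d :: nat
  assumes \<alpha>: "0 < \<alpha>" and b: "0 < \<beta>" "\<beta> < \<delta>" "\<delta> \<le> (real d - \<alpha>) / 2"
  shows "kappa d \<alpha> \<beta> < kappa d \<alpha> \<delta>"
proof -
  define h where "h = \<alpha> / 2"
  define m where "m = (real d - \<alpha>) / 2"
  define F where "F x = (ln_Gamma (x + h) - ln_Gamma x) + (ln_Gamma (m - x + h) - ln_Gamma (m - x))" for x :: real
  have h: "h > 0" using \<alpha> by (simp add: h_def)
  have k: "kappa d \<alpha> g = 2 powr \<alpha> * exp (F (g / 2))" if g: "0 < g" "g < real d - \<alpha>" for g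
  proof -
    have *: "g / 2 + h = (g + \<alpha>) / 2" "m - g / 2 = (real d - g - \<alpha>) / 2" "(real d - g - \<alpha>) / 2 + h = (real d - g) / 2"
      by (simp_all add: h_def m_def field_simps)
    thus ?thesis using g \<alpha> unfolding kappa_def F_def *
      by (simp add: Gamma_real_pos_exp exp_add exp_diff)
  qed
  have der: "(F has_real_derivative (Digamma (x + h) - Digamma x) - (Digamma (m - x + h) - Digamma (m - x))) (at x)"
    if "0 < x" "x < m" for x
    unfolding F_def using that h by (auto intro!: derivative_eq_intros)
  \<comment> \<open>Positivity of the derivative is asked for only inside the interval, since it
    vanishes at the right end point when \<delta> = (d - \<alpha>) / 2.\<close>
  have "F (\<beta> / 2) < F (\<delta> / 2)"
  proof (rule DERIV_pos_imp_increasing_open[where f = F])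
    show "\<beta> / 2 < \<delta> / 2" using b by simp
    show "continuous_on {\<beta> / 2..\<delta> / 2} F"
      using b \<alpha> by (intro DERIV_continuous_on[OF has_field_derivative_at_within[OF der]]) (auto simp: m_def)
    fix x assume x: "\<beta> / 2 < x" "x < \<delta> / 2"
    \<comment> \<open>2 x < \<delta> \<le> m, which places \<open>x\<close> to the left of its
      mirror point \<open>m - x\<close>.\<close>
    have "0 < x" "x < m - x" using x b \<alpha> by (auto simp: m_def field_simps)
    hence "(F has_real_derivative (Digamma (x + h) - Digamma x) - (Digamma (m - x + h) - Digamma (m - x))) (at x)"
      and "(Digamma (x + h) - Digamma x) - (Digamma (m - x + h) - Digamma (m - x)) > 0"
      using der[of x] Digamma_increment_antimono[of x "m - x" h] h by auto
    thus "\<exists>y. (F has_real_derivative y) (at x) \<and> y > 0" by blast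
  qed
  thus ?thesis using b \<alpha> by (simp add: k)
qed

section \<open>Stationarity of the powers |x|^-\<gamma>\<close>

context
  fixes \<alpha> :: real
  assumes \<alpha>: "0 < \<alpha>" "\<alpha> < 2"
begin

text \<open>This is \<open>stable_potential_stationary\<close> with \<open>a\<close> such that the
  potential of order \<open>a + 1\<close> is \<open>C\<close> times the power. By
  \<open>riesz_const_ratio\<close> the source carries the same \<open>C\<close> next to
  \<open>kappa\<close>, and \<open>C\<close>, being positive and finite, cancels. Under the
  integrals the formulas are needed only for almost every \<open>z\<close>.\<close>

lemma norm_powr_stationary:
  fixes x :: "real ^ 'n"
  assumes g: "0 < \<gamma>" "\<gamma> < real CARD('n) - \<alpha>" and x: "x \<noteq> 0" and T: "T > 0"
  shows "ennreal (norm x powr (- \<gamma>)) = (\<integral>\<^sup>+z. heat_kernel \<alpha> T x z * ennreal (norm z powr (- \<gamma>)) \<partial>lborel)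
    + (\<integral>\<^sup>+s\<in>{0<..<T}. (\<integral>\<^sup>+z. heat_kernel \<alpha> s x z * ennreal (kappa CARD('n) \<alpha> \<gamma> * norm z powr (- \<alpha> - \<gamma>)) \<partial>lborel) \<partial>lborel)"
proof -
  let ?d = "real CARD('n)"
  define a where "a = (?d - \<gamma> - \<alpha>) / \<alpha>"
  define C where "C = riesz_const \<alpha> CARD('n) (a + 1)"
  have a: "a > 0" using g \<alpha> by (simp add: a_def)
  have e: "\<alpha> * a = ?d - \<gamma> - \<alpha>" "\<alpha> * (a + 1) = ?d - \<gamma>"
    using \<alpha> by (simp_all add: a_def field_simps)
  have C: "C > 0" unfolding C_def using a e g by (intro riesz_const_pos[OF \<alpha>]) auto
  have V1: "stable_potential \<alpha> (a + 1) z = ennreal C * ennreal (norm z powr (- \<gamma>))" if "z \<noteq> 0" for z :: "real ^ 'n"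
    using stable_potential_eq[OF \<alpha>, of "a + 1" z] a e g that C by (simp add: C_def ennreal_mult)
  have V2: "ennreal a * stable_potential \<alpha> a z = ennreal C * ennreal (kappa CARD('n) \<alpha> \<gamma> * norm z powr (- \<alpha> - \<gamma>))"
    if "z \<noteq> 0" for z :: "real ^ 'n"
  proof -
    have "ennreal a * stable_potential \<alpha> a z = ennreal (a * riesz_const \<alpha> CARD('n) a * norm z powr (- \<alpha> - \<gamma>))"
      using stable_potential_eq[OF \<alpha>, of a z] a e g \<alpha> that by (simp add: ennreal_mult'[symmetric] mult.assoc algebra_simps)
    also have "a * riesz_const \<alpha> CARD('n) a = C * kappa CARD('n) \<alpha> \<gamma>"
      unfolding C_def a_def by (rule riesz_const_ratio[OF \<alpha> g])
    finally show ?thesis using C by (simp add: ennreal_mult'[symmetric] mult.assoc)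
  qed
  have P1: "(\<integral>\<^sup>+z. heat_kernel \<alpha> T x z * stable_potential \<alpha> (a + 1) z \<partial>lborel)
      = ennreal C * (\<integral>\<^sup>+z. heat_kernel \<alpha> T x z * ennreal (norm z powr (- \<gamma>)) \<partial>lborel)"
  proof (subst nn_integral_cmult[symmetric], simp, rule nn_integral_cong_AE)
    show "AE z in lborel. heat_kernel \<alpha> T x z * stable_potential \<alpha> (a + 1) z
        = ennreal C * (heat_kernel \<alpha> T x z * ennreal (norm z powr (- \<gamma>)))"
      using AE_lborel_singleton[of "0 :: real ^ 'n"] by eventually_elim (simp add: V1 mult_ac)
  qed
  have P2: "(\<integral>\<^sup>+z. heat_kernel \<alpha> s x z * (ennreal a * stable_potential \<alpha> a z) \<partial>lborel)
      = ennreal C * (\<integral>\<^sup>+z. heat_kernel \<alpha> s x z * ennreal (kappa CARD('n) \<alpha> \<gamma> * norm z powr (- \<alpha> - \<gamma>)) \<partial>lborel)" for s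
  proof (subst nn_integral_cmult[symmetric], simp, rule nn_integral_cong_AE)
    show "AE z in lborel. heat_kernel \<alpha> s x z * (ennreal a * stable_potential \<alpha> a z)
        = ennreal C * (heat_kernel \<alpha> s x z * ennreal (kappa CARD('n) \<alpha> \<gamma> * norm z powr (- \<alpha> - \<gamma>)))"
      using AE_lborel_singleton[of "0 :: real ^ 'n"] by eventually_elim (subst V2, assumption, rule mult.left_commute)
  qed
  let ?P = "\<integral>\<^sup>+z. heat_kernel \<alpha> T x z * ennreal (norm z powr (- \<gamma>)) \<partial>lborel"
  let ?Q = "\<lambda>s. \<integral>\<^sup>+z. heat_kernel \<alpha> s x z * ennreal (kappa CARD('n) \<alpha> \<gamma> * norm z powr (- \<alpha> - \<gamma>)) \<partial>lborel"
  have "(\<integral>\<^sup>+s\<in>{0<..<T}. (ennreal C * ?Q s) \<partial>lborel) = ennreal C * (\<integral>\<^sup>+s\<in>{0<..<T}. ?Q s \<partial>lborel)"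
    unfolding mult.assoc by (rule nn_integral_cmult) simp
  hence "ennreal C * ennreal (norm x powr (- \<gamma>)) = ennreal C * (?P + (\<integral>\<^sup>+s\<in>{0<..<T}. ?Q s \<partial>lborel))"
    using stable_potential_stationary[OF \<alpha> a T, of x] unfolding V1[OF x] P1 P2
    by (simp only: distrib_left)
  thus ?thesis using C by (simp add: ennreal_mult_cancel_left)
qed

end

section \<open>Supersolutions of the perturbed equation\<close>

text \<open>The right-hand side is recognised as jointly measurable in \<open>s\<close> and \<open>t\<close>, unlike the left-hand side.\<close>

lemma indicator_Ioo_split: "indicator {0<..<t} s = (indicator {0<..} s * indicator {0<..} (t - s) :: ennreal)" for s t :: real
  by (auto split: split_indicator)

lemma perturbation_term_measurable:
  fixes q :: "real ^ 'n \<Rightarrow> ennreal"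
  assumes [measurable]: "q \<in> borel_measurable borel"
  shows "(\<lambda>(t, x, y). perturbation_term (heat_kernel \<alpha>) q n t x y) \<in> borel_measurable (borel \<Otimes>\<^sub>M borel \<Otimes>\<^sub>M borel)"
proof (induction n)
  case 0
  show ?case by (simp add: split_beta')
next
  case (Suc n)
  have [measurable (raw)]: "(\<lambda>w. perturbation_term (heat_kernel \<alpha>) q n (f w) (g w) (h w)) \<in> borel_measurable M"
    if [measurable]: "f \<in> borel_measurable M" "g \<in> borel_measurable M" "h \<in> borel_measurable M" for M :: "'c measure" and f g h
    using measurable_compose[OF _ Suc, of "\<lambda>w. (f w, g w, h w)" M] by simp
  show ?case by (simp add: split_beta' indicator_Ioo_split)
qed

lemma perturbation_term_measurable'[measurable (raw)]:
  fixes q :: "real ^ 'n \<Rightarrow> ennreal"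
  assumes q: "q \<in> borel_measurable borel"
    and [measurable]: "f \<in> borel_measurable M" "g \<in> borel_measurable M" "h \<in> borel_measurable M"
  shows "(\<lambda>w. perturbation_term (heat_kernel \<alpha>) q n (f w) (g w) (h w)) \<in> borel_measurable M"
  using measurable_compose[OF _ perturbation_term_measurable[OF q], of "\<lambda>w. (f w, g w, h w)" M] by simp

text \<open>Integrating out \<open>y\<close> turns the recursion for the kernels into one for their
  masses, which is what the comparison with \<open>H\<close> iterates.\<close>

lemma nn_integral_perturbation_term_Suc:
  fixes q :: "real ^ 'n \<Rightarrow> ennreal"
  assumes [measurable]: "q \<in> borel_measurable borel"
  shows "(\<integral>\<^sup>+y. perturbation_term (heat_kernel \<alpha>) q (Suc n) t x y \<partial>lborel)
    = (\<integral>\<^sup>+s\<in>{0<..<t}. (\<integral>\<^sup>+z. heat_kernel \<alpha> s x z * q z * (\<integral>\<^sup>+y. perturbation_term (heat_kernel \<alpha>) q n (t - s) z y \<partial>lborel) \<partial>lborel) \<partial>lborel)"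
proof -
  let ?f = "\<lambda>s z y. heat_kernel \<alpha> s x z * q z * perturbation_term (heat_kernel \<alpha>) q n (t - s) z y"
  have "(\<integral>\<^sup>+y. perturbation_term (heat_kernel \<alpha>) q (Suc n) t x y \<partial>lborel)
    = (\<integral>\<^sup>+s. \<integral>\<^sup>+y. (\<integral>\<^sup>+z. ?f s z y \<partial>lborel) * indicator {0<..<t} s \<partial>lborel \<partial>lborel)"
    unfolding perturbation_term.simps(2) by (rule lborel_pair.Fubini'[symmetric]) simp
  also have "\<dots> = (\<integral>\<^sup>+s\<in>{0<..<t}. (\<integral>\<^sup>+y. (\<integral>\<^sup>+z. ?f s z y \<partial>lborel) \<partial>lborel) \<partial>lborel)"
    by (intro nn_integral_cong nn_integral_multc) simp
  also have "\<dots> = (\<integral>\<^sup>+s\<in>{0<..<t}. (\<integral>\<^sup>+z. (\<integral>\<^sup>+y. ?f s z y \<partial>lborel) \<partial>lborel) \<partial>lborel)"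
    by (intro nn_integral_cong arg_cong[where f = "\<lambda>c. c * _"] lborel_pair.Fubini') simp
  also have "\<dots> = (\<integral>\<^sup>+s\<in>{0<..<t}. (\<integral>\<^sup>+z. heat_kernel \<alpha> s x z * q z * (\<integral>\<^sup>+y. perturbation_term (heat_kernel \<alpha>) q n (t - s) z y \<partial>lborel) \<partial>lborel) \<partial>lborel)"
    by (simp add: nn_integral_cmult)
  finally show ?thesis .
qed

text \<open>Induction on the number of summands: a partial sum with one more term is the zeroth term
  plus the Duhamel integral of the shorter partial sum, to which the bound at time
  \<open>t - s\<close> applies. The inequality for \<open>H\<close> is assumed away from the origin
  only; \<open>q 0 = 0\<close> settles the point z = 0 under the integral.\<close>

lemma schroedinger_perturbation_supersolution:
  fixes q :: "real ^ 'n \<Rightarrow> ennreal" and H :: "real \<Rightarrow> real ^ 'n \<Rightarrow> ennreal"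
  assumes q[measurable]: "q \<in> borel_measurable borel" and q0: "q 0 = 0"
    and H: "\<And>t x. 0 < t \<Longrightarrow> t \<le> T \<Longrightarrow> x \<noteq> 0 \<Longrightarrow>
      (\<integral>\<^sup>+y. heat_kernel \<alpha> t x y \<partial>lborel)
        + (\<integral>\<^sup>+s\<in>{0<..<t}. (\<integral>\<^sup>+z. heat_kernel \<alpha> s x z * q z * H (t - s) z \<partial>lborel) \<partial>lborel) \<le> H t x"
    and t: "0 < t" "t \<le> T" and x: "x \<noteq> 0"
  shows "(\<integral>\<^sup>+y. schroedinger_perturbation (heat_kernel \<alpha>) q t x y \<partial>lborel) \<le> H t x"
proof -
  define u where "u n t x = (\<integral>\<^sup>+y. perturbation_term (heat_kernel \<alpha>) q n t x y \<partial>lborel)" for n t x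
  have u_meas[measurable (raw)]: "(\<lambda>w. u n (f w) (g w)) \<in> borel_measurable M"
    if [measurable]: "f \<in> borel_measurable M" "g \<in> borel_measurable M" for n f g and M :: "'c measure"
    unfolding u_def by measurable
  have bound: "(\<Sum>n<N. u n t x) \<le> H t x" if "0 < t" "t \<le> T" "x \<noteq> 0" for N t x
    using that
  proof (induction N arbitrary: t x)
    case (Suc N)
    have "(\<Sum>n<N. u (Suc n) t x)
      = (\<Sum>n<N. \<integral>\<^sup>+s\<in>{0<..<t}. (\<integral>\<^sup>+z. heat_kernel \<alpha> s x z * q z * u n (t - s) z \<partial>lborel) \<partial>lborel)"
      unfolding u_def nn_integral_perturbation_term_Suc[OF q] ..
    also have "\<dots> = (\<integral>\<^sup>+s. (\<Sum>n<N. (\<integral>\<^sup>+z. heat_kernel \<alpha> s x z * q z * u n (t - s) z \<partial>lborel) * indicator {0<..<t} s) \<partial>lborel)"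
      by (rule nn_integral_sum[symmetric]) simp
    also have "\<dots> = (\<integral>\<^sup>+s\<in>{0<..<t}. (\<integral>\<^sup>+z. (\<Sum>n<N. heat_kernel \<alpha> s x z * q z * u n (t - s) z) \<partial>lborel) \<partial>lborel)"
      by (intro nn_integral_cong, subst nn_integral_sum) (simp_all add: sum_distrib_right)
    also have "\<dots> \<le> (\<integral>\<^sup>+s\<in>{0<..<t}. (\<integral>\<^sup>+z. heat_kernel \<alpha> s x z * q z * H (t - s) z \<partial>lborel) \<partial>lborel)"
    proof (rule nn_integral_mono)
      fix s :: real
      show "(\<integral>\<^sup>+z. (\<Sum>n<N. heat_kernel \<alpha> s x z * q z * u n (t - s) z) \<partial>lborel) * indicator {0<..<t} s
        \<le> (\<integral>\<^sup>+z. heat_kernel \<alpha> s x z * q z * H (t - s) z \<partial>lborel) * indicator {0<..<t} s"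
      proof (cases "s \<in> {0<..<t}")
        case True
        have "(\<Sum>n<N. heat_kernel \<alpha> s x z * q z * u n (t - s) z) \<le> heat_kernel \<alpha> s x z * q z * H (t - s) z" for z
        proof (cases "z = 0")
          case False
          thus ?thesis unfolding sum_distrib_left[symmetric]
            using True Suc.prems by (intro mult_left_mono Suc.IH) auto
        qed (simp add: q0)
        thus ?thesis by (intro mult_right_mono nn_integral_mono) auto
      qed simp
    qed
    finally have "(\<Sum>n<Suc N. u n t x) \<le> (\<integral>\<^sup>+y. heat_kernel \<alpha> t x y \<partial>lborel)
        + (\<integral>\<^sup>+s\<in>{0<..<t}. (\<integral>\<^sup>+z. heat_kernel \<alpha> s x z * q z * H (t - s) z \<partial>lborel) \<partial>lborel)"
      unfolding sum.lessThan_Suc_shift by (intro add_mono) (simp_all add: u_def)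
    also have "\<dots> \<le> H t x" by (rule H[OF Suc.prems])
    finally show ?case .
  qed simp
  have "(\<integral>\<^sup>+y. schroedinger_perturbation (heat_kernel \<alpha>) q t x y \<partial>lborel) = (\<Sum>n. u n t x)"
    unfolding schroedinger_perturbation_def u_def by (rule nn_integral_suminf) simp
  also have "\<dots> \<le> H t x" by (rule suminf_le_const[OF summableI]) (rule bound[OF t x])
  finally show ?thesis .
qed

text \<open>
  The weighted identity is the given one at time \<open>t\<close> plus \<open>l\<close> times its integral over \<open>0 < r < t\<close>. It
  turns a stationary solution \<open>c\<close> of the heat equation with source into the solution \<open>(1 + l t) c\<close>.
\<close>

lemma Duhamel_linear_weight:
  fixes F G :: "real \<Rightarrow> ennreal" and c :: ennreal and l t :: real
  assumes [measurable]: "F \<in> borel_measurable borel" "G \<in> borel_measurable borel"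
    and c: "\<And>r. 0 < r \<Longrightarrow> r \<le> t \<Longrightarrow> c = F r + (\<integral>\<^sup>+s\<in>{0<..<r}. G s \<partial>lborel)"
    and l: "l \<ge> 0" and t: "t > 0"
  shows "ennreal (1 + l * t) * c = F t + ennreal l * (\<integral>\<^sup>+s\<in>{0<..<t}. F s \<partial>lborel)
    + (\<integral>\<^sup>+s\<in>{0<..<t}. (ennreal (1 + l * (t - s)) * G s) \<partial>lborel)"
proof -
  let ?I = "\<lambda>s. indicator {0<..<t} s :: ennreal"
  have len: "(\<integral>\<^sup>+r. indicator {a<..<t} r \<partial>lborel) = ennreal (t - a)" if "a < t" for a
    using that by simp
  have "ennreal t * c = (\<integral>\<^sup>+r\<in>{0<..<t}. c \<partial>lborel)"
    using t len[of 0] by (simp add: nn_integral_cmult mult.commute)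
  also have "\<dots> = (\<integral>\<^sup>+r. F r * ?I r + (\<integral>\<^sup>+s\<in>{0<..<r}. G s \<partial>lborel) * ?I r \<partial>lborel)"
    using c by (intro nn_integral_cong) (auto split: split_indicator)
  also have "\<dots> = (\<integral>\<^sup>+r\<in>{0<..<t}. F r \<partial>lborel) + (\<integral>\<^sup>+r\<in>{0<..<t}. (\<integral>\<^sup>+s\<in>{0<..<r}. G s \<partial>lborel) \<partial>lborel)"
    by (rule nn_integral_add) (simp_all add: indicator_Ioo_split)
  also have "(\<integral>\<^sup>+r\<in>{0<..<t}. (\<integral>\<^sup>+s\<in>{0<..<r}. G s \<partial>lborel) \<partial>lborel)
      = (\<integral>\<^sup>+r. \<integral>\<^sup>+s. G s * indicator {0<..<r} s * ?I r \<partial>lborel \<partial>lborel)"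
    by (intro nn_integral_cong nn_integral_multc[symmetric]) simp
  also have "\<dots> = (\<integral>\<^sup>+s. \<integral>\<^sup>+r. G s * indicator {0<..<r} s * ?I r \<partial>lborel \<partial>lborel)"
    by (rule lborel_pair.Fubini') (simp add: indicator_Ioo_split)
  \<comment> \<open>For fixed \<open>s\<close> the remaining range is s < r < t; its length is the
    new weight.\<close>
  also have "\<dots> = (\<integral>\<^sup>+s\<in>{0<..<t}. (ennreal (t - s) * G s) \<partial>lborel)"
  proof (rule nn_integral_cong)
    fix s :: real
    have "(\<integral>\<^sup>+r. G s * indicator {0<..<r} s * ?I r \<partial>lborel) = (\<integral>\<^sup>+r. G s * ?I s * indicator {s<..<t} r \<partial>lborel)"
      by (intro nn_integral_cong) (auto split: split_indicator)
    also have "\<dots> = ennreal (t - s) * G s * ?I s"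
      using len[of s] by (cases "s \<in> {0<..<t}") (simp_all add: nn_integral_cmult mult.commute)
    finally show "(\<integral>\<^sup>+r. G s * indicator {0<..<r} s * ?I r \<partial>lborel) = ennreal (t - s) * G s * ?I s" .
  qed
  finally have tc: "ennreal t * c = (\<integral>\<^sup>+r\<in>{0<..<t}. F r \<partial>lborel) + (\<integral>\<^sup>+s\<in>{0<..<t}. (ennreal (t - s) * G s) \<partial>lborel)" .
  have "(\<integral>\<^sup>+s\<in>{0<..<t}. (ennreal (1 + l * (t - s)) * G s) \<partial>lborel)
      = (\<integral>\<^sup>+s. G s * ?I s + ennreal l * (ennreal (t - s) * G s * ?I s) \<partial>lborel)"
    using l by (intro nn_integral_cong)
      (auto simp: ennreal_mult ennreal_plus distrib_right mult.assoc simp del: ennreal_plus[symmetric] split: split_indicator)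
  also have "\<dots> = (\<integral>\<^sup>+s\<in>{0<..<t}. G s \<partial>lborel) + ennreal l * (\<integral>\<^sup>+s\<in>{0<..<t}. (ennreal (t - s) * G s) \<partial>lborel)"
    by (simp add: nn_integral_add nn_integral_cmult)
  finally have w: "(\<integral>\<^sup>+s\<in>{0<..<t}. (ennreal (1 + l * (t - s)) * G s) \<partial>lborel)
    = (\<integral>\<^sup>+s\<in>{0<..<t}. G s \<partial>lborel) + ennreal l * (\<integral>\<^sup>+s\<in>{0<..<t}. (ennreal (t - s) * G s) \<partial>lborel)" .
  have "ennreal (1 + l * t) = 1 + ennreal l * ennreal t"
    using l t by (simp add: ennreal_mult)
  hence "ennreal (1 + l * t) * c = c + ennreal l * (ennreal t * c)"
    by (simp add: distrib_right mult.assoc)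
  thus ?thesis unfolding w tc using c[of t] t by (simp add: distrib_left add_ac)
qed

context
  fixes \<alpha> :: real
  assumes \<alpha>: "0 < \<alpha>" "\<alpha> < 2"
begin

lemma scaled_powr_stationary:
  fixes x :: "real ^ 'n"
  assumes g: "0 < \<gamma>" "\<gamma> < real CARD('n) - \<alpha>" and x: "x \<noteq> 0" and T: "T > 0" and C: "C \<ge> 0"
  shows "ennreal (C * norm x powr (- \<gamma>)) = (\<integral>\<^sup>+z. heat_kernel \<alpha> T x z * ennreal (C * norm z powr (- \<gamma>)) \<partial>lborel)
    + (\<integral>\<^sup>+s\<in>{0<..<T}. (\<integral>\<^sup>+z. heat_kernel \<alpha> s x z * ennreal (kappa CARD('n) \<alpha> \<gamma> * (C * norm z powr (- \<gamma>)) * norm z powr (- \<alpha>)) \<partial>lborel) \<partial>lborel)"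
proof -
  let ?Q = "\<lambda>s. \<integral>\<^sup>+z. heat_kernel \<alpha> s x z * ennreal (kappa CARD('n) \<alpha> \<gamma> * norm z powr (- \<alpha> - \<gamma>)) \<partial>lborel"
  have 1: "(\<integral>\<^sup>+z. heat_kernel \<alpha> T x z * ennreal (C * norm z powr (- \<gamma>)) \<partial>lborel)
      = ennreal C * (\<integral>\<^sup>+z. heat_kernel \<alpha> T x z * ennreal (norm z powr (- \<gamma>)) \<partial>lborel)"
    using C by (subst nn_integral_cmult[symmetric]) (simp_all add: ennreal_mult mult.left_commute)
  have 2: "(\<integral>\<^sup>+z. heat_kernel \<alpha> s x z * ennreal (kappa CARD('n) \<alpha> \<gamma> * (C * norm z powr (- \<gamma>)) * norm z powr (- \<alpha>)) \<partial>lborel) = ennreal C * ?Q s" for s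
  proof (subst nn_integral_cmult[symmetric], simp, rule nn_integral_cong)
    fix z :: "real ^ 'n"
    have "kappa CARD('n) \<alpha> \<gamma> * (C * norm z powr (- \<gamma>)) * norm z powr (- \<alpha>) = C * (kappa CARD('n) \<alpha> \<gamma> * norm z powr (- \<alpha> - \<gamma>))"
      using powr_add[of "norm z" "- \<gamma>" "- \<alpha>"] by (simp add: add.commute)
    thus "heat_kernel \<alpha> s x z * ennreal (kappa CARD('n) \<alpha> \<gamma> * (C * norm z powr (- \<gamma>)) * norm z powr (- \<alpha>))
        = ennreal C * (heat_kernel \<alpha> s x z * ennreal (kappa CARD('n) \<alpha> \<gamma> * norm z powr (- \<alpha> - \<gamma>)))"
      using C by (simp only: ennreal_mult' mult.left_commute)
  qed
  have "(\<integral>\<^sup>+s\<in>{0<..<T}. (ennreal C * ?Q s) \<partial>lborel) = ennreal C * (\<integral>\<^sup>+s\<in>{0<..<T}. ?Q s \<partial>lborel)"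
    unfolding mult.assoc by (rule nn_integral_cmult) simp
  thus ?thesis unfolding 1 2 ennreal_mult'[OF C, of "norm x powr (- \<gamma>)"] norm_powr_stationary[OF \<alpha> g x T] by (simp only: distrib_left)
qed

end

section \<open>The barrier \<Phi>\<close>

lemma barrier_ge_1:
  fixes r :: real
  assumes "0 < \<beta>" "\<beta> < \<delta>" "0 < r"
  shows "1 \<le> 2 + r powr (- \<delta>) - r powr (- \<beta>)"
proof (cases "r \<ge> 1")
  case True
  \<comment> \<open>Here the subtracted power is bounded only by 1, which is why the constant in
    \<Phi> is 2 rather than 1.\<close>
  hence "r powr (- \<beta>) \<le> r powr 0" using assms by (intro powr_mono) auto
  hence "r powr (- \<beta>) \<le> 1" using True by simp
  thus ?thesis using powr_ge_zero[of r "- \<delta>"] by linarith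
next
  case False
  hence "r powr (- \<beta>) \<le> r powr (- \<delta>)" using assms by (intro powr_mono') auto
  thus ?thesis by simp
qed

text \<open>Once k r^(-\<delta>-\<alpha>) is cancelled, the claim reads 2 k r^-\<alpha> \<le> K
  \<Phi>(r) + (k - m) r^(-\<beta>-\<alpha>). It is used with \<open>k\<close> and \<open>m\<close>
  the coupling constants of \<open>\<delta>\<close> and \<open>\<beta>\<close>.\<close>

lemma barrier_inequality:
  fixes k m \<alpha> \<beta> \<delta> :: real
  assumes "0 < \<alpha>" "0 < \<beta>" "\<beta> < \<delta>" "0 < k" "m < k"
  obtains K where "K > 0"
    and "\<And>r. r > 0 \<Longrightarrow> k * r powr (- \<alpha>) * (2 + r powr (- \<delta>) - r powr (- \<beta>)) + m * r powr (- \<beta>) * r powr (- \<alpha>)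
      \<le> k * r powr (- \<delta>) * r powr (- \<alpha>) + K * (2 + r powr (- \<delta>) - r powr (- \<beta>))"
proof
  \<comment> \<open>\<open>p\<close> solves (k - m) p^-\<beta> = 2 k. For r \<le> p the surplus
    alone suffices; beyond \<open>p\<close> one has 2 k r^-\<alpha> \<le> K, and \<Phi> \<ge>
    1.\<close>
  define p where "p = ((k - m) / (2 * k)) powr (1 / \<beta>)"
  have p: "p > 0" using assms by (simp add: p_def)
  define K where "K = 2 * k * p powr (- \<alpha>)"
  show K: "K > 0" using assms p by (simp add: K_def)
  fix r :: real assume r: "r > 0"
  let ?\<Phi> = "2 + r powr (- \<delta>) - r powr (- \<beta>)"
  have \<Phi>: "1 \<le> ?\<Phi>" by (rule barrier_ge_1[OF assms(2,3) r])
  have "2 * k * r powr (- \<alpha>) \<le> K * ?\<Phi> + (k - m) * r powr (- \<beta>) * r powr (- \<alpha>)"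
  proof (cases "r \<le> p")
    case True
    hence "r powr \<beta> \<le> p powr \<beta>" using r assms by (intro powr_mono2) auto
    also have "p powr \<beta> = (k - m) / (2 * k)" using assms by (simp add: p_def powr_powr)
    finally have "2 * k \<le> (k - m) * r powr (- \<beta>)"
      using r assms by (simp add: powr_minus field_simps)
    hence "2 * k * r powr (- \<alpha>) \<le> (k - m) * r powr (- \<beta>) * r powr (- \<alpha>)" by (intro mult_right_mono) auto
    moreover have "0 \<le> K * ?\<Phi>" using K \<Phi> by simp
    ultimately show ?thesis by linarith
  next
    case False
    hence "r powr (- \<alpha>) \<le> p powr (- \<alpha>)" using p assms by (intro powr_mono2') auto
    hence "2 * k * r powr (- \<alpha>) \<le> K" unfolding K_def using assms by (intro mult_left_mono) auto
    also have "K \<le> K * ?\<Phi>" using K \<Phi> by simp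
    also have "\<dots> \<le> K * ?\<Phi> + (k - m) * r powr (- \<beta>) * r powr (- \<alpha>)" using assms by simp
    finally show ?thesis .
  qed
  thus "k * r powr (- \<alpha>) * ?\<Phi> + m * r powr (- \<beta>) * r powr (- \<alpha>) \<le> k * r powr (- \<delta>) * r powr (- \<alpha>) + K * ?\<Phi>"
    by (simp add: algebra_simps)
qed

text \<open>In the unscaled inequality at r / R every term with r^-\<alpha> carries a factor
  R^\<alpha>; dividing by it leaves R^-\<alpha> on \<open>K\<close> alone.\<close>

lemma barrier_inequality_scaled:
  fixes r R k m \<alpha> \<beta> \<delta> K :: real
  assumes K: "\<And>r. r > 0 \<Longrightarrow> k * r powr (- \<alpha>) * (2 + r powr (- \<delta>) - r powr (- \<beta>)) + m * r powr (- \<beta>) * r powr (- \<alpha>)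
      \<le> k * r powr (- \<delta>) * r powr (- \<alpha>) + K * (2 + r powr (- \<delta>) - r powr (- \<beta>))"
    and r: "r > 0" and R: "R > 0"
  shows "k * r powr (- \<alpha>) * (2 + R powr \<delta> * r powr (- \<delta>) - R powr \<beta> * r powr (- \<beta>)) + m * (R powr \<beta> * r powr (- \<beta>)) * r powr (- \<alpha>)
      \<le> k * (R powr \<delta> * r powr (- \<delta>)) * r powr (- \<alpha>) + K * R powr (- \<alpha>) * (2 + R powr \<delta> * r powr (- \<delta>) - R powr \<beta> * r powr (- \<beta>))"
proof -
  have e: "(r / R) powr (- g) = R powr g * r powr (- g)" for g
    using r R by (simp add: powr_divide powr_minus_divide)
  define A where "A = r powr (- \<alpha>)"
  define P where "P = R powr \<alpha>"
  define D where "D = R powr \<delta> * r powr (- \<delta>)"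
  define B where "B = R powr \<beta> * r powr (- \<beta>)"
  have P: "P > 0" using R by (simp add: P_def)
  have "k * (P * A) * (2 + D - B) + m * B * (P * A) \<le> k * D * (P * A) + K * (2 + D - B)"
    using K[of "r / R"] r R unfolding e A_def P_def D_def B_def by simp
  hence "inverse P * (k * (P * A) * (2 + D - B) + m * B * (P * A)) \<le> inverse P * (k * D * (P * A) + K * (2 + D - B))"
    using P by (intro mult_left_mono) auto
  moreover have "inverse P * (k * (P * A) * Y + m * B * (P * A)) = k * A * Y + m * B * A"
    and "inverse P * (k * D * (P * A) + K * Y) = k * D * A + K * inverse P * Y" for Y
    using P by (simp_all add: field_simps)
  ultimately have "k * A * (2 + D - B) + m * B * A \<le> k * D * A + K * inverse P * (2 + D - B)"
    by (simp only:)
  thus ?thesis by (simp only: A_def P_def D_def B_def powr_minus)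
qed

context
  fixes \<alpha> :: real
  assumes \<alpha>: "0 < \<alpha>" "\<alpha> < 2"
begin

text \<open>Weighted Duhamel identities hold separately for \<open>f1\<close>, which is 2 + a, and
  for \<open>b\<close>, where \<Phi> = 2 + a - b. Cancelling the terms of \<open>b\<close> leaves
  one identity for \<Phi> with source \<open>g1\<close> on one side and \<open>g2\<close> on the
  other; the barrier inequality compares these with the potential term \<open>q\<close>.\<close>

lemma barrier_supersolution:
  fixes x :: "real ^ 'n"
  assumes d: "0 < \<beta>" "\<beta> < \<delta>" "\<delta> < real CARD('n) - \<alpha>"
    and K: "\<And>r. r > 0 \<Longrightarrow> kappa CARD('n) \<alpha> \<delta> * r powr (- \<alpha>) * (2 + r powr (- \<delta>) - r powr (- \<beta>))
        + kappa CARD('n) \<alpha> \<beta> * r powr (- \<beta>) * r powr (- \<alpha>)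
      \<le> kappa CARD('n) \<alpha> \<delta> * r powr (- \<delta>) * r powr (- \<alpha>) + K * (2 + r powr (- \<delta>) - r powr (- \<beta>))"
    and K0: "K > 0" and R: "R > 0"
  defines "l \<equiv> 2 * K * R powr (- \<alpha>)"
    and "\<Phi> \<equiv> \<lambda>z::real ^ 'n. 2 + R powr \<delta> * norm z powr (- \<delta>) - R powr \<beta> * norm z powr (- \<beta>)"
  assumes t: "0 < t" "l * t \<le> 1" and x: "x \<noteq> 0"
  shows "(\<integral>\<^sup>+y. heat_kernel \<alpha> t x y \<partial>lborel)
     + (\<integral>\<^sup>+s\<in>{0<..<t}. (\<integral>\<^sup>+z. heat_kernel \<alpha> s x z * hardy_potential (kappa CARD('n) \<alpha> \<delta>) \<alpha> z
           * ennreal ((1 + l * (t - s)) * \<Phi> z) \<partial>lborel) \<partial>lborel)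
     \<le> ennreal ((1 + l * t) * \<Phi> x)"
proof -
  let ?k = "kappa CARD('n) \<alpha> \<delta>" and ?m = "kappa CARD('n) \<alpha> \<beta>"
  have k: "?k > 0" "?m > 0" using d \<alpha> by (auto intro!: kappa_pos)
  have l: "l \<ge> 0" using K0 by (simp add: l_def)
  define P where "P s f = (\<integral>\<^sup>+z. heat_kernel \<alpha> s x z * f z \<partial>lborel)" for s and f :: "real ^ 'n \<Rightarrow> ennreal"
  define J where "J f = (\<integral>\<^sup>+s\<in>{0<..<t}. P s f \<partial>lborel)" for f
  define L where "L f = (\<integral>\<^sup>+s\<in>{0<..<t}. (ennreal (1 + l * (t - s)) * P s f) \<partial>lborel)" for f
  define a where "a z = R powr \<delta> * norm z powr (- \<delta>)" for z :: "real ^ 'n"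
  define b where "b z = R powr \<beta> * norm z powr (- \<beta>)" for z :: "real ^ 'n"
  define g1 where "g1 z = ennreal (?k * a z * norm z powr (- \<alpha>))" for z
  define g2 where "g2 z = ennreal (?m * b z * norm z powr (- \<alpha>))" for z
  define f1 where "f1 z = ennreal (2 + a z)" for z
  define q where "q z = ennreal (?k * norm z powr (- \<alpha>) * \<Phi> z)" for z
  let ?\<Phi> = "\<lambda>z. ennreal (\<Phi> z)" and ?b = "\<lambda>z. ennreal (b z)"
  have ab: "a z \<ge> 0" "b z \<ge> 0" for z by (simp_all add: a_def b_def)
  have \<Phi>_eq: "\<Phi> z = 2 + a z - b z" for z by (simp add: \<Phi>_def a_def b_def)
  \<comment> \<open>At the origin both powers are 0 by the convention \<open>0 powr y = 0\<close>,
    so \<open>\<Phi> 0 = 2\<close>.\<close>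
  have \<Phi>1: "\<Phi> z \<ge> 1" for z
  proof (cases "z = 0")
    case False
    hence "norm z / R > 0" using R by simp
    from barrier_ge_1[OF d(1,2) this] show ?thesis
      using R False by (simp add: \<Phi>_def powr_divide powr_minus_divide)
  qed (simp add: \<Phi>_def)
  have meas[measurable]: "a \<in> borel_measurable borel" "b \<in> borel_measurable borel" "\<Phi> \<in> borel_measurable borel"
    "g1 \<in> borel_measurable borel" "g2 \<in> borel_measurable borel" "f1 \<in> borel_measurable borel" "q \<in> borel_measurable borel"
    unfolding g1_def[abs_def] g2_def[abs_def] f1_def[abs_def] q_def[abs_def] a_def[abs_def] b_def[abs_def] \<Phi>_def by measurable
  have P_meas: "(\<lambda>s. P s f) \<in> borel_measurable borel" if [measurable]: "f \<in> borel_measurable borel" for f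
    unfolding P_def by measurable
  have P_add: "P s (\<lambda>z. f z + g z) = P s f + P s g" if [measurable]: "f \<in> borel_measurable borel" "g \<in> borel_measurable borel" for s f g
    unfolding P_def by (simp add: distrib_left nn_integral_add)
  have P_mono: "P s f \<le> P s g" if "\<And>z. f z \<le> g z" for s f g
    unfolding P_def using that by (intro nn_integral_mono mult_left_mono) auto
  have J_add: "J (\<lambda>z. f z + g z) = J f + J g" if [measurable]: "f \<in> borel_measurable borel" "g \<in> borel_measurable borel" for f g
    using P_meas[of f] P_meas[of g] unfolding J_def P_add[OF that] by (simp add: distrib_right nn_integral_add)
  have L_add: "L (\<lambda>z. f z + g z) = L f + L g" if [measurable]: "f \<in> borel_measurable borel" "g \<in> borel_measurable borel" for f g
    using P_meas[of f] P_meas[of g] unfolding L_def P_add[OF that] by (simp add: distrib_left distrib_right nn_integral_add)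
  have L_mono: "L f \<le> L g" if "\<And>z. f z \<le> g z" for f g
    unfolding L_def using P_mono[OF that] by (intro nn_integral_mono mult_right_mono mult_left_mono) auto
  \<comment> \<open>The heat kernel preserves the constant 2, so only the power in \<open>f1\<close>
    contributes a source.\<close>
  have C1: "f1 x = P r f1 + (\<integral>\<^sup>+s\<in>{0<..<r}. P s g1 \<partial>lborel)" if "0 < r" for r
  proof -
    have "f1 x = 2 + (P r (\<lambda>z. ennreal (a z)) + (\<integral>\<^sup>+s\<in>{0<..<r}. P s g1 \<partial>lborel))"
      using scaled_powr_stationary[OF \<alpha> _ d(3) x that, of "R powr \<delta>"] d ab
      by (simp add: f1_def g1_def P_def a_def)
    moreover have "P r (\<lambda>_. 2) = 2"
      unfolding P_def using heat_kernel_total_mass[OF \<alpha> that, of x] by (simp add: nn_integral_multc)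
    moreover have "P r f1 = P r (\<lambda>_. 2) + P r (\<lambda>z. ennreal (a z))"
      using ab P_add[of "\<lambda>_. 2" "\<lambda>z. ennreal (a z)" r] by (simp add: f1_def[abs_def])
    ultimately show ?thesis by (simp add: add.assoc)
  qed
  have C2: "?b x = P r ?b + (\<integral>\<^sup>+s\<in>{0<..<r}. P s g2 \<partial>lborel)" if "0 < r" for r
    using scaled_powr_stationary[OF \<alpha> d(1) _ x that, of "R powr \<beta>"] d by (simp add: g2_def P_def b_def)
  have E1: "ennreal (1 + l * t) * f1 x = P t f1 + ennreal l * J f1 + L g1"
    unfolding J_def L_def by (rule Duhamel_linear_weight[OF P_meas P_meas C1 l t(1)]) simp_all
  have E2: "ennreal (1 + l * t) * ?b x = P t ?b + ennreal l * J ?b + L g2"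
    unfolding J_def L_def by (rule Duhamel_linear_weight[OF P_meas P_meas C2 l t(1)]) simp_all
  have f1: "f1 = (\<lambda>z. ?\<Phi> z + ?b z)"
  proof
    fix z
    have "2 + a z = \<Phi> z + b z" by (simp add: \<Phi>_eq)
    thus "f1 z = ?\<Phi> z + ?b z"
      unfolding f1_def using ab(2)[of z] \<Phi>1[of z] by (simp only: ennreal_plus order_trans[OF zero_le_one])
  qed
  define X where "X = P t ?b + ennreal l * J ?b"
  \<comment> \<open>\<open>X\<close> and \<open>L g2\<close> are the two summands of this finite
    quantity, hence finite, and may be cancelled later.\<close>
  have "ennreal (1 + l * t) * ?b x < \<infinity>" by (simp add: ennreal_mult_less_top)
  hence fin: "X \<noteq> \<infinity>" "L g2 \<noteq> \<infinity>" unfolding E2 X_def by auto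
  have "ennreal (1 + l * t) * ?\<Phi> x + (X + L g2) = ennreal (1 + l * t) * f1 x"
    unfolding X_def E2[symmetric] f1 by (simp add: distrib_left)
  also have "\<dots> = X + (P t ?\<Phi> + ennreal l * J ?\<Phi> + L g1)"
    unfolding E1 unfolding f1 by (simp add: P_add J_add X_def distrib_left add_ac)
  finally have "X + (ennreal (1 + l * t) * ?\<Phi> x + L g2) = X + (P t ?\<Phi> + ennreal l * J ?\<Phi> + L g1)"
    by (simp add: add_ac)
  hence main: "ennreal (1 + l * t) * ?\<Phi> x + L g2 = P t ?\<Phi> + ennreal l * J ?\<Phi> + L g1"
    using fin by (simp add: ennreal_add_left_cancel)
  have "q z + g2 z \<le> g1 z + ennreal (l / 2 * \<Phi> z)" for z
  proof (cases "z = 0")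
    case False
    have "?k * norm z powr (- \<alpha>) * \<Phi> z + ?m * b z * norm z powr (- \<alpha>) \<le> ?k * a z * norm z powr (- \<alpha>) + l / 2 * \<Phi> z"
      using barrier_inequality_scaled[OF K, of "norm z" R] False R by (simp add: \<Phi>_def a_def b_def l_def)
    hence "ennreal (?k * norm z powr (- \<alpha>) * \<Phi> z + ?m * b z * norm z powr (- \<alpha>)) \<le> ennreal (?k * a z * norm z powr (- \<alpha>) + l / 2 * \<Phi> z)"
      by (rule ennreal_leI)
    moreover have "0 \<le> ?k * norm z powr (- \<alpha>) * \<Phi> z" "0 \<le> ?m * b z * norm z powr (- \<alpha>)"
      "0 \<le> ?k * a z * norm z powr (- \<alpha>)" "0 \<le> l / 2 * \<Phi> z"
      using k ab[of z] \<Phi>1[of z] l by (auto intro!: mult_nonneg_nonneg divide_nonneg_nonneg)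
    ultimately show ?thesis unfolding q_def g1_def g2_def by (simp only: ennreal_plus)
  qed (simp add: q_def g2_def)
  hence "L (\<lambda>z. q z + g2 z) \<le> L (\<lambda>z. g1 z + ennreal (l / 2 * \<Phi> z))" by (rule L_mono)
  hence "L q + L g2 \<le> L g1 + L (\<lambda>z. ennreal (l / 2 * \<Phi> z))" by (simp add: L_add)
  \<comment> \<open>The barrier inequality asks for the rate \<open>K * R powr (- \<alpha>)\<close>,
    which is \<open>l / 2\<close>. The other factor 2 in \<open>l\<close> pays for the time weight:
    1 + l (t - s) \<le> 2 because l t \<le> 1.\<close>
  also have "L (\<lambda>z. ennreal (l / 2 * \<Phi> z)) \<le> ennreal l * J ?\<Phi>"
  proof -
    have "L (\<lambda>z. ennreal (l / 2 * \<Phi> z)) \<le> (\<integral>\<^sup>+s. ennreal l * (P s ?\<Phi> * indicator {0<..<t} s) \<partial>lborel)"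
      unfolding L_def
    proof (rule nn_integral_mono)
      fix s :: real
      have Pl: "P s (\<lambda>z. ennreal (l / 2 * \<Phi> z)) = ennreal (l / 2) * P s ?\<Phi>"
      proof -
        have "0 \<le> l / 2" using l by simp
        thus ?thesis unfolding P_def ennreal_mult'[OF \<open>0 \<le> l / 2\<close>]
          by (subst nn_integral_cmult[symmetric]) (simp_all only: mult.left_commute, simp)
      qed
      show "ennreal (1 + l * (t - s)) * P s (\<lambda>z. ennreal (l / 2 * \<Phi> z)) * indicator {0<..<t} s
        \<le> ennreal l * (P s ?\<Phi> * indicator {0<..<t} s)"
      proof (cases "s \<in> {0<..<t}")
        case True
        have "l * (t - s) \<le> l * t" using True l by (intro mult_left_mono) auto
        hence "(1 + l * (t - s)) * (l / 2) \<le> 2 * (l / 2)" using t l by (intro mult_right_mono) auto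
        hence "ennreal (1 + l * (t - s)) * ennreal (l / 2) \<le> ennreal l"
          using True l by (subst ennreal_mult[symmetric]) (auto intro!: ennreal_leI)
        hence "ennreal (1 + l * (t - s)) * ennreal (l / 2) * P s ?\<Phi> \<le> ennreal l * P s ?\<Phi>" by (rule mult_right_mono) simp
        thus ?thesis unfolding Pl using True by (simp add: mult.assoc)
      qed simp
    qed
    also have "\<dots> = ennreal l * J ?\<Phi>"
      unfolding J_def using P_meas[of ?\<Phi>] by (intro nn_integral_cmult) simp
    finally show ?thesis .
  qed
  finally have "P t ?\<Phi> + (L q + L g2) \<le> P t ?\<Phi> + (L g1 + ennreal l * J ?\<Phi>)"
    by (simp add: add_left_mono)
  also have "\<dots> = ennreal (1 + l * t) * ?\<Phi> x + L g2" unfolding main by (simp add: add_ac)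
  finally have "L g2 + (P t ?\<Phi> + L q) \<le> L g2 + ennreal (1 + l * t) * ?\<Phi> x" by (simp add: add_ac)
  hence res: "P t ?\<Phi> + L q \<le> ennreal (1 + l * t) * ?\<Phi> x"
    using fin by (simp add: ennreal_add_left_cancel_le)
  have "(\<integral>\<^sup>+y. heat_kernel \<alpha> t x y \<partial>lborel) \<le> P t ?\<Phi>"
    unfolding P_def
  proof (rule nn_integral_mono)
    fix z
    have "1 \<le> ?\<Phi> z" using \<Phi>1[of z] by simp
    thus "heat_kernel \<alpha> t x z \<le> heat_kernel \<alpha> t x z * ?\<Phi> z"
      using mult_left_mono[of 1 "?\<Phi> z" "heat_kernel \<alpha> t x z"] by simp
  qed
  moreover have "(\<integral>\<^sup>+s\<in>{0<..<t}. (\<integral>\<^sup>+z. heat_kernel \<alpha> s x z * hardy_potential ?k \<alpha> z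
           * ennreal ((1 + l * (t - s)) * \<Phi> z) \<partial>lborel) \<partial>lborel) = L q"
    unfolding L_def
  proof (rule nn_integral_cong)
    fix s :: real
    show "(\<integral>\<^sup>+z. heat_kernel \<alpha> s x z * hardy_potential ?k \<alpha> z * ennreal ((1 + l * (t - s)) * \<Phi> z) \<partial>lborel) * indicator {0<..<t} s
      = ennreal (1 + l * (t - s)) * P s q * indicator {0<..<t} s"
    proof (cases "s \<in> {0<..<t}")
      case True
      hence w: "1 + l * (t - s) \<ge> 0" using l by simp
      have "heat_kernel \<alpha> s x z * hardy_potential ?k \<alpha> z * ennreal ((1 + l * (t - s)) * \<Phi> z)
          = ennreal (1 + l * (t - s)) * (heat_kernel \<alpha> s x z * q z)" for z
        unfolding q_def hardy_potential_def using w k \<Phi>1[of z] by (simp add: ennreal_mult mult_ac)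
      thus ?thesis unfolding P_def by (simp add: nn_integral_cmult)
    qed simp
  qed
  ultimately have "(\<integral>\<^sup>+y. heat_kernel \<alpha> t x y \<partial>lborel)
     + (\<integral>\<^sup>+s\<in>{0<..<t}. (\<integral>\<^sup>+z. heat_kernel \<alpha> s x z * hardy_potential ?k \<alpha> z
           * ennreal ((1 + l * (t - s)) * \<Phi> z) \<partial>lborel) \<partial>lborel)
     \<le> P t ?\<Phi> + L q" by (simp add: add_right_mono)
  also note res
  also have "ennreal (1 + l * t) * ?\<Phi> x = ennreal ((1 + l * t) * \<Phi> x)"
    using l t \<Phi>1[of x] by (simp add: ennreal_mult)
  finally show ?thesis .
qed

end

lemma hardy_potential_measurable[measurable]: "hardy_potential \<kappa> \<alpha> \<in> borel_measurable borel"
  unfolding hardy_potential_def[abs_def] by measurable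

theorem proposition3p2:
  fixes \<alpha> \<delta> \<kappa> :: real
    and p_tilde :: "real \<Rightarrow> real ^ 'n \<Rightarrow> real ^ 'n \<Rightarrow> ennreal"
  assumes "0 < \<alpha>" "\<alpha> < min 2 (real CARD('n))"
    and "\<delta> \<in> {0..(real CARD('n) - \<alpha>) / 2}"
    and "\<kappa> = kappa CARD('n) \<alpha> \<delta>"
    and "p_tilde = schroedinger_perturbation (heat_kernel \<alpha>) (hardy_potential \<kappa> \<alpha>)"
  shows "\<exists>M::real. M \<ge> 1 \<and>
           (\<forall>t x. 0 < t \<longrightarrow> x \<noteq> 0 \<longrightarrow>
              (\<integral>\<^sup>+y. p_tilde t x y \<partial>lborel)
                \<le> ennreal (M * (1 + t powr (\<delta> / \<alpha>) * norm x powr (- \<delta>))))"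
proof (cases "\<delta> = 0")
  case True
  have \<alpha>: "0 < \<alpha>" "\<alpha> < 2" using assms by auto
  \<comment> \<open>For \<delta> = 0 the potential vanishes, so the constant 1 is a
    supersolution.\<close>
  have "(\<integral>\<^sup>+y. p_tilde t x y \<partial>lborel) \<le> 1" if t: "0 < t" and x: "x \<noteq> 0" for t x
    unfolding assms(5)
  proof (rule schroedinger_perturbation_supersolution[where H = "\<lambda>_ _. 1", OF hardy_potential_measurable _ _ t order_refl x])
    fix s :: real and y :: "real ^ 'n" assume "0 < s"
    thus "(\<integral>\<^sup>+z. heat_kernel \<alpha> s y z \<partial>lborel) + (\<integral>\<^sup>+r\<in>{0<..<s}. (\<integral>\<^sup>+z. heat_kernel \<alpha> r y z * hardy_potential \<kappa> \<alpha> z * 1 \<partial>lborel) \<partial>lborel) \<le> 1"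
      using heat_kernel_total_mass[OF \<alpha>, of s y] True assms(4) by (simp add: hardy_potential_def kappa_def)
  qed (simp add: hardy_potential_def)
  moreover have "1 \<le> ennreal (1 * (1 + t powr (\<delta> / \<alpha>) * norm x powr (- \<delta>)))" for t and x :: "real ^ 'n"
    by (subst ennreal_1[symmetric], rule ennreal_leI) simp
  ultimately show ?thesis by (intro exI[of _ 1]) (meson order_refl order_trans)
next
  case False
  have \<alpha>: "0 < \<alpha>" "\<alpha> < 2" using assms by auto
  \<comment> \<open>Any value strictly between 0 and \<delta> would serve.\<close>
  define \<beta> where "\<beta> = \<delta> / 2"
  have d: "0 < \<beta>" "\<beta> < \<delta>" "\<delta> < real CARD('n) - \<alpha>" using False assms by (auto simp: \<beta>_def)
  have "0 < \<kappa>" "kappa CARD('n) \<alpha> \<beta> < \<kappa>"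
    unfolding assms(4) using d assms by (auto intro!: kappa_pos kappa_strict_mono)
  from barrier_inequality[OF \<alpha>(1) d(1,2) this] obtain K where K0: "K > 0" and
    K: "\<And>r. r > 0 \<Longrightarrow> \<kappa> * r powr (- \<alpha>) * (2 + r powr (- \<delta>) - r powr (- \<beta>)) + kappa CARD('n) \<alpha> \<beta> * r powr (- \<beta>) * r powr (- \<alpha>)
      \<le> \<kappa> * r powr (- \<delta>) * r powr (- \<alpha>) + K * (2 + r powr (- \<delta>) - r powr (- \<beta>))" by blast
  \<comment> \<open>At time T the factor 1 + l T = 2 multiplies \<Phi> \<le> 2 +
    R^\<delta>|x|^-\<delta>, and R^\<delta> is the power \<delta> / \<alpha> of 2 K T.\<close>
  define M where "M = 4 + 2 * (2 * K) powr (\<delta> / \<alpha>)"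
  have "(\<integral>\<^sup>+y. p_tilde T x y \<partial>lborel) \<le> ennreal (M * (1 + T powr (\<delta> / \<alpha>) * norm x powr (- \<delta>)))"
    if T: "0 < T" and x: "x \<noteq> 0" for T x
  proof -
    \<comment> \<open>With this \<open>R\<close> the rate 2 K R^-\<alpha> equals 1 / T, the largest
      one for which l t \<le> 1 holds up to time \<open>T\<close>.\<close>
    define R where "R = (2 * K * T) powr (1 / \<alpha>)"
    have R: "R > 0" using K0 T by (simp add: R_def)
    have l: "2 * K * R powr (- \<alpha>) = 1 / T"
      using K0 T \<alpha> by (simp add: R_def powr_powr powr_minus field_simps)
    let ?\<Phi> = "\<lambda>z::real ^ 'n. 2 + R powr \<delta> * norm z powr (- \<delta>) - R powr \<beta> * norm z powr (- \<beta>)"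
    have "(\<integral>\<^sup>+y. p_tilde T x y \<partial>lborel) \<le> ennreal ((1 + 1 / T * T) * ?\<Phi> x)"
      unfolding assms(5)
    proof (rule schroedinger_perturbation_supersolution[where H = "\<lambda>t z. ennreal ((1 + 1 / T * t) * ?\<Phi> z)", OF hardy_potential_measurable _ _ T order_refl x])
      fix t and y :: "real ^ 'n" assume "0 < t" "t \<le> T" "y \<noteq> 0"
      thus "(\<integral>\<^sup>+z. heat_kernel \<alpha> t y z \<partial>lborel) + (\<integral>\<^sup>+s\<in>{0<..<t}. (\<integral>\<^sup>+z. heat_kernel \<alpha> s y z * hardy_potential \<kappa> \<alpha> z
           * ennreal ((1 + 1 / T * (t - s)) * ?\<Phi> z) \<partial>lborel) \<partial>lborel) \<le> ennreal ((1 + 1 / T * t) * ?\<Phi> y)"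
        using barrier_supersolution[OF \<alpha> d K[unfolded assms(4)] K0 R, of t y] T unfolding l assms(4) by simp
    qed (simp add: hardy_potential_def)
    also have "(1 + 1 / T * T) * ?\<Phi> x \<le> M * (1 + T powr (\<delta> / \<alpha>) * norm x powr (- \<delta>))"
    proof -
      have "R powr \<delta> = (2 * K) powr (\<delta> / \<alpha>) * T powr (\<delta> / \<alpha>)"
        using K0 T by (simp add: R_def powr_powr powr_mult)
      moreover have "0 \<le> R powr \<beta> * norm x powr (- \<beta>)" "0 \<le> (2 * K) powr (\<delta> / \<alpha>)" "0 \<le> T powr (\<delta> / \<alpha>) * norm x powr (- \<delta>)"
        by simp_all
      ultimately show ?thesis using T unfolding M_def by (simp add: algebra_simps)
    qed
    finally show ?thesis by (simp add: ennreal_leI)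
  qed
  moreover have "M \<ge> 1" by (simp add: M_def add_increasing2)
  ultimately show ?thesis by blast
qed

end
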